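(* Let $\mathfrak{G}$ be an étale groupoid whose unit space is homeomorphic to the Cantor set. Suppose that $\mathfrak{G}$ is expansive and every $\mathfrak{G}$-orbit has at least $5$ points. Then the group $\mathsf{A}(\mathfrak{G})$ is finitely generated.
   Context: A groupoid $\mathfrak{G}$ is a small category in which every morphism is invertible, identified with its set of morphisms; $\mathsf{s}(\gamma)=\gamma^{-1}\gamma$ and $\mathsf{r}(\gamma)=\gamma\gamma^{-1}$ are the source and range, $\gamma_1\gamma_2$ is defined iff $\mathsf{s}(\gamma_1)=\mathsf{r}(\gamma_2)$, and $\mathfrak{G}^{(0)}$ is the set of units (elements $\gamma\gamma^{-1}$). A topological groupoid is a groupoid with a topology for which multiplication and inversion are continuous (not assumed Hausdorff). A bisection is a compact open subset $F\subset\mathfrak{G}$ such that $\mathsf{s}:F\to\mathsf{s}(F)$ and $\mathsf{r}:F\to\mathsf{r}(F)$ are homeomorphisms onto open subsets of $\mathfrak{G}^{(0)}$. $\mathfrak{G}$ is étale if bisections form a basis of its topology. Throughout, groupoids are étale and $\mathfrak{G}^{(0)}$ is homeomorphic to the Cantor set. Subsets are multiplied by $AB=\{ab: a\in A, b\in B, ab \text{ defined}\}$, and $A^{-1}=\{a^{-1}:a\in A\}$. The $\mathfrak{G}$-orbit of a unit $x$ is $\{\mathsf{r}(\gamma):\mathsf{s}(\gamma)=x\}$. A generating set is a compact set $S\subset\mathfrak{G}$ with $\mathfrak{G}=\bigcup_{n\ge1}(S\cup S^{-1})^n$; $\mathfrak{G}$ is compactly generated if one exists. A finite cover $\mathcal{S}$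 of a compact open generating set $S$ by bisections is expansive if $\bigcup_{n\ge1}(\mathcal{S}\cup\mathcal{S}^{-1})^n$ is a basis of the topology of $\mathfrak{G}$, where $\mathcal{S}^{-1}=\{F^{-1}:F\in\mathcal{S}\}$ and $(\mathcal{S}\cup\mathcal{S}^{-1})^n$ is the set of all products of $n$ bisections from $\mathcal{S}\cup\mathcal{S}^{-1}$. $\mathfrak{G}$ is expansive if it is compactly generated and some compact open generating set of $\mathfrak{G}$ has an expansive finite cover by bisections. The topological full group $\mathsf{F}(\mathfrak{G})$ is the group, under multiplication of subsets, of all bisections $F$ with $\mathsf{s}(F)=\mathsf{r}(F)=\mathfrak{G}^{(0)}$. A multisection of degree $d$ is a collection $\mathcal{F}=\{F_{i,j}\}_{i,j=1}^d$ of $d^2$ bisections such that $F_{i_2,i_3}F_{i_1,i_2}=F_{i_1,i_3}$ for all $i_1,i_2,i_3$ and the $F_{i,i}$ are pairwise disjoint subsets of $\mathfrak{G}^{(0)}$. Its domain is $U=\bigcup_i F_{i,i}$. For a permutation $\pi$ of $\{1,\dots,d\}$ put $\mathcal{F}_\pi=\bigcup_{i=1}^d F_{i,\pi(i)}\cup(\mathfrak{G}^{(0)}\setminus U)\in\mathsf{F}(\mathfrak{G})$, and let $\mathsf{A}(\mathcal{F})=\{\mathcal{F}_\pi:\pi\text{ even}\}$. The group $\mathsf{A}(\mathfrak{G})$ is the subgroup of $\mathsf{F}(\mathfrak{G})$ generated by the union of $\mathsf{A}(\mathcal{F})$ over all multisections $\mathcal{F}$ of degree $3$. *)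

theory Defs
  imports "HOL-Analysis.Analysis" "HOL-Algebra.Generated_Groups" "HOL-Combinatorics.Permutations"
begin

section \<open>Topological groupoids\<close>

text \<open>
  A small category is given by its set of morphisms, every object being identified with its
  identity morphism. The morphisms are the points of the topology \<open>arrows G\<close>; \<open>prd G g h\<close> is the
  product \<open>gh\<close> and is meaningful only when \<open>src G g = rng G h\<close>.
\<close>

record 'a groupoid_data =
  arrows :: "'a topology"
  src :: "'a \<Rightarrow> 'a"
  rng :: "'a \<Rightarrow> 'a"
  prd :: "'a \<Rightarrow> 'a \<Rightarrow> 'a"

abbreviation mor :: "'a groupoid_data \<Rightarrow> 'a set" where
  "mor G \<equiv> topspace (arrows G)"

definition is_inverse :: "'a groupoid_data \<Rightarrow> 'a \<Rightarrow> 'a \<Rightarrow> bool" where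
  "is_inverse G g h \<longleftrightarrow> h \<in> mor G \<and> src G h = rng G g \<and> rng G h = src G g
     \<and> prd G h g = src G g \<and> prd G g h = rng G g"

definition ginv :: "'a groupoid_data \<Rightarrow> 'a \<Rightarrow> 'a" where
  "ginv G g = (THE h. is_inverse G g h)"

locale groupoid =
  fixes G :: "'a groupoid_data"
  assumes src_closed: "g \<in> mor G \<Longrightarrow> src G g \<in> mor G"
    and rng_closed: "g \<in> mor G \<Longrightarrow> rng G g \<in> mor G"
    and src_src: "g \<in> mor G \<Longrightarrow> src G (src G g) = src G g"
    and rng_src: "g \<in> mor G \<Longrightarrow> rng G (src G g) = src G g"
    and src_rng: "g \<in> mor G \<Longrightarrow> src G (rng G g) = rng G g"
    and rng_rng: "g \<in> mor G \<Longrightarrow> rng G (rng G g) = rng G g"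
    and prd_closed: "\<lbrakk>g \<in> mor G; h \<in> mor G; src G g = rng G h\<rbrakk> \<Longrightarrow> prd G g h \<in> mor G"
    and src_prd: "\<lbrakk>g \<in> mor G; h \<in> mor G; src G g = rng G h\<rbrakk> \<Longrightarrow> src G (prd G g h) = src G h"
    and rng_prd: "\<lbrakk>g \<in> mor G; h \<in> mor G; src G g = rng G h\<rbrakk> \<Longrightarrow> rng G (prd G g h) = rng G g"
    and prd_assoc: "\<lbrakk>g \<in> mor G; h \<in> mor G; k \<in> mor G; src G g = rng G h; src G h = rng G k\<rbrakk>
        \<Longrightarrow> prd G (prd G g h) k = prd G g (prd G h k)"
    and prd_src: "g \<in> mor G \<Longrightarrow> prd G g (src G g) = g"
    and rng_prd_id: "g \<in> mor G \<Longrightarrow> prd G (rng G g) g = g"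
    and invertible: "g \<in> mor G \<Longrightarrow> \<exists>h. is_inverse G g h"
begin

lemma is_inverse_unique:
  assumes "g \<in> mor G" "is_inverse G g h" "is_inverse G g k"
  shows "h = k"
proof -
  have "h = prd G h (prd G g k)"
    using assms prd_src[of h] by (simp add: is_inverse_def)
  also have "\<dots> = prd G (prd G h g) k"
    using assms by (subst prd_assoc) (auto simp: is_inverse_def)
  also have "\<dots> = k"
    using assms rng_prd_id[of k] by (simp add: is_inverse_def)
  finally show ?thesis .
qed

lemma is_inverse_ginv:
  assumes "g \<in> mor G"
  shows "is_inverse G g (ginv G g)"
  unfolding ginv_def
  by (rule theI') (use assms invertible is_inverse_unique in blast)

lemma src_eq: "g \<in> mor G \<Longrightarrow> src G g = prd G (ginv G g) g"
  and rng_eq: "g \<in> mor G \<Longrightarrow> rng G g = prd G g (ginv G g)"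
  using is_inverse_ginv by (simp_all add: is_inverse_def)

end

definition units :: "'a groupoid_data \<Rightarrow> 'a set" where
  "units G = {prd G g (ginv G g) |g. g \<in> mor G}"

definition unit_space :: "'a groupoid_data \<Rightarrow> 'a topology" where
  "unit_space G = subtopology (arrows G) (units G)"

definition orbit :: "'a groupoid_data \<Rightarrow> 'a \<Rightarrow> 'a set" where
  "orbit G x = {rng G g |g. g \<in> mor G \<and> src G g = x}"

locale topological_groupoid = groupoid +
  assumes continuous_prd:
    "continuous_map
       (subtopology (prod_topology (arrows G) (arrows G)) {(g, h). src G g = rng G h})
       (arrows G) (\<lambda>(g, h). prd G g h)"
    and continuous_ginv: "continuous_map (arrows G) (arrows G) (ginv G)"

section \<open>Bisections and etale groupoids\<close>

definition bisection :: "'a groupoid_data \<Rightarrow> 'a set \<Rightarrow> bool" where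
  "bisection G F \<longleftrightarrow> compactin (arrows G) F \<and> openin (arrows G) F
     \<and> openin (unit_space G) (src G ` F) \<and> openin (unit_space G) (rng G ` F)
     \<and> homeomorphic_map (subtopology (arrows G) F) (subtopology (unit_space G) (src G ` F)) (src G)
     \<and> homeomorphic_map (subtopology (arrows G) F) (subtopology (unit_space G) (rng G ` F)) (rng G)"

definition is_basis :: "'a topology \<Rightarrow> 'a set set \<Rightarrow> bool" where
  "is_basis T \<B> \<longleftrightarrow> openin T = arbitrary union_of (\<lambda>U. U \<in> \<B>)"

locale etale_groupoid = topological_groupoid +
  assumes bisections_basis: "is_basis (arrows G) {F. bisection G F}"

definition cantor_space :: "(nat \<Rightarrow> bool) topology" where
  "cantor_space = product_topology (\<lambda>_. discrete_topology UNIV) UNIV"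

section \<open>Generating sets and expansivity\<close>

definition subset_prd :: "'a groupoid_data \<Rightarrow> 'a set \<Rightarrow> 'a set \<Rightarrow> 'a set" where
  "subset_prd G A B = {prd G a b |a b. a \<in> A \<and> b \<in> B \<and> src G a = rng G b}"

definition subset_inv :: "'a groupoid_data \<Rightarrow> 'a set \<Rightarrow> 'a set" where
  "subset_inv G A = ginv G ` A"

text \<open>Both powers below are used for exponents at least 1 only; the units are neutral for
  \<open>subset_prd\<close>.\<close>

primrec subset_pow :: "'a groupoid_data \<Rightarrow> 'a set \<Rightarrow> nat \<Rightarrow> 'a set" where
  "subset_pow G A 0 = units G"
| "subset_pow G A (Suc n) = subset_prd G A (subset_pow G A n)"

primrec family_pow :: "'a groupoid_data \<Rightarrow> 'a set set \<Rightarrow> nat \<Rightarrow> 'a set set" where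
  "family_pow G \<A> 0 = {units G}"
| "family_pow G \<A> (Suc n) = {subset_prd G A B |A B. A \<in> \<A> \<and> B \<in> family_pow G \<A> n}"

definition generating_set :: "'a groupoid_data \<Rightarrow> 'a set \<Rightarrow> bool" where
  "generating_set G S \<longleftrightarrow> compactin (arrows G) S
     \<and> mor G = (\<Union>n\<in>{1..}. subset_pow G (S \<union> subset_inv G S) n)"

definition compactly_generated :: "'a groupoid_data \<Rightarrow> bool" where
  "compactly_generated G \<longleftrightarrow> (\<exists>S. generating_set G S)"

definition bisection_cover :: "'a groupoid_data \<Rightarrow> 'a set \<Rightarrow> 'a set set \<Rightarrow> bool" where
  "bisection_cover G S \<C> \<longleftrightarrow> finite \<C> \<and> (\<forall>F\<in>\<C>. bisection G F) \<and> S \<subseteq> \<Union>\<C>"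

definition expansive_family :: "'a groupoid_data \<Rightarrow> 'a set set \<Rightarrow> bool" where
  "expansive_family G \<C> \<longleftrightarrow>
     is_basis (arrows G) (\<Union>n\<in>{1..}. family_pow G (\<C> \<union> subset_inv G ` \<C>) n)"

definition expansive :: "'a groupoid_data \<Rightarrow> bool" where
  "expansive G \<longleftrightarrow> compactly_generated G
     \<and> (\<exists>S \<C>. openin (arrows G) S \<and> generating_set G S
            \<and> bisection_cover G S \<C> \<and> expansive_family G \<C>)"

section \<open>Full groups\<close>

definition full_group :: "'a groupoid_data \<Rightarrow> 'a set monoid" where
  "full_group G =
     \<lparr>carrier = {F. bisection G F \<and> src G ` F = units G \<and> rng G ` F = units G},
      mult = subset_prd G, one = units G\<rparr>"

text \<open>A multisection of degree \<open>d\<close> is a family of sets, of which only the members with both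
  indices in \<open>{1..d}\<close> are relevant. Since \<open>F i j\<close> multiplies as \<open>F j k \<cdot> F i j = F i k\<close>, its
  source is \<open>F i i\<close> and its range is \<open>F j j\<close>.\<close>

definition multisection :: "'a groupoid_data \<Rightarrow> nat \<Rightarrow> (nat \<Rightarrow> nat \<Rightarrow> 'a set) \<Rightarrow> bool" where
  "multisection G d F \<longleftrightarrow>
     (\<forall>i\<in>{1..d}. \<forall>j\<in>{1..d}. bisection G (F i j))
     \<and> (\<forall>i\<in>{1..d}. \<forall>j\<in>{1..d}. \<forall>k\<in>{1..d}. subset_prd G (F j k) (F i j) = F i k)
     \<and> (\<forall>i\<in>{1..d}. F i i \<subseteq> units G)
     \<and> (\<forall>i\<in>{1..d}. \<forall>j\<in>{1..d}. i \<noteq> j \<longrightarrow> F i i \<inter> F j j = {})"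

definition multisection_domain :: "nat \<Rightarrow> (nat \<Rightarrow> nat \<Rightarrow> 'a set) \<Rightarrow> 'a set" where
  "multisection_domain d F = (\<Union>i\<in>{1..d}. F i i)"

definition multisection_perm ::
    "'a groupoid_data \<Rightarrow> nat \<Rightarrow> (nat \<Rightarrow> nat \<Rightarrow> 'a set) \<Rightarrow> (nat \<Rightarrow> nat) \<Rightarrow> 'a set" where
  "multisection_perm G d F \<pi> = (\<Union>i\<in>{1..d}. F i (\<pi> i)) \<union> (units G - multisection_domain d F)"

definition multisection_alt ::
    "'a groupoid_data \<Rightarrow> nat \<Rightarrow> (nat \<Rightarrow> nat \<Rightarrow> 'a set) \<Rightarrow> 'a set set" where
  "multisection_alt G d F = {multisection_perm G d F \<pi> |\<pi>. \<pi> permutes {1..d} \<and> evenperm \<pi>}"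

definition alternating_full_group :: "'a groupoid_data \<Rightarrow> 'a set monoid" where
  "alternating_full_group G = (full_group G)
     \<lparr>carrier := generate (full_group G) (\<Union>F\<in>{F. multisection G 3 F}. multisection_alt G 3 F)\<rparr>"

definition finitely_generated_group :: "('g, 'b) monoid_scheme \<Rightarrow> bool" where
  "finitely_generated_group H \<longleftrightarrow>
     group H \<and> (\<exists>K. finite K \<and> K \<subseteq> carrier H \<and> generate H K = carrier H)"

end

theory Submission
  imports Defs
begin

text \<open>
  Cover the unit space by finitely many disjoint clopen blocks \<open>U\<close>, over each of which five bisections
  with pairwise disjoint ranges are given; one of them is \<open>U\<close> itself. A subgroup \<open>H\<close> of the full group
  controls a clopen set \<open>D\<close> if it contains all three-cycles of the bisections of each block, restricted
  to \<open>D\<close>. The commutator of two three-cycles sharing exactly one bisection, restricted to \<open>V\<close> and \<open>W\<close>,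
  is a three-cycle restricted to \<open>V \<inter> W\<close>; since five points are available, the controlled sets are a
  Boolean algebra. For every bisection \<open>T\<close> finitely many three-cycles in \<open>H\<close> suffice to make controlled sets
  stable under preimages along \<open>T\<close>. Applied to the members of an expansive cover this gives a
  finitely generated \<open>H\<close> that controls the sources of all their products, hence all clopen sets.

  Call a triple of arrows with a common source good if \<open>H\<close> contains the corresponding three-cycle
  restricted to every small clopen neighbourhood of the source. The commutator trick propagates goodness
  along the arrows of the cover, which generate the groupoid, so every triple with distinct ranges is
  good. By compactness \<open>H\<close> contains all three-cycles.
\<close>

text \<open>Finitely many three-cycles involve only finitely many clopen sets, so the obstacle is to
  reach arbitrarily small restrictions. The source of a product \<open>A \<odot> B\<close> is the
  preimage along \<open>B\<close> of the source of \<open>A\<close>. A Boolean algebra of clopen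
  sets that is stable under preimages along an expansive cover and its inverses therefore contains
  the sources of all words, and the words contained in a clopen set of units exhaust that set. The
  number five comes from the identity (a b c)(a d e) = (a b d)(a d e)(a b c), which needs five
  distinct points and, for cycles over two base sets, leaves the cycle (a b d) over their
  intersection. Distinct ranges are a condition on single arrows, whereas a three-cycle needs
  disjoint images over a whole set. Germs bridge the gap, because two bisections through the same
  arrow agree near its source. The groupoid may be neither Hausdorff nor effective. Hence separation
  and complements are used only in the unit space, and elements of the full group are compared by
  their action on arrows.\<close>

section \<open>Groupoids and their bisections\<close>

context groupoid
begin

abbreviation gprd (infixl "\<cdot>" 75) where "g \<cdot> h \<equiv> prd G g h"

declare src_closed [simp] rng_closed [simp] src_src [simp] rng_src [simp] src_rng [simp]
  rng_rng [simp] prd_closed [simp] src_prd [simp] rng_prd [simp] prd_src [simp] rng_prd_id [simp]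

lemma ginv_closed [simp]: "g \<in> mor G \<Longrightarrow> ginv G g \<in> mor G"
  and src_ginv [simp]: "g \<in> mor G \<Longrightarrow> src G (ginv G g) = rng G g"
  and rng_ginv [simp]: "g \<in> mor G \<Longrightarrow> rng G (ginv G g) = src G g"
  and ginv_prd_self [simp]: "g \<in> mor G \<Longrightarrow> ginv G g \<cdot> g = src G g"
  and prd_ginv_self [simp]: "g \<in> mor G \<Longrightarrow> g \<cdot> ginv G g = rng G g"
  using is_inverse_ginv by (simp_all add: is_inverse_def)

lemma ginv_eqI: "g \<in> mor G \<Longrightarrow> is_inverse G g h \<Longrightarrow> ginv G g = h"
  using is_inverse_ginv is_inverse_unique by blast

lemma ginv_ginv [simp]: "g \<in> mor G \<Longrightarrow> ginv G (ginv G g) = g"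
  by (rule ginv_eqI) (simp_all add: is_inverse_def)

lemma prd_cancel_left [simp]:
  assumes "g \<in> mor G" "h \<in> mor G"
  shows "src G g = rng G h \<Longrightarrow> ginv G g \<cdot> (g \<cdot> h) = h"
    and "rng G g = rng G h \<Longrightarrow> g \<cdot> (ginv G g \<cdot> h) = h"
  using assms by (simp_all flip: prd_assoc)

lemma ginv_prd:
  assumes "g \<in> mor G" "h \<in> mor G" "src G g = rng G h"
  shows "ginv G (g \<cdot> h) = ginv G h \<cdot> ginv G g"
  by (rule ginv_eqI) (use assms in \<open>simp_all add: is_inverse_def prd_assoc\<close>)

lemma units_iff: "u \<in> units G \<longleftrightarrow> u \<in> mor G \<and> src G u = u"
proof
  assume "u \<in> units G"
  then obtain g where "g \<in> mor G" "u = g \<cdot> ginv G g"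
    by (auto simp: units_def)
  then show "u \<in> mor G \<and> src G u = u" by simp
next
  assume u: "u \<in> mor G \<and> src G u = u"
  then have "u = ginv G u \<cdot> ginv G (ginv G u)"
    by simp
  with u show "u \<in> units G"
    unfolding units_def using ginv_closed by blast
qed

lemma unitsD [simp]:
  assumes "u \<in> units G"
  shows "u \<in> mor G" "src G u = u" "rng G u = u" "ginv G u = u"
proof -
  show *: "u \<in> mor G" "src G u = u" using assms by (auto simp: units_iff)
  then show "rng G u = u" using rng_src[of u] by simp
  with * show "ginv G u = u"
    using rng_prd_id[of u] by (intro ginv_eqI) (auto simp: is_inverse_def)
qed

lemma src_units [simp]: "g \<in> mor G \<Longrightarrow> src G g \<in> units G"
  and rng_units [simp]: "g \<in> mor G \<Longrightarrow> rng G g \<in> units G"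
  unfolding units_iff by simp_all

lemma units_subset: "units G \<subseteq> mor G"
  by auto

lemma prd_unit_left [simp]: "u \<in> units G \<Longrightarrow> g \<in> mor G \<Longrightarrow> rng G g = u \<Longrightarrow> u \<cdot> g = g"
  and prd_unit_right [simp]: "u \<in> units G \<Longrightarrow> g \<in> mor G \<Longrightarrow> src G g = u \<Longrightarrow> g \<cdot> u = g"
  by auto

end

section \<open>Continuity of source and range\<close>

context topological_groupoid
begin

lemma continuous_map_prd:
  assumes "continuous_map X (arrows G) f" "continuous_map X (arrows G) g"
    and "\<And>x. x \<in> topspace X \<Longrightarrow> src G (f x) = rng G (g x)"
  shows "continuous_map X (arrows G) (\<lambda>x. f x \<cdot> g x)"
proof -
  have "continuous_map X (subtopology (prod_topology (arrows G) (arrows G))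
      {(g, h). src G g = rng G h}) (\<lambda>x. (f x, g x))"
    using assms by (auto simp: continuous_map_in_subtopology continuous_map_paired)
  from continuous_map_compose[OF this continuous_prd] show ?thesis
    by (simp add: o_def)
qed

lemma continuous_map_src: "continuous_map (arrows G) (arrows G) (src G)"
  by (rule continuous_map_eq[where f = "\<lambda>g. ginv G g \<cdot> g"])
    (auto intro!: continuous_map_prd continuous_ginv)

lemma continuous_map_rng: "continuous_map (arrows G) (arrows G) (rng G)"
  by (rule continuous_map_eq[where f = "\<lambda>g. g \<cdot> ginv G g"])
    (auto intro!: continuous_map_prd continuous_ginv)

lemma openin_preimage:
  assumes "openin (arrows G) O'" "openin (arrows G) V"
  shows "openin (arrows G) {g \<in> O'. src G g \<in> V}" "openin (arrows G) {g \<in> O'. rng G g \<in> V}"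
    "openin (arrows G) (ginv G ` O')"
proof -
  have *: "openin (arrows G) (O' \<inter> {g \<in> mor G. f g \<in> V})"
    if "continuous_map (arrows G) (arrows G) f" for f
    using that assms by (auto simp: continuous_map_def)
  have sub: "O' \<subseteq> mor G" using assms(1) openin_subset by blast
  have "{g \<in> O'. src G g \<in> V} = O' \<inter> {g \<in> mor G. src G g \<in> V}"
    "{g \<in> O'. rng G g \<in> V} = O' \<inter> {g \<in> mor G. rng G g \<in> V}"
    using sub by auto
  then show "openin (arrows G) {g \<in> O'. src G g \<in> V}" "openin (arrows G) {g \<in> O'. rng G g \<in> V}"
    using *[OF continuous_map_src] *[OF continuous_map_rng] by simp_all
  have "ginv G ` O' = {g \<in> mor G. ginv G g \<in> O'}"
    using sub by (auto simp: image_iff) (metis ginv_ginv)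
  then show "openin (arrows G) (ginv G ` O')"
    using continuous_ginv assms(1) by (auto simp: continuous_map_def)
qed

end

section \<open>Open source and range maps, and a criterion for bisections\<close>

context etale_groupoid
begin

lemma bisectionD:
  assumes "bisection G F"
  shows "F \<subseteq> mor G" "openin (arrows G) F" "compactin (arrows G) F"
    "inj_on (src G) F" "inj_on (rng G) F"
proof -
  show F: "openin (arrows G) F" "compactin (arrows G) F"
    using assms by (simp_all add: bisection_def)
  show "F \<subseteq> mor G" using F(1) openin_subset by blast
  then have "topspace (subtopology (arrows G) F) = F" by auto
  then show "inj_on (src G) F" "inj_on (rng G) F"
    using assms homeomorphic_imp_injective_map unfolding bisection_def by metis+
qed

lemma openin_Union_bisections:
  assumes "openin (arrows G) O'"
  shows "\<exists>\<U>. (\<forall>F\<in>\<U>. bisection G F) \<and> O' = \<Union>\<U>"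
proof -
  have "(arbitrary union_of (\<lambda>U. U \<in> {F. bisection G F})) O'"
    using bisections_basis assms by (simp add: is_basis_def)
  then show ?thesis
    by (auto simp: union_of_def arbitrary_def)
qed

lemma bisection_nbhd:
  assumes "openin (arrows G) O'" "g \<in> O'"
  obtains F where "bisection G F" "g \<in> F" "F \<subseteq> O'"
  using openin_Union_bisections[OF assms(1)] assms(2) by blast

text \<open>Let \<open>F\<close> be a bisection around a unit. An arrow \<open>g\<close> of
  \<open>F\<close> whose source also lies in \<open>F\<close> has the same source as
  \<open>src G g\<close>, so injectivity of the source on \<open>F\<close> forces \<open>g\<close>
  to be a unit. Such arrows form an open set containing the given unit.\<close>

lemma openin_units: "openin (arrows G) (units G)"
proof (subst openin_subopen, intro ballI)
  fix x assume x: "x \<in> units G"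
  obtain F where F: "bisection G F" "x \<in> F"
    using bisection_nbhd[OF openin_topspace, of x] x by auto
  let ?O = "{g \<in> F. src G g \<in> F}"
  have "openin (arrows G) ?O"
    using F bisectionD openin_preimage by blast
  moreover have "?O \<subseteq> units G"
  proof
    fix g assume g: "g \<in> ?O"
    then have "g \<in> mor G" using bisectionD(1)[OF F(1)] by auto
    moreover from this have "src G g = g"
      using g inj_onD[OF bisectionD(4)[OF F(1)], of "src G g" g] by auto
    ultimately show "g \<in> units G" unfolding units_iff by simp
  qed
  ultimately show "\<exists>T. openin (arrows G) T \<and> x \<in> T \<and> T \<subseteq> units G"
    using F x by (intro exI[of _ ?O]) auto
qed

lemma openin_unit_space: "openin (unit_space G) V \<longleftrightarrow> openin (arrows G) V \<and> V \<subseteq> units G"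
  by (simp add: unit_space_def openin_open_subtopology openin_units)

lemma topspace_unit_space [simp]: "topspace (unit_space G) = units G"
  using units_subset by (auto simp: unit_space_def)

lemma openin_src_image: "openin (arrows G) O' \<Longrightarrow> openin (arrows G) (src G ` O')"
  and openin_rng_image: "openin (arrows G) O' \<Longrightarrow> openin (arrows G) (rng G ` O')"
proof -
  assume O: "openin (arrows G) O'"
  obtain \<U> where U: "\<forall>F\<in>\<U>. bisection G F" "O' = \<Union>\<U>"
    using openin_Union_bisections[OF O] by auto
  have "openin (arrows G) (src G ` F)" "openin (arrows G) (rng G ` F)" if "F \<in> \<U>" for F
    using U(1) that openin_unit_space by (auto simp: bisection_def)
  then show "openin (arrows G) (src G ` O')" "openin (arrows G) (rng G ` O')"
    unfolding U(2) by (auto simp: image_Union intro!: openin_Union)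
qed

lemma homeomorphic_map_open_inj:
  assumes f: "continuous_map (arrows G) (arrows G) f"
    and op: "\<And>O'. openin (arrows G) O' \<Longrightarrow> openin (arrows G) (f ` O')"
    and F: "openin (arrows G) F" "inj_on f F" and fu: "f ` F \<subseteq> units G"
  shows "homeomorphic_map (subtopology (arrows G) F) (subtopology (unit_space G) (f ` F)) f"
proof (rule bijective_open_imp_homeomorphic_map)
  have sub: "F \<subseteq> mor G" "f ` F \<subseteq> mor G"
    using F openin_subset op by blast+
  have eq: "subtopology (unit_space G) (f ` F) = subtopology (arrows G) (f ` F)"
    using fu by (simp add: unit_space_def subtopology_subtopology Int_absorb1)
  show "continuous_map (subtopology (arrows G) F) (subtopology (unit_space G) (f ` F)) f"
    unfolding eq using f by (auto simp: continuous_map_in_subtopology intro: continuous_map_from_subtopology)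
  show "open_map (subtopology (arrows G) F) (subtopology (unit_space G) (f ` F)) f"
    unfolding eq open_map_def using F op
    by (auto simp: openin_open_subtopology)
  show "f ` topspace (subtopology (arrows G) F) = topspace (subtopology (unit_space G) (f ` F))"
    using sub fu by auto
  show "inj_on f (topspace (subtopology (arrows G) F))"
    using F(2) sub by (simp add: Int_absorb1)
qed

lemma compactin_open_inj:
  assumes f: "continuous_map (arrows G) (arrows G) f"
    and op: "\<And>O'. openin (arrows G) O' \<Longrightarrow> openin (arrows G) (f ` O')"
    and F: "openin (arrows G) F" "inj_on f F" and fu: "f ` F \<subseteq> units G"
  shows "compactin (arrows G) F \<longleftrightarrow> compactin (arrows G) (f ` F)"
proof -
  have sub: "F \<subseteq> mor G" "f ` F \<subseteq> mor G"
    using F openin_subset op by blast+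
  have "compact_space (subtopology (arrows G) F)
      \<longleftrightarrow> compact_space (subtopology (unit_space G) (f ` F))"
    using homeomorphic_map_imp_homeomorphic_space[OF homeomorphic_map_open_inj[OF assms]]
    by (rule homeomorphic_compact_space)
  then show ?thesis
    using sub fu by (simp add: compact_space_subtopology compactin_subspace unit_space_def
        subtopology_subtopology Int_absorb1)
qed

text \<open>Source and range are continuous and open, hence homeomorphisms onto their images
  wherever they are injective. Compactness can therefore be tested on the source, that is, inside
  the unit space.\<close>

lemma bisection_iff:
  "bisection G F \<longleftrightarrow> openin (arrows G) F \<and> inj_on (src G) F \<and> inj_on (rng G) F
     \<and> compactin (arrows G) (src G ` F)" (is "?L \<longleftrightarrow> ?R")
proof
  assume ?L
  then show ?R
    using bisectionD image_compactin[OF _ continuous_map_src] by blast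
next
  assume R: ?R
  have F: "F \<subseteq> mor G" using R openin_subset by blast
  note 1 = continuous_map_src openin_src_image conjunct1[OF R]
  note 2 = continuous_map_rng openin_rng_image conjunct1[OF R]
  have su: "src G ` F \<subseteq> units G" "rng G ` F \<subseteq> units G" using F by auto
  show ?L
    unfolding bisection_def openin_unit_space
    using R F su homeomorphic_map_open_inj[OF 1] homeomorphic_map_open_inj[OF 2]
      compactin_open_inj[OF 1] openin_src_image openin_rng_image by blast
qed

end

section \<open>Products of sets of arrows and the partial maps they induce on units\<close>

context groupoid
begin

abbreviation sprd (infixl "\<odot>" 75) where "A \<odot> B \<equiv> subset_prd G A B"

definition restr :: "'a set \<Rightarrow> 'a set \<Rightarrow> 'a set" where
  "restr A V = {a \<in> A. src G a \<in> V}"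

text \<open>For a bisection, \<open>pull\<close> and \<open>push\<close> are preimage and image
  under the partial homeomorphism of the unit space that sends sources to ranges.\<close>

definition pull :: "'a set \<Rightarrow> 'a set \<Rightarrow> 'a set" where
  "pull A V = src G ` {a \<in> A. rng G a \<in> V}"

definition push :: "'a set \<Rightarrow> 'a set \<Rightarrow> 'a set" where
  "push A V = rng G ` {a \<in> A. src G a \<in> V}"

text \<open>For a bisection this inverts the source map on \<open>A\<close>. Outside the source of
  \<open>A\<close> its value is unspecified.\<close>

definition sec :: "'a set \<Rightarrow> 'a \<Rightarrow> 'a" where
  "sec A x = (THE a. a \<in> A \<and> src G a = x)"

lemma in_sprd_iff: "g \<in> A \<odot> B \<longleftrightarrow> (\<exists>a\<in>A. \<exists>b\<in>B. src G a = rng G b \<and> g = a \<cdot> b)"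
  by (auto simp: subset_prd_def)

lemma sprdI: "a \<in> A \<Longrightarrow> b \<in> B \<Longrightarrow> src G a = rng G b \<Longrightarrow> a \<cdot> b \<in> A \<odot> B"
  by (auto simp: in_sprd_iff)

lemma sprdE:
  assumes "g \<in> A \<odot> B"
  obtains a b where "a \<in> A" "b \<in> B" "src G a = rng G b" "g = a \<cdot> b"
  using assms by (auto simp: in_sprd_iff)

lemma sprd_assoc:
  assumes "A \<subseteq> mor G" "B \<subseteq> mor G" "C \<subseteq> mor G"
  shows "A \<odot> B \<odot> C = A \<odot> (B \<odot> C)"
proof (intro equalityI subsetI)
  fix g assume "g \<in> A \<odot> B \<odot> C"
  then obtain a b c where *: "a \<in> A" "b \<in> B" "c \<in> C" "src G a = rng G b" "src G (a \<cdot> b) = rng G c"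
    "g = a \<cdot> b \<cdot> c"
    by (elim sprdE) auto
  moreover have "a \<in> mor G" "b \<in> mor G" "c \<in> mor G" using * assms by auto
  ultimately show "g \<in> A \<odot> (B \<odot> C)"
    by (auto simp: prd_assoc intro!: sprdI)
next
  fix g assume "g \<in> A \<odot> (B \<odot> C)"
  then obtain a b c where *: "a \<in> A" "b \<in> B" "c \<in> C" "src G a = rng G (b \<cdot> c)" "src G b = rng G c"
    "g = a \<cdot> (b \<cdot> c)"
    by (elim sprdE) auto
  moreover have "a \<in> mor G" "b \<in> mor G" "c \<in> mor G" using * assms by auto
  ultimately show "g \<in> A \<odot> B \<odot> C"
    by (auto simp flip: prd_assoc intro!: sprdI)
qed

lemma units_sprd [simp]: "A \<subseteq> mor G \<Longrightarrow> units G \<odot> A = A"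
  and sprd_units [simp]: "A \<subseteq> mor G \<Longrightarrow> A \<odot> units G = A"
proof -
  assume A: "A \<subseteq> mor G"
  show "units G \<odot> A = A"
  proof (intro equalityI subsetI)
    fix a assume "a \<in> A"
    then show "a \<in> units G \<odot> A"
      using A sprdI[of "rng G a" "units G" a A] by (auto simp: subset_iff)
  qed (use A in \<open>auto simp: in_sprd_iff subset_iff\<close>)
  show "A \<odot> units G = A"
  proof (intro equalityI subsetI)
    fix a assume "a \<in> A"
    then show "a \<in> A \<odot> units G"
      using A sprdI[of a A "src G a" "units G"] by (auto simp: subset_iff)
  qed (use A in \<open>auto simp: in_sprd_iff subset_iff\<close>)
qed

lemma sprd_closed: "A \<subseteq> mor G \<Longrightarrow> B \<subseteq> mor G \<Longrightarrow> A \<odot> B \<subseteq> mor G"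
  by (auto simp: in_sprd_iff subset_iff)

lemma sprd_ginv:
  assumes "A \<subseteq> mor G"
  shows "inj_on (rng G) A \<Longrightarrow> ginv G ` A \<odot> A = src G ` A"
    and "inj_on (src G) A \<Longrightarrow> A \<odot> ginv G ` A = rng G ` A"
proof -
  have *: "a \<in> mor G" if "a \<in> A" for a using that assms by auto
  show "ginv G ` A \<odot> A = src G ` A" if "inj_on (rng G) A"
  proof (intro equalityI subsetI)
    fix g assume "g \<in> ginv G ` A \<odot> A"
    then obtain a b where "a \<in> A" "b \<in> A" "rng G a = rng G b" "g = ginv G a \<cdot> b"
      using * by (auto elim!: sprdE)
    moreover from this have "a = b" using that by (auto dest: inj_onD)
    ultimately show "g \<in> src G ` A" using * by auto
  next
    fix g assume "g \<in> src G ` A"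
    then obtain a where "a \<in> A" "g = src G a" by auto
    then show "g \<in> ginv G ` A \<odot> A" using * sprdI[of "ginv G a" "ginv G ` A" a A] by simp
  qed
  show "A \<odot> ginv G ` A = rng G ` A" if "inj_on (src G) A"
  proof (intro equalityI subsetI)
    fix g assume "g \<in> A \<odot> ginv G ` A"
    then obtain a b where "a \<in> A" "b \<in> A" "src G a = src G b" "g = a \<cdot> ginv G b"
      using * by (auto elim!: sprdE)
    moreover from this have "a = b" using that by (auto dest: inj_onD)
    ultimately show "g \<in> rng G ` A" using * by auto
  next
    fix g assume "g \<in> rng G ` A"
    then obtain a where "a \<in> A" "g = rng G a" by auto
    then show "g \<in> A \<odot> ginv G ` A" using * sprdI[of a A "ginv G a" "ginv G ` A"] by simp
  qed
qed

text \<open>A product acts through \<open>B\<close> first, so preimages compose in the opposite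
  order. Applied to \<open>units G\<close> this computes the source of a product, which links words
  in a cover to sets stable under \<open>pull\<close>.\<close>

lemma pull_sprd:
  assumes "A \<subseteq> mor G" "B \<subseteq> mor G"
  shows "pull (A \<odot> B) V = pull B (pull A V)"
proof -
  have *: "a \<in> mor G" if "a \<in> A \<or> a \<in> B" for a using that assms by auto
  show ?thesis
  proof (intro equalityI subsetI)
    fix x assume "x \<in> pull (A \<odot> B) V"
    then obtain g where "g \<in> A \<odot> B" "rng G g \<in> V" "x = src G g"
      by (auto simp: pull_def)
    then obtain a b where "a \<in> A" "b \<in> B" "src G a = rng G b" "rng G (a \<cdot> b) \<in> V" "x = src G (a \<cdot> b)"
      by (auto elim: sprdE)
    moreover from this have "a \<in> mor G" "b \<in> mor G" using * by auto
    ultimately show "x \<in> pull B (pull A V)"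
      unfolding pull_def by (intro image_eqI[of _ _ b]) (auto intro!: image_eqI[of _ _ a])
  next
    fix x assume "x \<in> pull B (pull A V)"
    then obtain a b where "a \<in> A" "b \<in> B" "rng G b = src G a" "rng G a \<in> V" "x = src G b"
      by (auto simp: pull_def)
    then show "x \<in> pull (A \<odot> B) V"
      using * unfolding pull_def by (intro image_eqI[of _ _ "a \<cdot> b"]) (auto intro!: sprdI)
  qed
qed

end

context etale_groupoid
begin

lemma bisection_subset_mor: "bisection G A \<Longrightarrow> a \<in> A \<Longrightarrow> a \<in> mor G"
  using bisectionD by blast

lemma sec_eq: "bisection G A \<Longrightarrow> a \<in> A \<Longrightarrow> sec A (src G a) = a"
  unfolding sec_def by (rule the_equality) (auto dest: bisectionD(4) inj_onD)

lemma sec [simp]: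
  assumes "bisection G A" "x \<in> src G ` A"
  shows "sec A x \<in> A" "sec A x \<in> mor G" "src G (sec A x) = x"
  using assms sec_eq bisection_subset_mor by auto

lemma sec_inj: "bisection G A \<Longrightarrow> x \<in> src G ` A \<Longrightarrow> y \<in> src G ` A
    \<Longrightarrow> rng G (sec A x) = rng G (sec A y) \<Longrightarrow> x = y"
  using inj_onD[OF bisectionD(5), of A "sec A x" "sec A y"] sec(1,3) by metis

lemma bisection_mono:
  assumes "bisection G A" "openin (arrows G) B" "B \<subseteq> A" "compactin (arrows G) (src G ` B)"
  shows "bisection G B"
  using assms inj_on_subset unfolding bisection_iff by blast

text \<open>An arrow \<open>h\<close> whose range is a range of \<open>A\<close> determines the
  unique \<open>a\<close> in \<open>A\<close> with the same range, and \<open>h\<close> lies in the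
  product iff the inverse of \<open>a\<close> times \<open>h\<close> lies in \<open>B\<close>. The
  product is thus the preimage of \<open>B\<close> under a continuous map defined on an open
  set.\<close>

lemma openin_sprd_bisection:
  assumes A: "bisection G A" and B: "openin (arrows G) B"
  shows "openin (arrows G) (A \<odot> B)"
proof -
  define \<alpha> where "\<alpha> = inv_into A (rng G)"
  have Am: "\<And>a. a \<in> A \<Longrightarrow> a \<in> mor G" and Bm: "\<And>b. b \<in> B \<Longrightarrow> b \<in> mor G"
    using A B bisection_subset_mor openin_subset by blast+
  have \<alpha>: "\<alpha> (rng G a) = a" if "a \<in> A" for a
    using that bisectionD(5)[OF A] by (simp add: \<alpha>_def)
  have op: "openin (arrows G) (rng G ` A)"
    using A bisectionD openin_rng_image by blast
  have \<alpha>c: "continuous_map (subtopology (arrows G) (rng G ` A)) (arrows G) \<alpha>"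
    unfolding continuous_map_def
  proof (intro conjI allI impI)
    show "\<alpha> \<in> topspace (subtopology (arrows G) (rng G ` A)) \<rightarrow> mor G"
      using \<alpha> Am by auto
    fix O' assume O': "openin (arrows G) O'"
    have "{y \<in> topspace (subtopology (arrows G) (rng G ` A)). \<alpha> y \<in> O'} = rng G ` (A \<inter> O')"
      using \<alpha> Am by auto
    moreover have "openin (arrows G) (rng G ` (A \<inter> O'))"
      using O' bisectionD(2)[OF A] openin_rng_image by blast
    ultimately show "openin (subtopology (arrows G) (rng G ` A))
        {y \<in> topspace (subtopology (arrows G) (rng G ` A)). \<alpha> y \<in> O'}"
      using op by (auto simp: openin_open_subtopology)
  qed
  define D where "D = {h \<in> mor G. rng G h \<in> rng G ` A}"
  have D: "openin (arrows G) D"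
    unfolding D_def by (rule openin_preimage) (use op in auto)
  then have tD: "topspace (subtopology (arrows G) D) = D"
    by (auto simp: D_def)
  have "continuous_map (subtopology (arrows G) D) (subtopology (arrows G) (rng G ` A)) (rng G)"
    using continuous_map_from_subtopology[OF continuous_map_rng] tD
    by (auto simp: continuous_map_in_subtopology D_def)
  then have c1: "continuous_map (subtopology (arrows G) D) (arrows G) (\<lambda>h. ginv G (\<alpha> (rng G h)))"
    using continuous_map_compose[OF _ continuous_map_compose[OF \<alpha>c continuous_ginv]]
    by (fastforce simp: o_def)
  have c: "continuous_map (subtopology (arrows G) D) (arrows G) (\<lambda>h. ginv G (\<alpha> (rng G h)) \<cdot> h)"
    by (rule continuous_map_prd[OF c1])
      (auto simp: tD D_def \<alpha> Am continuous_map_from_subtopology)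
  have "A \<odot> B = {h \<in> topspace (subtopology (arrows G) D). ginv G (\<alpha> (rng G h)) \<cdot> h \<in> B}"
    unfolding tD
  proof (intro equalityI subsetI)
    fix h assume "h \<in> A \<odot> B"
    then show "h \<in> {h \<in> D. ginv G (\<alpha> (rng G h)) \<cdot> h \<in> B}"
      using Am Bm by (auto elim!: sprdE simp: \<alpha> D_def)
  next
    fix h assume "h \<in> {h \<in> D. ginv G (\<alpha> (rng G h)) \<cdot> h \<in> B}"
    then obtain a where a: "a \<in> A" "h \<in> mor G" "rng G h = rng G a" "ginv G a \<cdot> h \<in> B"
      by (auto simp: D_def \<alpha>)
    then have "a \<cdot> (ginv G a \<cdot> h) \<in> A \<odot> B"
      by (intro sprdI) (use a Am in auto)
    then show "h \<in> A \<odot> B" using prd_cancel_left(2)[of a h] a Am by simp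
  qed
  also have "openin (arrows G) \<dots>"
    using c B D unfolding continuous_map_def by (auto simp: openin_open_subtopology)
  finally show ?thesis .
qed

end

section \<open>Clopen sets of units and the bisections over them\<close>

locale compact_etale_groupoid = etale_groupoid +
  assumes compact_unit_space: "compact_space (unit_space G)"
    and Hausdorff_unit_space: "Hausdorff_space (unit_space G)"
begin

definition clop :: "'a set \<Rightarrow> bool" where
  "clop V \<longleftrightarrow> openin (unit_space G) V \<and> closedin (unit_space G) V"

lemma clop_units [simp]: "clop (units G)"
  and clop_empty [simp]: "clop {}"
  and clop_Un [simp]: "clop V \<Longrightarrow> clop W \<Longrightarrow> clop (V \<union> W)"
  and clop_Int [simp]: "clop V \<Longrightarrow> clop W \<Longrightarrow> clop (V \<inter> W)"
  and clop_Diff [simp]: "clop V \<Longrightarrow> clop W \<Longrightarrow> clop (V - W)"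
  unfolding clop_def using openin_topspace[of "unit_space G"] closedin_topspace[of "unit_space G"]
  by (auto intro: openin_diff closedin_diff)

text \<open>In the compact Hausdorff unit space closed means compact. Unlike closedness, compactness
  does not depend on the ambient space, so clopen sets can be handled inside the space of arrows,
  which may fail to be Hausdorff.\<close>

lemma clop_iff: "clop V \<longleftrightarrow> V \<subseteq> units G \<and> openin (arrows G) V \<and> compactin (arrows G) V"
proof -
  have "compactin (unit_space G) V \<longleftrightarrow> closedin (unit_space G) V"
    using compact_unit_space Hausdorff_unit_space closedin_compact_space compactin_imp_closedin
    by blast
  moreover have "compactin (unit_space G) V \<longleftrightarrow> V \<subseteq> units G \<and> compactin (arrows G) V"
    by (auto simp: unit_space_def compactin_subtopology)
  ultimately show ?thesis
    by (auto simp: clop_def openin_unit_space)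
qed

lemma clop_subset: "clop V \<Longrightarrow> V \<subseteq> units G"
  by (simp add: clop_iff)

lemma inj_on_units: "inj_on (src G) (units G)" "inj_on (rng G) (units G)"
  by (auto simp: inj_on_def)

lemma src_image_units [simp]: "V \<subseteq> units G \<Longrightarrow> src G ` V = V"
  and rng_image_units [simp]: "V \<subseteq> units G \<Longrightarrow> rng G ` V = V"
  by (force simp: subset_iff image_iff)+

lemma bisection_clop: "clop V \<Longrightarrow> bisection G V"
  using inj_on_subset[OF inj_on_units(1)] inj_on_subset[OF inj_on_units(2)]
  by (simp add: clop_iff bisection_iff)

lemma clop_bisection: "bisection G V \<Longrightarrow> V \<subseteq> units G \<Longrightarrow> clop V"
  using bisectionD by (simp add: clop_iff)

lemma bisection_units [simp]: "bisection G (units G)"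
  by (simp add: bisection_clop)

lemma sec_units [simp]: "x \<in> units G \<Longrightarrow> sec (units G) x = x"
  using sec_eq[OF bisection_units, of x] by simp

lemma clop_src [simp]: "bisection G A \<Longrightarrow> clop (src G ` A)"
  and clop_rng [simp]: "bisection G A \<Longrightarrow> clop (rng G ` A)"
  using openin_src_image openin_rng_image bisectionD[of A]
    image_compactin[OF _ continuous_map_src, of A] image_compactin[OF _ continuous_map_rng, of A]
  by (auto simp: clop_iff)

text \<open>A bisection contained in the open set of units is clopen there, so the basis of
  bisections makes the unit space zero-dimensional.\<close>

lemma clop_nbhd:
  assumes "openin (arrows G) O'" "x \<in> O'" "x \<in> units G"
  obtains V where "clop V" "x \<in> V" "V \<subseteq> O'"
proof -
  obtain F where "bisection G F" "x \<in> F" "F \<subseteq> O' \<inter> units G"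
    using bisection_nbhd[of "O' \<inter> units G" x] assms openin_units by blast
  with clop_bisection[of F] that show thesis by auto
qed

lemma src_restr: "src G ` restr A V = src G ` A \<inter> V"
  by (auto simp: restr_def)

lemma bisection_restr [simp]:
  assumes "bisection G A" "clop V"
  shows "bisection G (restr A V)"
proof (rule bisection_mono[OF assms(1)])
  show "openin (arrows G) (restr A V)"
    unfolding restr_def using assms by (intro openin_preimage) (auto simp: clop_iff bisectionD)
  show "compactin (arrows G) (src G ` restr A V)"
    unfolding src_restr using clop_Int[OF clop_src[OF assms(1)] assms(2)] clop_iff by blast
qed (auto simp: restr_def)

lemma bisection_ginv [simp]:
  assumes "bisection G A"
  shows "bisection G (ginv G ` A)"
proof -
  note A = bisectionD[OF assms]
  have "inj_on (src G) (ginv G ` A)" "inj_on (rng G) (ginv G ` A)" "src G ` ginv G ` A = rng G ` A"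
    using A(1,4,5) by (auto simp: inj_on_def subset_iff image_iff)
  moreover have "openin (arrows G) (ginv G ` A)"
    using A(2) openin_preimage by blast
  ultimately show ?thesis
    using clop_rng[OF assms] by (auto simp: bisection_iff clop_iff)
qed

lemma src_ginv_image: "A \<subseteq> mor G \<Longrightarrow> src G ` ginv G ` A = rng G ` A"
  and rng_ginv_image: "A \<subseteq> mor G \<Longrightarrow> rng G ` ginv G ` A = src G ` A"
  by (auto simp: image_iff subset_iff)

lemma clop_push [simp]:
  assumes "bisection G A" "clop V"
  shows "clop (push A V)"
proof -
  have "push A V = rng G ` restr A V" by (auto simp: push_def restr_def)
  then show ?thesis using assms by simp
qed

lemma push_ginv:
  assumes "A \<subseteq> mor G"
  shows "push (ginv G ` A) V = pull A V"
proof -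
  have eq: "{a \<in> ginv G ` A. src G a \<in> V} = ginv G ` {a \<in> A. rng G a \<in> V}"
    using assms by (auto simp: subset_iff)
  show ?thesis
    unfolding pull_def push_def eq by (rule rng_ginv_image) (use assms in auto)
qed

lemma clop_pull [simp]:
  assumes "bisection G A" "clop V"
  shows "clop (pull A V)"
  using clop_push[OF bisection_ginv] push_ginv[of A V] assms bisectionD(1) by metis

lemma pull_units: "A \<subseteq> mor G \<Longrightarrow> pull A (units G) = src G ` A"
  by (auto simp: pull_def subset_iff image_iff)

lemma src_sprd: "A \<subseteq> mor G \<Longrightarrow> B \<subseteq> mor G \<Longrightarrow> src G ` (A \<odot> B) = pull B (src G ` A)"
proof -
  assume A: "A \<subseteq> mor G" and B: "B \<subseteq> mor G"
  show ?thesis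
    using pull_sprd[OF A B, of "units G"] unfolding pull_units[OF A] pull_units[OF sprd_closed[OF A B]] .
qed

lemma bisection_sprd [simp]:
  assumes A: "bisection G A" and B: "bisection G B"
  shows "bisection G (A \<odot> B)"
proof -
  note AD = bisectionD[OF A] and BD = bisectionD[OF B]
  have m: "a \<in> mor G" if "a \<in> A \<or> a \<in> B" for a using that AD(1) BD(1) by auto
  have "inj_on (src G) (A \<odot> B)"
  proof (rule inj_onI)
    fix g h assume gh: "g \<in> A \<odot> B" "h \<in> A \<odot> B" "src G g = src G h"
    obtain a b where ab: "a \<in> A" "b \<in> B" "src G a = rng G b" "g = a \<cdot> b"
      using gh(1) by (rule sprdE)
    obtain a' b' where ab': "a' \<in> A" "b' \<in> B" "src G a' = rng G b'" "h = a' \<cdot> b'"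
      using gh(2) by (rule sprdE)
    have "src G b = src G b'"
      using gh(3) ab ab' m src_prd by metis
    with ab ab' have "b = b'"
      by (metis inj_onD[OF BD(4)])
    moreover from this ab ab' have "a = a'"
      by (metis inj_onD[OF AD(4)])
    ultimately show "g = h" using ab ab' by simp
  qed
  moreover have "inj_on (rng G) (A \<odot> B)"
  proof (rule inj_onI)
    fix g h assume gh: "g \<in> A \<odot> B" "h \<in> A \<odot> B" "rng G g = rng G h"
    obtain a b where ab: "a \<in> A" "b \<in> B" "src G a = rng G b" "g = a \<cdot> b"
      using gh(1) by (rule sprdE)
    obtain a' b' where ab': "a' \<in> A" "b' \<in> B" "src G a' = rng G b'" "h = a' \<cdot> b'"
      using gh(2) by (rule sprdE)
    have "rng G a = rng G a'"
      using gh(3) ab ab' m rng_prd by metis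
    with ab ab' have "a = a'"
      by (metis inj_onD[OF AD(5)])
    moreover from this ab ab' have "b = b'"
      by (metis inj_onD[OF BD(5)])
    ultimately show "g = h" using ab ab' by simp
  qed
  moreover have "compactin (arrows G) (src G ` (A \<odot> B))"
    unfolding src_sprd[OF AD(1) BD(1)] using clop_pull[OF B clop_src[OF A]] by (auto simp: clop_iff)
  ultimately show ?thesis
    using openin_sprd_bisection[OF A BD(2)] by (simp add: bisection_iff)
qed

lemma sec_sprd:
  assumes "bisection G A" "bisection G B" "x \<in> src G ` B" "rng G (sec B x) \<in> src G ` A"
  shows "sec (A \<odot> B) x = sec A (rng G (sec B x)) \<cdot> sec B x"
proof -
  have "sec A (rng G (sec B x)) \<cdot> sec B x \<in> A \<odot> B"
    using assms by (intro sprdI) auto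
  from sec_eq[OF bisection_sprd[OF assms(1,2)] this] show ?thesis
    using assms by simp
qed

lemma bisection_Un:
  assumes "bisection G A" "bisection G B" "src G ` A \<inter> src G ` B = {}" "rng G ` A \<inter> rng G ` B = {}"
  shows "bisection G (A \<union> B)"
  using assms clop_Un[OF clop_src clop_src, of A B]
  by (fastforce simp: bisection_iff clop_iff inj_on_Un image_Un)

section \<open>The full group\<close>

abbreviation FG where "FG \<equiv> full_group G"

lemma full_group_simps [simp]: "mult FG = subset_prd G" "one FG = units G"
  by (simp_all add: full_group_def)

lemma in_full_group: "F \<in> carrier FG \<longleftrightarrow> bisection G F \<and> src G ` F = units G \<and> rng G ` F = units G"
  by (simp add: full_group_def)

lemma full_group_group: "group FG"
proof (rule groupI)
  fix A B assume A: "A \<in> carrier FG" and B: "B \<in> carrier FG"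
  then have bA: "bisection G A" and bB: "bisection G B" by (auto simp: in_full_group)
  note m = bisectionD(1)[OF bA] bisectionD(1)[OF bB]
  have "src G ` (A \<odot> B) = units G" "rng G ` (A \<odot> B) = units G"
  proof -
    show "src G ` (A \<odot> B) = units G"
      using A B m by (simp add: src_sprd pull_units in_full_group)
    show "rng G ` (A \<odot> B) = units G"
    proof (intro equalityI subsetI)
      fix x assume "x \<in> units G"
      then obtain a where a: "a \<in> A" "x = rng G a" using A by (auto simp: in_full_group)
      then have "src G a \<in> rng G ` B" using A B m by (auto simp: in_full_group)
      then obtain b where "b \<in> B" "src G a = rng G b" by auto
      with a m show "x \<in> rng G ` (A \<odot> B)"
        by (intro image_eqI[of _ _ "a \<cdot> b"]) (auto intro: sprdI simp: subset_iff)
    qed (use m sprd_closed[OF m] in auto)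
  qed
  then show "A \<otimes>\<^bsub>FG\<^esub> B \<in> carrier FG"
    using bA bB by (simp add: in_full_group)
next
  fix A B C assume "A \<in> carrier FG" "B \<in> carrier FG" "C \<in> carrier FG"
  then show "A \<otimes>\<^bsub>FG\<^esub> B \<otimes>\<^bsub>FG\<^esub> C = A \<otimes>\<^bsub>FG\<^esub> (B \<otimes>\<^bsub>FG\<^esub> C)"
    using sprd_assoc bisectionD(1) by (simp add: in_full_group)
next
  fix A assume A: "A \<in> carrier FG"
  then show "\<one>\<^bsub>FG\<^esub> \<otimes>\<^bsub>FG\<^esub> A = A"
    using bisectionD(1) by (simp add: in_full_group)
  have b: "bisection G A" using A by (simp add: in_full_group)
  then have "ginv G ` A \<in> carrier FG" "ginv G ` A \<odot> A = units G"
    using A sprd_ginv(1)[of A] bisectionD(1,5)[OF b] src_ginv_image[of A] rng_ginv_image[of A]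
    by (auto simp: in_full_group)
  then show "\<exists>B\<in>carrier FG. B \<otimes>\<^bsub>FG\<^esub> A = \<one>\<^bsub>FG\<^esub>" by auto
qed (simp add: in_full_group)

sublocale FG: group FG by (rule full_group_group)

section \<open>Localized three-cycles\<close>

lemma push_eq: "bisection G A \<Longrightarrow> V \<subseteq> src G ` A \<Longrightarrow> push A V = (\<lambda>x. rng G (sec A x)) ` V"
proof -
  assume A: "bisection G A" "V \<subseteq> src G ` A"
  have "{a \<in> A. src G a \<in> V} = sec A ` V"
    using A sec_eq[OF A(1)] by (auto simp: image_iff subset_iff) (metis sec(1,3) imageI)+
  then show ?thesis by (auto simp: push_def)
qed

lemma in_pushI: "bisection G A \<Longrightarrow> x \<in> V \<Longrightarrow> x \<in> src G ` A \<Longrightarrow> rng G (sec A x) \<in> push A V"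
  unfolding push_def by (intro imageI) simp

lemma push_mono: "V \<subseteq> W \<Longrightarrow> push A V \<subseteq> push A W"
  by (auto simp: push_def)

text \<open>Disjointness is asked of the images of the whole set \<open>U\<close>, which is stronger
  than distinct ranges over each point. It gives the pieces of a three-cycle over \<open>U\<close>
  disjoint sources and disjoint ranges.\<close>

primrec indep :: "'a set \<Rightarrow> 'a set list \<Rightarrow> bool" where
  "indep U [] = clop U"
| "indep U (A # As) = (bisection G A \<and> U \<subseteq> src G ` A
     \<and> (\<forall>B\<in>set As. push A U \<inter> push B U = {}) \<and> indep U As)"

lemma indep_clop: "indep U As \<Longrightarrow> clop U"
  by (induction As) auto

lemma indep_mono: "indep U As \<Longrightarrow> clop V \<Longrightarrow> V \<subseteq> U \<Longrightarrow> indep V As"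
  by (induction As) (use push_mono in \<open>simp; blast\<close>)+

text \<open>This is the product of \<open>B\<close> over \<open>V\<close> with the inverse of
  \<open>A\<close> over \<open>V\<close>. The pointwise form shows that only the sections of
  \<open>A\<close> and \<open>B\<close> over \<open>V\<close> matter.\<close>

definition mv :: "'a set \<Rightarrow> 'a set \<Rightarrow> 'a set \<Rightarrow> 'a set" where
  "mv A B V = (\<lambda>x. sec B x \<cdot> ginv G (sec A x)) ` V"

lemma mv_bisection:
  assumes A: "bisection G A" and B: "bisection G B" and V: "clop V"
    and sub: "V \<subseteq> src G ` A" "V \<subseteq> src G ` B"
  shows "bisection G (mv A B V)" "src G ` mv A B V = push A V" "rng G ` mv A B V = push B V"
proof -
  have V': "x \<in> src G ` A" "x \<in> src G ` B" if "x \<in> V" for x using that sub by auto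
  have eq: "mv A B V = restr B V \<odot> ginv G ` restr A V"
  proof (intro equalityI subsetI)
    fix g assume "g \<in> mv A B V"
    then obtain x where x: "x \<in> V" "g = sec B x \<cdot> ginv G (sec A x)" by (auto simp: mv_def)
    show "g \<in> restr B V \<odot> ginv G ` restr A V"
      unfolding x(2) by (rule sprdI) (use x V' A B in \<open>auto simp: restr_def\<close>)
  next
    fix g assume "g \<in> restr B V \<odot> ginv G ` restr A V"
    then obtain b a where ab: "b \<in> restr B V" "a \<in> restr A V" "src G b = rng G (ginv G a)" "g = b \<cdot> ginv G a"
      by (auto elim!: sprdE)
    moreover have "a \<in> mor G" using ab(2) bisection_subset_mor[OF A] by (auto simp: restr_def)
    ultimately have "src G b = src G a" "a \<in> A" "b \<in> B" "src G a \<in> V" by (auto simp: restr_def)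
    then show "g \<in> mv A B V"
      using sec_eq[OF A, of a] sec_eq[OF B, of b] ab(4) unfolding mv_def by (intro image_eqI) auto
  qed
  show "bisection G (mv A B V)"
    unfolding eq by (intro bisection_sprd bisection_ginv bisection_restr A B V)
  show "src G ` mv A B V = push A V" "rng G ` mv A B V = push B V"
    unfolding push_eq[OF A sub(1)] push_eq[OF B sub(2)] mv_def image_image
    using V' A B by (auto intro!: image_cong)
qed

text \<open>The element acting as the cycle \<open>A \<rightarrow> B \<rightarrow> C \<rightarrow> A\<close> over \<open>V\<close>; it lies in the full group only if
  \<open>indep V [A, B, C]\<close>.\<close>

definition c3 :: "'a set \<Rightarrow> 'a set \<Rightarrow> 'a set \<Rightarrow> 'a set \<Rightarrow> 'a set" where
  "c3 A B C V = mv A B V \<union> mv B C V \<union> mv C A V \<union> (units G - (push A V \<union> push B V \<union> push C V))"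

lemma c3_rotate: "c3 A B C V = c3 B C A V"
  by (auto simp: c3_def)

text \<open>This is what makes germs of three-cycles well defined: over \<open>V\<close> the
  bisections enter only through their sections.\<close>

lemma c3_cong:
  assumes "\<And>x. x \<in> V \<Longrightarrow> sec A x = sec A' x" "\<And>x. x \<in> V \<Longrightarrow> sec B x = sec B' x"
    "\<And>x. x \<in> V \<Longrightarrow> sec C x = sec C' x"
    "indep V [A, B, C]" "indep V [A', B', C']"
  shows "c3 A B C V = c3 A' B' C' V"
  using assms by (simp add: c3_def mv_def push_eq cong: image_cong_simp)

lemma c3_empty [simp]: "c3 A B C {} = units G"
  by (simp add: c3_def mv_def push_def)

lemma c3_closed:
  assumes "indep V [A, B, C]"
  shows "c3 A B C V \<in> carrier FG"
proof -
  have A: "bisection G A" "V \<subseteq> src G ` A" and B: "bisection G B" "V \<subseteq> src G ` B"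
    and C: "bisection G C" "V \<subseteq> src G ` C" and V: "clop V"
    and dis: "push A V \<inter> push B V = {}" "push A V \<inter> push C V = {}" "push B V \<inter> push C V = {}"
    using assms by auto
  let ?R = "units G - (push A V \<union> push B V \<union> push C V)"
  have R: "bisection G ?R" "src G ` ?R = ?R" "rng G ` ?R = ?R"
    using A B C V by (auto intro!: bisection_clop src_image_units rng_image_units)
  note AB = mv_bisection[OF A(1) B(1) V A(2) B(2)]
  note BC = mv_bisection[OF B(1) C(1) V B(2) C(2)]
  note CA = mv_bisection[OF C(1) A(1) V C(2) A(2)]
  have sub: "push A V \<subseteq> units G" "push B V \<subseteq> units G" "push C V \<subseteq> units G"
    using clop_subset[OF clop_push] A B C V by blast+
  have "bisection G (mv A B V \<union> mv B C V)"
    by (rule bisection_Un[OF AB(1) BC(1)]; unfold AB BC; use dis in blast)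
  then have "bisection G (mv A B V \<union> mv B C V \<union> mv C A V)"
    by (rule bisection_Un[OF _ CA(1)]; unfold AB BC CA image_Un; use dis in blast)
  then have "bisection G (c3 A B C V)"
    unfolding c3_def by (rule bisection_Un[OF _ R(1)]; unfold AB BC CA R image_Un; blast)
  moreover have "src G ` c3 A B C V = units G" "rng G ` c3 A B C V = units G"
    unfolding c3_def image_Un AB BC CA R using sub by blast+
  ultimately show ?thesis
    by (simp add: in_full_group)
qed

text \<open>Left multiplication by the arrow of \<open>F\<close> that starts at the range of
  \<open>g\<close>. Arrows are acted on rather than units, because distinct elements of the full
  group may induce the same map on units when the groupoid is not effective.\<close>

definition act :: "'a set \<Rightarrow> 'a \<Rightarrow> 'a" where
  "act F g = sec F (rng G g) \<cdot> g"

lemma act_simps [simp]: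
  assumes "F \<in> carrier FG" "g \<in> mor G"
  shows "act F g \<in> mor G" "src G (act F g) = src G g" "rng G (act F g) = rng G (sec F (rng G g))"
  using assms by (auto simp: act_def in_full_group)

lemma act_sprd:
  assumes F: "F \<in> carrier FG" and F': "F' \<in> carrier FG" and g: "g \<in> mor G"
  shows "act (F \<odot> F') g = act F (act F' g)"
proof -
  have *: "bisection G F" "bisection G F'" "src G ` F = units G" "src G ` F' = units G"
    using F F' by (auto simp: in_full_group)
  show ?thesis
    unfolding act_def using g * by (subst sec_sprd) (auto simp: prd_assoc)
qed

text \<open>At a unit \<open>u\<close> the action returns the arrow of \<open>F\<close> with source
  \<open>u\<close>, and these arrows exhaust \<open>F\<close>.\<close>

lemma full_group_eqI:
  assumes F: "F \<in> carrier FG" and F': "F' \<in> carrier FG"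
    and eq: "\<And>g. g \<in> mor G \<Longrightarrow> act F g = act F' g"
  shows "F = F'"
proof -
  have *: "E = sec E ` units G" if "E \<in> carrier FG" for E
  proof -
    have b: "bisection G E" "src G ` E = units G" using that by (auto simp: in_full_group)
    have "sec E ` src G ` E = E" using sec_eq[OF b(1)] by (force simp: image_image)
    with b show ?thesis by simp
  qed
  have "sec F u = sec F' u" if "u \<in> units G" for u
    using eq[of u] that F F' by (auto simp: act_def in_full_group)
  then have "sec F ` units G = sec F' ` units G" by (rule image_cong[OF refl])
  then show ?thesis using *[OF F] *[OF F'] by simp
qed

lemma act_c3_in:
  assumes "indep V [A, B, C]" "x \<in> V" "g \<in> mor G" "rng G g = x"
  shows "act (c3 A B C V) (sec A x \<cdot> g) = sec B x \<cdot> g"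
proof -
  have *: "bisection G A" "bisection G B" "x \<in> src G ` A" "x \<in> src G ` B"
    using assms by auto
  have "sec B x \<cdot> ginv G (sec A x) \<in> c3 A B C V"
    using assms(2) by (auto simp: c3_def mv_def)
  moreover have "bisection G (c3 A B C V)"
    using c3_closed[OF assms(1)] by (simp add: in_full_group)
  ultimately have "sec (c3 A B C V) (src G (sec B x \<cdot> ginv G (sec A x))) = sec B x \<cdot> ginv G (sec A x)"
    using sec_eq by blast
  then have "sec (c3 A B C V) (rng G (sec A x)) = sec B x \<cdot> ginv G (sec A x)"
    using * by simp
  then show ?thesis
    using * assms(3,4) by (simp add: act_def prd_assoc)
qed

lemma act_c3_out:
  assumes "indep V [A, B, C]" "g \<in> mor G" "rng G g \<notin> push A V" "rng G g \<notin> push B V" "rng G g \<notin> push C V"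
  shows "act (c3 A B C V) g = g"
proof -
  have "rng G g \<in> c3 A B C V"
    using assms unfolding c3_def by simp
  moreover have "bisection G (c3 A B C V)"
    using c3_closed[OF assms(1)] by (simp add: in_full_group)
  ultimately have "sec (c3 A B C V) (src G (rng G g)) = rng G g"
    using sec_eq by blast
  then show ?thesis using assms(2) by (simp add: act_def)
qed

lemma sec_notin_push:
  assumes "bisection G A" "x \<in> src G ` A" "V \<subseteq> src G ` A" "x \<notin> V"
  shows "rng G (sec A x) \<notin> push A V"
proof
  assume "rng G (sec A x) \<in> push A V"
  then obtain y where y: "y \<in> V" "rng G (sec A x) = rng G (sec A y)"
    unfolding push_eq[OF assms(1,3)] by auto
  then have "x = y" using sec_inj[OF assms(1,2)] assms(3) by blast
  with y assms(4) show False by simp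
qed

lemma act_c3:
  assumes ind: "indep U [A, B, C]" and V: "clop V" "V \<subseteq> U" and x: "x \<in> U" and g: "g \<in> mor G" "rng G g = x"
  shows "act (c3 A B C V) (sec A x \<cdot> g) = (if x \<in> V then sec B x else sec A x) \<cdot> g"
    and "act (c3 A B C V) (sec B x \<cdot> g) = (if x \<in> V then sec C x else sec B x) \<cdot> g"
    and "act (c3 A B C V) (sec C x \<cdot> g) = (if x \<in> V then sec A x else sec C x) \<cdot> g"
proof -
  have *: "act (c3 A B C V) (sec A x \<cdot> g) = (if x \<in> V then sec B x else sec A x) \<cdot> g"
    if ind: "indep U [A, B, C]" for A B C
  proof (cases "x \<in> V")
    case True
    then show ?thesis using act_c3_in[OF indep_mono[OF ind V]] g by simp
  next
    case False
    have b: "bisection G A" "U \<subseteq> src G ` A" "x \<in> src G ` A" using ind x by auto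
    have 1: "rng G (sec A x) \<in> push A U" by (rule in_pushI) (use b x in auto)
    have 2: "rng G (sec A x) \<notin> push A V" by (rule sec_notin_push) (use b x V False in auto)
    have 3: "push A U \<inter> push B U = {}" "push A U \<inter> push C U = {}" using ind by auto
    have "rng G (sec A x) \<notin> push B V" "rng G (sec A x) \<notin> push C V"
      using 1 3 push_mono[OF V(2)] by blast+
    then show ?thesis
      using act_c3_out[OF indep_mono[OF ind V], of "sec A x \<cdot> g"] 2 b g False by simp
  qed
  have r1: "indep U [B, C, A]" and r2: "indep U [C, A, B]" using ind by (auto simp: Int_commute)
  show "act (c3 A B C V) (sec A x \<cdot> g) = (if x \<in> V then sec B x else sec A x) \<cdot> g"
    by (rule *[OF ind])
  show "act (c3 A B C V) (sec B x \<cdot> g) = (if x \<in> V then sec C x else sec B x) \<cdot> g"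
    using *[OF r1] c3_rotate[of A B C] by simp
  show "act (c3 A B C V) (sec C x \<cdot> g) = (if x \<in> V then sec A x else sec C x) \<cdot> g"
    using *[OF r2] c3_rotate[of C A B] by simp
qed

lemma act_c3_other:
  assumes ind: "indep U [D, A, B, C]" and V: "clop V" "V \<subseteq> U" and x: "x \<in> U" and g: "g \<in> mor G" "rng G g = x"
  shows "act (c3 A B C V) (sec D x \<cdot> g) = sec D x \<cdot> g"
proof -
  have b: "bisection G D" "U \<subseteq> src G ` D" "x \<in> src G ` D" using ind x by auto
  have 1: "rng G (sec D x) \<in> push D U" by (rule in_pushI) (use b x in auto)
  have 3: "push D U \<inter> push A U = {}" "push D U \<inter> push B U = {}" "push D U \<inter> push C U = {}"
    using ind by auto
  have "rng G (sec D x) \<notin> push A V" "rng G (sec D x) \<notin> push B V" "rng G (sec D x) \<notin> push C V"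
    using 1 3 push_mono[OF V(2)] by blast+
  moreover have "indep V [A, B, C]" using indep_mono[OF ind V] by simp
  ultimately show ?thesis
    using act_c3_out[of V A B C "sec D x \<cdot> g"] b g by simp
qed

text \<open>Every arrow ending in the image of \<open>U\<close> under \<open>A\<close> factors
  through \<open>A\<close>. This brings an arbitrary arrow into the form on which
  \<open>act_c3\<close> and \<open>act_c3_other\<close> operate.\<close>

lemma in_pushE:
  assumes "g \<in> mor G" "rng G g \<in> push A U" "bisection G A" "U \<subseteq> src G ` A"
  obtains x g0 where "x \<in> U" "g0 \<in> mor G" "rng G g0 = x" "g = sec A x \<cdot> g0"
proof -
  obtain x where x: "x \<in> U" "rng G g = rng G (sec A x)"
    using assms by (auto simp: push_eq)
  then have "g = sec A x \<cdot> (ginv G (sec A x) \<cdot> g)" "x \<in> src G ` A"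
    using assms by (auto simp: subset_iff)
  with x assms show thesis
    by (intro that[of x "ginv G (sec A x) \<cdot> g"]) auto
qed

text \<open>Over a point of \<open>V \<inter> W\<close> this is the identity (a b c)(a d e) = (a b
  d)(a d e)(a b c) of permutations composed from right to left. Over any other point the cycle (a b
  d) is trivial and so is at least one of the other two. The relation avoids inverses so that only
  cycles have to be evaluated.\<close>

lemma c3_commutator:
  assumes ind: "indep U [A, B, C, D, E]" and V: "clop V" "V \<subseteq> U" and W: "clop W" "W \<subseteq> U"
  shows "c3 A B C V \<odot> c3 A D E W = c3 A B D (V \<inter> W) \<odot> (c3 A D E W \<odot> c3 A B C V)"
proof -
  have VW: "clop (V \<inter> W)" "V \<inter> W \<subseteq> U" using V W by auto
  have i: "indep U [A, B, C]" "indep U [A, D, E]" "indep U [A, B, D]"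
    "indep U [D, A, B, C]" "indep U [E, A, B, C]" "indep U [B, A, D, E]" "indep U [C, A, D, E]"
    "indep U [C, A, B, D]" "indep U [E, A, B, D]"
    using ind by (auto simp: Int_commute)
  have cl: "c3 A B C V \<in> carrier FG" "c3 A D E W \<in> carrier FG" "c3 A B D (V \<inter> W) \<in> carrier FG"
    using c3_closed indep_mono i(1-3) V W VW by blast+
  have cl': "c3 A B C V \<odot> c3 A D E W \<in> carrier FG" "c3 A D E W \<odot> c3 A B C V \<in> carrier FG"
    "c3 A B D (V \<inter> W) \<odot> (c3 A D E W \<odot> c3 A B C V) \<in> carrier FG"
    using cl FG.m_closed by (metis full_group_simps(1))+
  show ?thesis
  proof (rule full_group_eqI[OF cl'(1,3)])
    fix g assume g: "g \<in> mor G"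
    note rules = act_c3[OF i(1) V] act_c3[OF i(2) W] act_c3[OF i(3) VW]
      act_c3_other[OF i(4) V] act_c3_other[OF i(5) V] act_c3_other[OF i(6) W] act_c3_other[OF i(7) W]
      act_c3_other[OF i(8) VW] act_c3_other[OF i(9) VW]
    have *: "act (c3 A B C V) (act (c3 A D E W) g)
        = act (c3 A B D (V \<inter> W)) (act (c3 A D E W) (act (c3 A B C V) g))"
      if "rng G g \<in> push P U" and P: "P \<in> {A, B, C, D, E}" for P
    proof -
      have "bisection G P" "U \<subseteq> src G ` P" using P ind by auto
      from in_pushE[OF g that(1) this] obtain x g0 where x: "x \<in> U" "g0 \<in> mor G" "rng G g0 = x"
        "g = sec P x \<cdot> g0" .
      note r = rules[OF x(1-3)]
      \<comment> \<open>Twenty cases: five positions for the range of \<open>g\<close>, and whether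
        the base point lies in \<open>V\<close> and in \<open>W\<close>.\<close>
      show ?thesis
        using P unfolding x(4) by (elim insertE; cases "x \<in> V"; cases "x \<in> W") (simp_all add: r)
    qed
    show "act (c3 A B C V \<odot> c3 A D E W) g = act (c3 A B D (V \<inter> W) \<odot> (c3 A D E W \<odot> c3 A B C V)) g"
      unfolding act_sprd[OF cl(1,2) g] act_sprd[OF cl(3) cl'(2) g] act_sprd[OF cl(2,1) g]
    proof (cases "\<exists>P\<in>{A, B, C, D, E}. rng G g \<in> push P U")
      case True
      with * show "act (c3 A B C V) (act (c3 A D E W) g)
        = act (c3 A B D (V \<inter> W)) (act (c3 A D E W) (act (c3 A B C V) g))" by blast
    next
      case False
      then have "act (c3 A B C V) g = g" "act (c3 A D E W) g = g" "act (c3 A B D (V \<inter> W)) g = g"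
        using g push_mono[OF V(2)] push_mono[OF W(2)] push_mono[OF VW(2)]
        by (intro act_c3_out indep_mono[OF i(1) V] indep_mono[OF i(2) W] indep_mono[OF i(3) VW]; blast)+
      then show "act (c3 A B C V) (act (c3 A D E W) g)
        = act (c3 A B D (V \<inter> W)) (act (c3 A D E W) (act (c3 A B C V) g))" by simp
    qed
  qed
qed

lemma c3_union:
  assumes ind: "indep U [A, B, C]" and V: "clop V" "V \<subseteq> U" and W: "clop W" "W \<subseteq> U" and dis: "V \<inter> W = {}"
  shows "c3 A B C (V \<union> W) = c3 A B C V \<odot> c3 A B C W"
proof -
  have VW: "clop (V \<union> W)" "V \<union> W \<subseteq> U" using V W by auto
  have cl: "c3 A B C V \<in> carrier FG" "c3 A B C W \<in> carrier FG" "c3 A B C (V \<union> W) \<in> carrier FG"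
    using c3_closed indep_mono ind V W VW by blast+
  have cl': "c3 A B C V \<odot> c3 A B C W \<in> carrier FG"
    using cl FG.m_closed by (metis full_group_simps(1))
  show ?thesis
  proof (rule full_group_eqI[OF cl(3) cl'])
    fix g assume g: "g \<in> mor G"
    note rules = act_c3[OF ind V] act_c3[OF ind W] act_c3[OF ind VW]
    have *: "act (c3 A B C (V \<union> W)) g = act (c3 A B C V) (act (c3 A B C W) g)"
      if "rng G g \<in> push P U" and P: "P \<in> {A, B, C}" for P
    proof -
      have "bisection G P" "U \<subseteq> src G ` P" using P ind by auto
      from in_pushE[OF g that(1) this] obtain x g0 where x: "x \<in> U" "g0 \<in> mor G" "rng G g0 = x"
        "g = sec P x \<cdot> g0" .
      note r = rules[OF x(1-3)]
      have "x \<notin> V \<or> x \<notin> W" using dis by auto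
      then show ?thesis
        using P unfolding x(4) by (elim insertE; cases "x \<in> V"; cases "x \<in> W") (simp_all add: r)
    qed
    show "act (c3 A B C (V \<union> W)) g = act (c3 A B C V \<odot> c3 A B C W) g"
      unfolding act_sprd[OF cl(1,2) g]
    proof (cases "\<exists>P\<in>{A, B, C}. rng G g \<in> push P U")
      case True
      with * show "act (c3 A B C (V \<union> W)) g = act (c3 A B C V) (act (c3 A B C W) g)" by blast
    next
      case False
      then have "act (c3 A B C V) g = g" "act (c3 A B C W) g = g" "act (c3 A B C (V \<union> W)) g = g"
        using g push_mono[OF V(2)] push_mono[OF W(2)] push_mono[OF VW(2)]
        by (intro act_c3_out indep_mono[OF ind V] indep_mono[OF ind W] indep_mono[OF ind VW]; blast)+
      then show "act (c3 A B C (V \<union> W)) g = act (c3 A B C V) (act (c3 A B C W) g)" by simp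
    qed
  qed
qed

lemma c3_inverse:
  assumes ind: "indep V [A, B, C]"
  shows "c3 A C B V = inv\<^bsub>FG\<^esub> (c3 A B C V)"
proof -
  have V: "clop V" "V \<subseteq> V" using ind by auto
  have i: "indep V [A, C, B]" using ind by (auto simp: Int_commute)
  have cl: "c3 A B C V \<in> carrier FG" "c3 A C B V \<in> carrier FG"
    using c3_closed ind i by blast+
  have cl': "c3 A C B V \<odot> c3 A B C V \<in> carrier FG" "units G \<in> carrier FG"
    using cl FG.m_closed FG.one_closed by (metis full_group_simps)+
  have "c3 A C B V \<odot> c3 A B C V = units G"
  proof (rule full_group_eqI[OF cl'])
    fix g assume g: "g \<in> mor G"
    note rules = act_c3[OF ind V] act_c3[OF i V]
    have *: "act (c3 A C B V) (act (c3 A B C V) g) = g"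
      if "rng G g \<in> push P V" and P: "P \<in> {A, B, C}" for P
    proof -
      have "bisection G P" "V \<subseteq> src G ` P" using P ind by auto
      from in_pushE[OF g that(1) this] obtain x g0 where x: "x \<in> V" "g0 \<in> mor G" "rng G g0 = x"
        "g = sec P x \<cdot> g0" .
      note r = rules[OF x(1-3)]
      show ?thesis
        using P x(1) unfolding x(4) by (elim insertE) (simp_all add: r)
    qed
    have "act (c3 A C B V) (act (c3 A B C V) g) = g"
    proof (cases "\<exists>P\<in>{A, B, C}. rng G g \<in> push P V")
      case True
      with * show ?thesis by blast
    next
      case False
      then have "act (c3 A B C V) g = g" "act (c3 A C B V) g = g"
        using g by (intro act_c3_out ind i; blast)+
      then show ?thesis by simp
    qed
    then show "act (c3 A C B V \<odot> c3 A B C V) g = act (units G) g"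
      unfolding act_sprd[OF cl(2,1) g] using g by (simp add: act_def)
  qed
  then show ?thesis
    using FG.inv_equality[of "c3 A C B V" "c3 A B C V"] cl by simp
qed

text \<open>In each arrow the section of \<open>T\<close> meets its own inverse and cancels. One
  group element is thus seen over two base sets related by \<open>T\<close>, which serves both to
  move control along \<open>T\<close> and to translate germs.\<close>

lemma c3_push:
  assumes T: "bisection G T" "V \<subseteq> src G ` T" and ind: "indep (push T V) [A, B, C]"
  shows "c3 (A \<odot> T) (B \<odot> T) (C \<odot> T) V = c3 A B C (push T V)"
proof -
  have V': "x \<in> src G ` T" "rng G (sec T x) \<in> src G ` P" if "x \<in> V" "P \<in> {A, B, C}" for x P
  proof -
    show x: "x \<in> src G ` T" using that T by auto
    have "push T V \<subseteq> src G ` P" using that(2) ind by auto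
    then show "rng G (sec T x) \<in> src G ` P" using in_pushI[OF T(1) that(1) x] by auto
  qed
  have sec: "sec (P \<odot> T) x = sec P (rng G (sec T x)) \<cdot> sec T x" if "x \<in> V" "P \<in> {A, B, C}" for x P
    using sec_sprd[OF _ T(1) V'[OF that]] that ind by auto
  have mv: "mv (P \<odot> T) (Q \<odot> T) V = mv P Q (push T V)" if "P \<in> {A, B, C}" "Q \<in> {A, B, C}" for P Q
    unfolding mv_def push_eq[OF T] image_image
  proof (rule image_cong[OF refl])
    fix x assume x: "x \<in> V"
    have b: "bisection G P" "bisection G Q" using that ind by auto
    show "sec (Q \<odot> T) x \<cdot> ginv G (sec (P \<odot> T) x)
        = sec Q (rng G (sec T x)) \<cdot> ginv G (sec P (rng G (sec T x)))"
      using V'[OF x that(1)] V'[OF x that(2)] b T(1)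
      by (simp add: sec[OF x that(1)] sec[OF x that(2)] ginv_prd prd_assoc)
  qed
  have push: "push (P \<odot> T) V = push P (push T V)" if "P \<in> {A, B, C}" for P
  proof -
    have b: "bisection G P" "push T V \<subseteq> src G ` P" using that ind by auto
    have "V \<subseteq> src G ` (P \<odot> T)"
    proof
      fix x assume x: "x \<in> V"
      show "x \<in> src G ` (P \<odot> T)"
        unfolding src_sprd[OF bisectionD(1)[OF b(1)] bisectionD(1)[OF T(1)]] pull_def
        using V'[OF x that] T(1) by (intro image_eqI[of _ _ "sec T x"]) auto
    qed
    then have "push (P \<odot> T) V = (\<lambda>x. rng G (sec (P \<odot> T) x)) ` V"
      using b T(1) by (intro push_eq) auto
    also have "\<dots> = (\<lambda>x. rng G (sec P (rng G (sec T x)))) ` V"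
      using V'[OF _ that] b T(1) by (intro image_cong) (simp_all add: sec[OF _ that])
    finally show ?thesis
      unfolding push_eq[OF b] unfolding push_eq[OF T] image_image .
  qed
  show ?thesis
    unfolding c3_def by (simp add: mv push)
qed

section \<open>Germs of three-cycles\<close>

text \<open>The sets \<open>V\<close> need not contain \<open>x\<close>: the pieces of a partition have to be admitted in \<open>near_additive\<close>.\<close>

definition near :: "'a \<Rightarrow> ('a set \<Rightarrow> bool) \<Rightarrow> bool" where
  "near x P \<longleftrightarrow> (\<exists>U. clop U \<and> x \<in> U \<and> (\<forall>V. clop V \<longrightarrow> V \<subseteq> U \<longrightarrow> P V))"

lemma nearI: "clop U \<Longrightarrow> x \<in> U \<Longrightarrow> (\<And>V. clop V \<Longrightarrow> V \<subseteq> U \<Longrightarrow> P V) \<Longrightarrow> near x P"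
  by (auto simp: near_def)

lemma nearE:
  assumes "near x P"
  obtains U where "clop U" "x \<in> U" "P U" "\<And>V. clop V \<Longrightarrow> V \<subseteq> U \<Longrightarrow> P V"
  using assms by (auto simp: near_def)

lemma near_mono: "near x P \<Longrightarrow> (\<And>V. clop V \<Longrightarrow> P V \<Longrightarrow> Q V) \<Longrightarrow> near x Q"
  unfolding near_def by blast

lemma near_conj: "near x P \<Longrightarrow> near x Q \<Longrightarrow> near x (\<lambda>V. P V \<and> Q V)"
proof -
  assume "near x P" "near x Q"
  then obtain U W where "clop U" "x \<in> U" "\<And>V. clop V \<Longrightarrow> V \<subseteq> U \<Longrightarrow> P V"
    "clop W" "x \<in> W" "\<And>V. clop V \<Longrightarrow> V \<subseteq> W \<Longrightarrow> Q V"
    by (elim nearE) blast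
  then show ?thesis by (intro nearI[of "U \<inter> W"]) auto
qed

lemma near_always: "x \<in> units G \<Longrightarrow> (\<And>V. clop V \<Longrightarrow> P V) \<Longrightarrow> near x P"
  by (rule nearI[of "units G"]) auto

lemma near_ball:
  assumes "finite S" "x \<in> units G" "\<And>s. s \<in> S \<Longrightarrow> near x (P s)"
  shows "near x (\<lambda>V. \<forall>s\<in>S. P s V)"
  using assms(1,3)
proof (induction S)
  case empty
  then show ?case using assms(2) by (simp add: near_always)
next
  case (insert s S)
  then have "near x (\<lambda>V. P s V \<and> (\<forall>s\<in>S. P s V))" by (intro near_conj) auto
  then show ?case by simp
qed

lemma near_subset:
  assumes "openin (arrows G) O'" "x \<in> O'" "x \<in> units G"
  shows "near x (\<lambda>V. V \<subseteq> O')"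
  using clop_nbhd[OF assms] by (metis nearI order_trans)

lemma near_src: "openin (arrows G) A \<Longrightarrow> a \<in> A \<Longrightarrow> near (src G a) (\<lambda>V. V \<subseteq> src G ` A)"
  using openin_subset[of "arrows G" A] by (intro near_subset openin_src_image) auto

lemma near_push:
  assumes "bisection G A" "a \<in> A" "openin (arrows G) Y" "rng G a \<in> Y"
  shows "near (src G a) (\<lambda>V. push A V \<subseteq> Y)"
proof -
  let ?A = "{g \<in> A. rng G g \<in> Y}"
  have "near (src G a) (\<lambda>V. V \<subseteq> src G ` ?A)"
    using assms bisectionD openin_preimage by (intro near_src) auto
  then show ?thesis
  proof (rule near_mono)
    fix V assume V: "V \<subseteq> src G ` ?A"
    show "push A V \<subseteq> Y"
    proof
      fix y assume "y \<in> push A V"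
      then obtain g where "g \<in> A" "src G g \<in> V" "y = rng G g" by (auto simp: push_def)
      moreover then obtain h where "h \<in> A" "rng G h \<in> Y" "src G h = src G g" using V by force
      ultimately show "y \<in> Y" using inj_onD[OF bisectionD(4)[OF assms(1)]] by metis
    qed
  qed
qed

lemma near_push_disjoint:
  assumes A: "bisection G A" "a \<in> A" and B: "bisection G B" "b \<in> B"
    and ab: "src G a = src G b" "rng G a \<noteq> rng G b"
  shows "near (src G a) (\<lambda>V. push A V \<inter> push B V = {})"
proof -
  have "rng G a \<in> units G" "rng G b \<in> units G"
    using A B bisection_subset_mor by auto
  then obtain Y Z where YZ: "openin (arrows G) Y" "openin (arrows G) Z" "rng G a \<in> Y" "rng G b \<in> Z" "disjnt Y Z"
    using Hausdorff_unit_space ab(2) unfolding Hausdorff_space_def openin_unit_space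
    by (metis topspace_unit_space)
  have "near (src G a) (\<lambda>V. push A V \<subseteq> Y)" "near (src G a) (\<lambda>V. push B V \<subseteq> Z)"
    using near_push[OF A YZ(1,3)] near_push[OF B YZ(2,4)] ab(1) by auto
  from near_conj[OF this] show ?thesis
    by (rule near_mono) (use YZ(5) in \<open>auto simp: disjnt_def\<close>)
qed

text \<open>Distinct ranges are distinct points of the Hausdorff unit space, so after shrinking the
  base the whole images become disjoint.\<close>

lemma near_indep:
  assumes "list_all2 (\<in>) as As" "\<forall>A\<in>set As. bisection G A" "\<forall>a\<in>set as. src G a = x"
    "distinct (map (rng G) as)" "x \<in> units G"
  shows "near x (\<lambda>V. indep V As)"
  using assms(1-4)
proof (induction as As rule: list_all2_induct)
  case Nil
  then show ?case using assms(5) by (simp add: near_always)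
next
  case (Cons a as A As)
  have 1: "near x (\<lambda>V. indep V As)" using Cons by auto
  have 2: "near x (\<lambda>V. V \<subseteq> src G ` A)"
    using near_src[OF bisectionD(2), of A a] Cons.hyps Cons.prems by auto
  have 3: "near x (\<lambda>V. \<forall>B\<in>set As. push A V \<inter> push B V = {})"
  proof (rule near_ball[OF _ assms(5)])
    fix B assume "B \<in> set As"
    then obtain b where b: "b \<in> set as" "b \<in> B"
      using Cons.hyps(2) by (metis in_set_conv_nth list_all2_conv_all_nth)
    have "rng G a \<noteq> rng G b" using Cons.prems(3) b by (auto simp: image_iff)
    then show "near x (\<lambda>V. push A V \<inter> push B V = {})"
      using near_push_disjoint[of A a B b] b \<open>B \<in> set As\<close> Cons.hyps Cons.prems by auto
  qed simp
  show ?case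
    using near_conj[OF 1 near_conj[OF 2 3]] by (rule near_mono) (use Cons.prems in auto)
qed

text \<open>A local-to-global principle: by compactness finitely many clopen sets, on all of whose
  clopen subsets \<open>Q\<close> holds, cover \<open>U\<close>. It later yields the partition into
  blocks, extends \<open>nice\<close> from neighbourhoods to bisections and assembles three-cycles
  from their germs.\<close>

lemma near_additive:
  assumes U: "clop U" and near: "\<And>x. x \<in> U \<Longrightarrow> near x Q" and empty: "Q {}"
    and add: "\<And>V W. clop V \<Longrightarrow> clop W \<Longrightarrow> V \<subseteq> U \<Longrightarrow> W \<subseteq> U \<Longrightarrow> V \<inter> W = {} \<Longrightarrow> Q V \<Longrightarrow> Q W \<Longrightarrow> Q (V \<union> W)"
  shows "Q U"
proof -
  let ?\<W> = "{W. clop W \<and> (\<forall>V. clop V \<longrightarrow> V \<subseteq> W \<longrightarrow> Q V)}"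
  have "U \<subseteq> \<Union>?\<W>" using near unfolding near_def by blast
  moreover have "\<forall>W\<in>?\<W>. openin (arrows G) W" by (auto simp: clop_iff)
  moreover have "compactin (arrows G) U" using U by (simp add: clop_iff)
  ultimately obtain \<W> where W: "finite \<W>" "\<W> \<subseteq> ?\<W>" "U \<subseteq> \<Union>\<W>"
    unfolding compactin_def by meson
  have "clop (U \<inter> \<Union>\<W>) \<and> Q (U \<inter> \<Union>\<W>)"
    using W(1,2)
  proof (induction \<W>)
    case empty
    then show ?case using \<open>Q {}\<close> by simp
  next
    case (insert W \<W>)
    then have IH: "clop (U \<inter> \<Union>\<W>)" "Q (U \<inter> \<Union>\<W>)" and W: "clop W" "\<And>V. clop V \<Longrightarrow> V \<subseteq> W \<Longrightarrow> Q V"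
      by auto
    \<comment> \<open>Only the part of \<open>W\<close> not yet covered is added, because
      \<open>add\<close> asks for disjoint sets.\<close>
    have eq: "U \<inter> \<Union>(insert W \<W>) = (U \<inter> \<Union>\<W>) \<union> (U \<inter> W - (U \<inter> \<Union>\<W>))" by auto
    have c: "clop (U \<inter> W - (U \<inter> \<Union>\<W>))" using IH W U by simp
    then have "Q (U \<inter> W - (U \<inter> \<Union>\<W>))" by (intro W) auto
    then have "Q ((U \<inter> \<Union>\<W>) \<union> (U \<inter> W - (U \<inter> \<Union>\<W>)))"
      by (intro add IH c) auto
    then show ?case
      unfolding eq using clop_Un[OF IH(1) c] by blast
  qed
  moreover have "U \<inter> \<Union>\<W> = U" using W(3) by auto
  ultimately show ?thesis by simp
qed

lemma clop_partition:
  assumes "\<And>x. x \<in> units G \<Longrightarrow> near x P"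
  shows "\<exists>\<V>. finite \<V> \<and> \<Union>\<V> = units G \<and> disjoint \<V> \<and> (\<forall>V\<in>\<V>. clop V \<and> P V)"
proof (rule near_additive[where Q = "\<lambda>U. \<exists>\<V>. finite \<V> \<and> \<Union>\<V> = U \<and> disjoint \<V> \<and> (\<forall>V\<in>\<V>. clop V \<and> P V)"])
  show "near x (\<lambda>U. \<exists>\<V>. finite \<V> \<and> \<Union>\<V> = U \<and> disjoint \<V> \<and> (\<forall>V\<in>\<V>. clop V \<and> P V))"
    if "x \<in> units G" for x
    using assms[OF that] by (rule near_mono) (auto intro!: exI[of _ "{_}"])
next
  fix V W assume "V \<inter> W = {}"
    "\<exists>\<V>. finite \<V> \<and> \<Union>\<V> = V \<and> disjoint \<V> \<and> (\<forall>V\<in>\<V>. clop V \<and> P V)"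
    "\<exists>\<V>. finite \<V> \<and> \<Union>\<V> = W \<and> disjoint \<V> \<and> (\<forall>V\<in>\<V>. clop V \<and> P V)"
  then obtain \<V> \<W> where "finite \<V>" "\<Union>\<V> = V" "disjoint \<V>" "\<forall>V\<in>\<V>. clop V \<and> P V"
    "finite \<W>" "\<Union>\<W> = W" "disjoint \<W>" "\<forall>V\<in>\<W>. clop V \<and> P V" by blast
  with \<open>V \<inter> W = {}\<close> show "\<exists>\<V>. finite \<V> \<and> \<Union>\<V> = V \<union> W \<and> disjoint \<V> \<and> (\<forall>V\<in>\<V>. clop V \<and> P V)"
    by (intro exI[of _ "\<V> \<union> \<W>"]) (auto intro!: disjoint_union)
qed (auto intro!: exI[of _ "{}"])

lemma c3_in_perm:
  assumes H: "subgroup H FG" and ind: "indep V [A, B, C]" and c: "c3 A B C V \<in> H"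
  shows "c3 B C A V \<in> H" "c3 C A B V \<in> H" "c3 A C B V \<in> H" "c3 C B A V \<in> H" "c3 B A C V \<in> H"
proof -
  show "c3 B C A V \<in> H" "c3 C A B V \<in> H"
    using c c3_rotate[of A B C V] c3_rotate[of C A B V] by simp_all
  show "c3 A C B V \<in> H"
    using c3_inverse[OF ind] subgroup.m_inv_closed[OF H c] by simp
  then show "c3 C B A V \<in> H" "c3 B A C V \<in> H"
    using c3_rotate[of A C B V] c3_rotate[of C B A V] by simp_all
qed

lemma c3_commutator_in:
  assumes H: "subgroup H FG" and ind: "indep U [A, B, C, D, E]"
    and V: "clop V" "V \<subseteq> U" and W: "clop W" "W \<subseteq> U"
    and c: "c3 A B C V \<in> H" "c3 A D E W \<in> H"
  shows "c3 A B D (V \<inter> W) \<in> H"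
proof -
  have VW: "clop (V \<inter> W)" "V \<inter> W \<subseteq> U" using V W by auto
  have i: "indep U [A, B, D]" using ind by (auto simp: Int_commute)
  have cl: "c3 A B D (V \<inter> W) \<in> carrier FG"
    by (rule c3_closed[OF indep_mono[OF i VW]])
  note HD = subgroup.m_closed[OF H]
  have in_H: "c3 A B C V \<odot> c3 A D E W \<in> H" "c3 A D E W \<odot> c3 A B C V \<in> H"
    using HD[OF c] HD[OF c(2,1)] by simp_all
  have "c3 A B D (V \<inter> W) = (c3 A B C V \<odot> c3 A D E W) \<otimes>\<^bsub>FG\<^esub> inv\<^bsub>FG\<^esub> (c3 A D E W \<odot> c3 A B C V)"
    using c3_commutator[OF ind V W] cl in_H subgroup.mem_carrier[OF H]
    by (subst FG.inv_solve_right) auto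
  then show ?thesis
    using HD[OF in_H(1) subgroup.m_inv_closed[OF H in_H(2)]] by simp
qed

lemma c3_union_in:
  assumes H: "subgroup H FG" and "indep U [A, B, C]" "clop V" "V \<subseteq> U" "clop W" "W \<subseteq> U" "V \<inter> W = {}"
    and c: "c3 A B C V \<in> H" "c3 A B C W \<in> H"
  shows "c3 A B C (V \<union> W) \<in> H"
  using c3_union[OF assms(2-7)] subgroup.m_closed[OF H c] by simp

lemma c3_diff_in:
  assumes H: "subgroup H FG" and ind: "indep U [A, B, C]" and V: "clop V" "V \<subseteq> U"
    and W: "clop W" "W \<subseteq> V" and c: "c3 A B C V \<in> H" "c3 A B C W \<in> H"
  shows "c3 A B C (V - W) \<in> H"
proof -
  have VW: "clop (V - W)" "V - W \<subseteq> U" using V W by auto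
  have "c3 A B C V = c3 A B C (V - W) \<otimes>\<^bsub>FG\<^esub> c3 A B C W"
    using c3_union[OF ind VW W(1), of] V W by (simp add: Diff_disjoint Int_commute Un_absorb2)
  moreover have "c3 A B C (V - W) \<in> carrier FG"
    by (rule c3_closed[OF indep_mono[OF ind VW]])
  ultimately have "c3 A B C (V - W) = c3 A B C V \<otimes>\<^bsub>FG\<^esub> inv\<^bsub>FG\<^esub> (c3 A B C W)"
    using subgroup.mem_carrier[OF H] c by (subst FG.inv_solve_right) auto
  then show ?thesis
    using subgroup.m_closed[OF H c(1) subgroup.m_inv_closed[OF H c(2)]] by simp
qed

section \<open>Good triples of arrows\<close>

definition good :: "'a set set \<Rightarrow> 'a \<Rightarrow> 'a \<Rightarrow> 'a \<Rightarrow> bool" where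
  "good H a b c \<longleftrightarrow> src G b = src G a \<and> src G c = src G a \<and> distinct (map (rng G) [a, b, c])
     \<and> (\<exists>A B C. bisection G A \<and> bisection G B \<and> bisection G C \<and> a \<in> A \<and> b \<in> B \<and> c \<in> C
          \<and> near (src G a) (\<lambda>V. c3 A B C V \<in> H))"

lemma goodI:
  assumes "bisection G A" "bisection G B" "bisection G C" "a \<in> A" "b \<in> B" "c \<in> C"
    "src G b = src G a" "src G c = src G a" "distinct (map (rng G) [a, b, c])"
    "near (src G a) (\<lambda>V. c3 A B C V \<in> H)"
  shows "good H a b c"
  using assms unfolding good_def by blast

lemma good_mor: "good H a b c \<Longrightarrow> a \<in> mor G \<and> b \<in> mor G \<and> c \<in> mor G"
  unfolding good_def using bisection_subset_mor by blast

text \<open>The intersection of two bisections through one arrow is open, so their sections agree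
  near its source. Hence goodness does not depend on the bisections chosen in
  \<open>good\<close>.\<close>

lemma good_near:
  assumes g: "good H a b c" and A: "bisection G A'" "bisection G B'" "bisection G C'" "a \<in> A'" "b \<in> B'" "c \<in> C'"
  shows "near (src G a) (\<lambda>V. c3 A' B' C' V \<in> H)"
proof -
  obtain A B C where B: "bisection G A" "bisection G B" "bisection G C" "a \<in> A" "b \<in> B" "c \<in> C"
    and n: "near (src G a) (\<lambda>V. c3 A B C V \<in> H)" and d: "distinct (map (rng G) [a, b, c])"
    and s: "src G b = src G a" "src G c = src G a"
    using g unfolding good_def by blast
  have x: "src G a \<in> units G" using B bisection_subset_mor by auto
  have i: "near (src G a) (\<lambda>V. indep V [A, B, C])" "near (src G a) (\<lambda>V. indep V [A', B', C'])"
    using near_indep[of "[a, b, c]" "[A, B, C]"] near_indep[of "[a, b, c]" "[A', B', C']"] A B s x d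
    by auto
  have src: "near (src G a) (\<lambda>V. V \<subseteq> src G ` (A \<inter> A'))" "near (src G a) (\<lambda>V. V \<subseteq> src G ` (B \<inter> B'))"
    "near (src G a) (\<lambda>V. V \<subseteq> src G ` (C \<inter> C'))"
    using near_src[of "A \<inter> A'" a] near_src[of "B \<inter> B'" b] near_src[of "C \<inter> C'" c] A B s
    by (simp_all add: openin_Int bisectionD(2))
  have sec: "sec P x = sec P' x" if P: "bisection G P" "bisection G P'" "V \<subseteq> src G ` (P \<inter> P')" "x \<in> V" for P P' V x
  proof -
    obtain p where "p \<in> P" "p \<in> P'" "x = src G p" using P(3,4) by blast
    then show ?thesis using sec_eq[OF P(1)] sec_eq[OF P(2)] by simp
  qed
  show ?thesis
    using near_conj[OF near_conj[OF i] near_conj[OF n near_conj[OF src(1) near_conj[OF src(2,3)]]]]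
  proof (rule near_mono, elim conjE)
    fix V assume i: "indep V [A, B, C]" "indep V [A', B', C']" and c: "c3 A B C V \<in> H"
      and V: "V \<subseteq> src G ` (A \<inter> A')" "V \<subseteq> src G ` (B \<inter> B')" "V \<subseteq> src G ` (C \<inter> C')"
    have "c3 A B C V = c3 A' B' C' V"
      by (rule c3_cong[OF _ _ _ i]) (fact sec[OF B(1) A(1) V(1)] sec[OF B(2) A(2) V(2)] sec[OF B(3) A(3) V(3)])+
    with c show "c3 A' B' C' V \<in> H" by simp
  qed
qed

lemma good_perm:
  assumes H: "subgroup H FG" and g: "good H a b c"
  shows "good H b c a" "good H a c b"
proof -
  obtain A B C where B: "bisection G A" "bisection G B" "bisection G C" "a \<in> A" "b \<in> B" "c \<in> C"
    and n: "near (src G a) (\<lambda>V. c3 A B C V \<in> H)" and d: "distinct (map (rng G) [a, b, c])"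
    and s: "src G b = src G a" "src G c = src G a"
    using g unfolding good_def by blast
  have x: "src G a \<in> units G" using B bisection_subset_mor by auto
  have i: "near (src G a) (\<lambda>V. indep V [A, B, C])"
    using near_indep[of "[a, b, c]" "[A, B, C]"] B s x d by auto
  have "near (src G a) (\<lambda>V. c3 B C A V \<in> H)" "near (src G a) (\<lambda>V. c3 A C B V \<in> H)"
    by (rule near_mono[OF near_conj[OF i n]], use c3_in_perm[OF H] in blast)+
  note n = this
  have d: "distinct (map (rng G) [b, c, a])" "distinct (map (rng G) [a, c, b])"
    using d by auto
  show "good H b c a"
    by (rule goodI[OF B(2,3,1,5,6,4) _ _ d(1)]) (use s n in simp_all)
  show "good H a c b"
    by (rule goodI[OF B(1,3,2,4,6,5) _ _ d(2)]) (use s n in simp_all)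
qed

lemma good_commutator:
  assumes H: "subgroup H FG" and g: "good H a b c" "good H a d e"
    and dist: "distinct (map (rng G) [a, b, c, d, e])"
  shows "good H a b d"
proof -
  have s: "src G b = src G a" "src G c = src G a" "src G d = src G a" "src G e = src G a"
    using g unfolding good_def by blast+
  have "\<exists>A. bisection G A \<and> a \<in> A" if "a \<in> mor G" for a
    using bisection_nbhd[OF openin_topspace that] by blast
  then obtain A B C D E where b: "bisection G A" "bisection G B" "bisection G C" "bisection G D" "bisection G E"
    "a \<in> A" "b \<in> B" "c \<in> C" "d \<in> D" "e \<in> E"
    using good_mor[OF g(1)] good_mor[OF g(2)] by metis
  have x: "src G a \<in> units G" using good_mor[OF g(1)] by auto
  have i: "near (src G a) (\<lambda>V. indep V [A, B, C, D, E])"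
    using near_indep[of "[a, b, c, d, e]" "[A, B, C, D, E]"] b s x dist by auto
  have "near (src G a) (\<lambda>V. c3 A B C V \<in> H)" "near (src G a) (\<lambda>V. c3 A D E V \<in> H)"
    using good_near[OF g(1)] good_near[OF g(2)] b by blast+
  from near_conj[OF i near_conj[OF this]] have "near (src G a) (\<lambda>V. c3 A B D V \<in> H)"
  proof (rule near_mono, elim conjE)
    fix V assume "clop V" "indep V [A, B, C, D, E]" "c3 A B C V \<in> H" "c3 A D E V \<in> H"
    then show "c3 A B D V \<in> H"
      using c3_commutator_in[OF H, of V A B C D E V V] by simp
  qed
  then show ?thesis
    using b s dist by (intro goodI[of A B D]) auto
qed

text \<open>Right multiplication by \<open>h\<close> keeps the ranges and moves the base point to
  the source of \<open>h\<close>. A bisection through \<open>h\<close> carries small neighbourhoods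
  of the new base point into given ones of the old, and \<open>c3_push\<close> identifies the
  three-cycles over them.\<close>

lemma good_translate:
  assumes H: "subgroup H FG" and g: "good H a b c" and h: "h \<in> mor G" "rng G h = src G a"
  shows "good H (a \<cdot> h) (b \<cdot> h) (c \<cdot> h)"
proof -
  obtain A B C where b: "bisection G A" "bisection G B" "bisection G C" "a \<in> A" "b \<in> B" "c \<in> C"
    and n: "near (src G a) (\<lambda>V. c3 A B C V \<in> H)" and d: "distinct (map (rng G) [a, b, c])"
    and s: "src G b = src G a" "src G c = src G a"
    using g unfolding good_def by blast
  have m: "a \<in> mor G" "b \<in> mor G" "c \<in> mor G" using good_mor[OF g] by auto
  have x: "src G a \<in> units G" using m by auto
  obtain T where T: "bisection G T" "h \<in> T" using bisection_nbhd[OF openin_topspace h(1)] .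
  have i: "near (src G a) (\<lambda>V. indep V [A, B, C])"
    using near_indep[of "[a, b, c]" "[A, B, C]"] b s x d by auto
  obtain U where U: "clop U" "src G a \<in> U" "\<And>V. clop V \<Longrightarrow> V \<subseteq> U \<Longrightarrow> indep V [A, B, C] \<and> c3 A B C V \<in> H"
    using near_conj[OF i n] by (elim nearE) blast
  have "openin (arrows G) U" using U(1) by (simp add: clop_iff)
  then have "near (src G h) (\<lambda>V. push T V \<subseteq> U \<and> V \<subseteq> src G ` T)"
    using U(2) h T near_push[OF T, of U] near_src[OF bisectionD(2)[OF T(1)] T(2)]
    by (intro near_conj) auto
  then have "near (src G h) (\<lambda>V. c3 (A \<odot> T) (B \<odot> T) (C \<odot> T) V \<in> H)"
  proof (rule near_mono, elim conjE)
    fix V assume V: "clop V" "push T V \<subseteq> U" "V \<subseteq> src G ` T"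
    then have "indep (push T V) [A, B, C]" "c3 A B C (push T V) \<in> H"
      using U(3)[of "push T V"] T(1) by auto
    then show "c3 (A \<odot> T) (B \<odot> T) (C \<odot> T) V \<in> H"
      using c3_push[OF T(1) V(3)] by simp
  qed
  then show ?thesis
    using b T m s h d by (intro goodI[of "A \<odot> T" "B \<odot> T" "C \<odot> T"]) (auto intro: sprdI)
qed

end

section \<open>Controlled sets\<close>

text \<open>The count behind blocks of five: after three points have been excluded, two auxiliary
  points are still available.\<close>

lemma two_avoiding:
  assumes "inj_on f {..<5::nat}" "finite F" "card F \<le> 3"
  obtains p q where "p < 5" "q < 5" "p \<noteq> q" "f p \<notin> F" "f q \<notin> F"
proof -
  have "card {p\<in>{..<5}. f p \<in> F} \<le> card F"
    using assms by (intro card_inj_on_le[of f]) (auto simp: inj_on_def)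
  moreover have "card ({p\<in>{..<5}. f p \<in> F} \<union> {p\<in>{..<5}. f p \<notin> F})
      \<le> card {p\<in>{..<5}. f p \<in> F} + card {p\<in>{..<5}. f p \<notin> F}"
    by (rule card_Un_le)
  moreover have "{p\<in>{..<5}. f p \<in> F} \<union> {p\<in>{..<5}. f p \<notin> F} = {..<5}" by auto
  ultimately have "\<not> card {p\<in>{..<5}. f p \<notin> F} \<le> Suc 0" using assms(3) by simp
  then obtain p q where "p \<in> {p\<in>{..<5}. f p \<notin> F}" "q \<in> {p\<in>{..<5}. f p \<notin> F}" "p \<noteq> q"
    by (subst (asm) card_le_Suc0_iff_eq) auto
  then show thesis using that by auto
qed

text \<open>Subsets of a fixed size are connected by exchanging one element at a time: trading an
  element outside \<open>T\<close> for a missing one of \<open>T\<close> lowers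
  \<open>card (T - S)\<close>.\<close>

lemma three_subsets_exchange:
  assumes "finite S" "finite T" "card S = card T" "S \<subseteq> X" "T \<subseteq> X" "P S"
    and step: "\<And>S k l. S \<subseteq> X \<Longrightarrow> P S \<Longrightarrow> card S = card T \<Longrightarrow> k \<in> S \<Longrightarrow> l \<in> X \<Longrightarrow> l \<notin> S \<Longrightarrow> P (insert l (S - {k}))"
  shows "P T"
  using assms(1-6)
proof (induction "card (T - S)" arbitrary: S)
  case 0
  then show ?case by (metis card_0_eq card_subset_eq finite_Diff Diff_eq_empty_iff)
next
  case (Suc n)
  then obtain l where l: "l \<in> T" "l \<notin> S" by (metis DiffE card.empty all_not_in_conv nat.distinct(1))
  have "\<not> S \<subseteq> T" using Suc.prems l by (metis card_subset_eq)
  then obtain k where k: "k \<in> S" "k \<notin> T" by auto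
  let ?S = "insert l (S - {k})"
  have "T - S = insert l (T - ?S)" "l \<notin> T - ?S" using l k by auto
  then have "card (T - S) = Suc (card (T - ?S))" using Suc.prems(2) by (metis card_insert_disjoint finite_Diff)
  then have "n = card (T - ?S)" using Suc.hyps(2) by simp
  moreover have "card ?S = card T"
    using Suc.prems(1,3) k(1) l(2) card_Suc_Diff1[of S k] by simp
  moreover have "P ?S" using step Suc.prems k l by blast
  moreover have "finite ?S" "?S \<subseteq> X" using Suc.prems l by auto
  ultimately show ?case using Suc.hyps(1)[of ?S] Suc.prems by blast
qed

section \<open>Families of five bisections\<close>

context compact_etale_groupoid
begin

lemma indep_nth:
  "indep U As \<Longrightarrow> i < length As \<Longrightarrow> bisection G (As ! i) \<and> U \<subseteq> src G ` (As ! i)"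
proof (induction As arbitrary: i)
  case (Cons A As)
  then show ?case by (cases i) auto
qed simp

lemma indep_nth_disjoint:
  "indep U As \<Longrightarrow> i < length As \<Longrightarrow> j < length As \<Longrightarrow> i \<noteq> j \<Longrightarrow> push (As ! i) U \<inter> push (As ! j) U = {}"
proof (induction As arbitrary: i j)
  case (Cons A As)
  then show ?case by (cases i; cases j) (auto simp: Int_commute)
qed simp

lemma indep_nths:
  assumes "indep U As"
  shows "distinct is \<Longrightarrow> set is \<subseteq> {..<length As} \<Longrightarrow> indep U (map ((!) As) is)"
proof (induction "is")
  case Nil
  then show ?case using assms indep_clop by auto
next
  case (Cons i "is")
  then have "bisection G (As ! i) \<and> U \<subseteq> src G ` (As ! i)" "indep U (map ((!) As) is)"
    using indep_nth[OF assms] by auto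
  moreover have "push (As ! i) U \<inter> push (As ! j) U = {}" if "j \<in> set is" for j
    using Cons.prems that by (intro indep_nth_disjoint[OF assms]) auto
  ultimately show ?case by simp
qed

definition C3 :: "'a set set" where
  "C3 = {c3 A B C V | A B C V. indep V [A, B, C]}"

lemma C3I: "indep V [A, B, C] \<Longrightarrow> c3 A B C V \<in> C3"
  unfolding C3_def by blast

definition full :: "'a set set \<Rightarrow> 'a set list \<Rightarrow> 'a set \<Rightarrow> bool" where
  "full H As V \<longleftrightarrow> (\<forall>i<5. \<forall>j<5. \<forall>k<5. distinct [i, j, k] \<longrightarrow> c3 (As ! i) (As ! j) (As ! k) V \<in> H)"

text \<open>The commutator of the cycle (i j k) over \<open>V\<close> with (i l m) over
  \<open>U\<close> gives (i j l) over \<open>V\<close>. It exchanges one index, so a single cycle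
  over \<open>V\<close> reaches all triples of indices.\<close>

lemma full_propagate:
  assumes H: "subgroup H FG" and ind: "indep U As" and len: "length As = 5" and full: "full H As U"
    and V: "clop V" "V \<subseteq> U"
    and ijk: "i < 5" "j < 5" "k < 5" "distinct [i, j, k]" "c3 (As ! i) (As ! j) (As ! k) V \<in> H"
  shows "full H As V"
proof -
  have indV: "indep V As" by (rule indep_mono[OF ind V])
  \<comment> \<open>\<open>P\<close> concerns an unordered triple: by \<open>c3_in_perm\<close>, one
    ordering in \<open>H\<close> yields all six.\<close>
  define P where "P S \<longleftrightarrow> (\<forall>i j k. S = {i, j, k} \<longrightarrow> distinct [i, j, k] \<longrightarrow> c3 (As ! i) (As ! j) (As ! k) V \<in> H)" for S
  have PI: "P {i, j, k}" if "i < 5" "j < 5" "k < 5" "distinct [i, j, k]" "c3 (As ! i) (As ! j) (As ! k) V \<in> H" for i j k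
    unfolding P_def
  proof (intro allI impI)
    fix a b c assume e: "{i, j, k} = {a, b, c}" and d: "distinct [a, b, c]"
    have "indep V [As ! i, As ! j, As ! k]"
      using indep_nths[OF indV, of "[i, j, k]"] that len by simp
    note * = that(5) c3_in_perm[OF H this that(5)]
    have "a \<in> {i, j, k}" "b \<in> {i, j, k}" "c \<in> {i, j, k}" using e by auto
    then show "c3 (As ! a) (As ! b) (As ! c) V \<in> H"
      using d * by (elim insertE) auto
  qed
  have step: "P (insert l (S - {k}))"
    if "S \<subseteq> {..<5}" "P S" "card S = 3" "k \<in> S" "l \<in> {..<5}" "l \<notin> S" for S k l
  proof -
    have "card (S - {k}) = 2" using that by simp
    then obtain i j where ij: "S - {k} = {i, j}" "i \<noteq> j" by (auto simp: card_2_iff)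
    then have S: "S = {i, j, k}" using that(4) by auto
    have d: "distinct [i, j, k]" using ij by auto
    \<comment> \<open>Four indices are in use, which leaves a fifth one \<open>m\<close> as the
      auxiliary point of the commutator.\<close>
    have "card (insert l S) = 4" using that finite_subset[OF that(1)] by simp
    then have "\<not> {..<5} \<subseteq> insert l S"
      using card_mono[of "insert l S" "{..<5}"] finite_subset[OF that(1)] by auto
    then obtain m where m: "m < 5" "m \<notin> insert l S" by auto
    have dist: "distinct [i, j, k, l, m]" "i < 5" "j < 5" "k < 5" "l < 5"
      using d m S that by auto
    have 1: "c3 (As ! i) (As ! j) (As ! k) V \<in> H" using that(2) S d unfolding P_def by blast
    have 2: "c3 (As ! i) (As ! l) (As ! m) U \<in> H" using full dist m unfolding full_def by auto
    have "indep U [As ! i, As ! j, As ! k, As ! l, As ! m]"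
      using indep_nths[OF ind, of "[i, j, k, l, m]"] dist m len by simp
    from c3_commutator_in[OF H this V indep_clop[OF ind] order_refl 1 2]
    have "c3 (As ! i) (As ! j) (As ! l) V \<in> H" using V by (simp add: Int_absorb2)
    then have "P {i, j, l}" using dist by (intro PI) auto
    moreover have "{i, j, l} = insert l (S - {k})" using ij by auto
    ultimately show ?thesis by simp
  qed
  show ?thesis
    unfolding full_def
  proof (intro allI impI)
    fix a b c :: nat assume abc: "a < 5" "b < 5" "c < 5" "distinct [a, b, c]"
    have "P {a, b, c}"
    proof (rule three_subsets_exchange[where S = "{i, j, k}" and X = "{..<5}"])
      show "P {i, j, k}" using PI ijk by blast
      have "card {a, b, c} = 3" using abc by simp
      then show "P (insert l (S - {k}))"
        if "S \<subseteq> {..<5}" "P S" "card S = card {a, b, c}" "k \<in> S" "l \<in> {..<5}" "l \<notin> S" for S k l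
        using step that by metis
    qed (use abc ijk in auto)
    then show "c3 (As ! a) (As ! b) (As ! c) V \<in> H" using abc unfolding P_def by blast
  qed
qed

end

text \<open>Normalising the first bisection to \<open>units G\<close> makes \<open>x\<close> itself
  one of the five points over \<open>x\<close>, so that the blocks at the two ends of an arrow can
  be related through that arrow.\<close>

locale block_system = compact_etale_groupoid +
  fixes BB :: "'a set set" and Q :: "'a set \<Rightarrow> 'a set list"
  assumes finite_BB: "finite BB" and Union_BB: "\<Union>BB = units G" and disjoint_BB: "disjoint BB"
    and indep_Q: "U \<in> BB \<Longrightarrow> indep U (Q U)" and length_Q: "U \<in> BB \<Longrightarrow> length (Q U) = 5"
    and Q_0: "U \<in> BB \<Longrightarrow> Q U ! 0 = units G"
begin

lemma clop_BB: "U \<in> BB \<Longrightarrow> clop U"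
  using indep_Q indep_clop by blast

definition ctrl :: "'a set set \<Rightarrow> 'a set \<Rightarrow> bool" where
  "ctrl H D \<longleftrightarrow> clop D \<and> (\<forall>U\<in>BB. full H (Q U) (D \<inter> U))"

lemma ctrlD: "ctrl H D \<Longrightarrow> U \<in> BB \<Longrightarrow> full H (Q U) (D \<inter> U)"
  and ctrl_clop: "ctrl H D \<Longrightarrow> clop D"
  by (auto simp: ctrl_def)

lemma ctrl_full:
  assumes "ctrl H D" "U \<in> BB" "D \<subseteq> U"
  shows "full H (Q U) D"
  using ctrlD[OF assms(1,2)] assms(3) by (simp add: Int_absorb2)

lemma ctrl_empty: "subgroup H FG \<Longrightarrow> ctrl H {}"
  using subgroup.one_closed by (fastforce simp: ctrl_def full_def)

text \<open>With \<open>l\<close> and \<open>m\<close> the two remaining indices, the commutator of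
  (i j l) over \<open>D\<close> with (i k m) over \<open>E\<close> gives (i j k) over the
  intersection. All five members of a block take part.\<close>

lemma ctrl_Int:
  assumes H: "subgroup H FG" and D: "ctrl H D" and E: "ctrl H E"
  shows "ctrl H (D \<inter> E)"
  unfolding ctrl_def full_def
proof (intro conjI ballI allI impI)
  show "clop (D \<inter> E)" using D E ctrl_clop by simp
  fix U and i j k :: nat assume U: "U \<in> BB" and ijk: "i < 5" "j < 5" "k < 5" "distinct [i, j, k]"
  have "inj_on id {..<5::nat}" "finite {i, j, k}" "card {i, j, k} \<le> 3" by (auto simp: card_insert_if)
  then obtain l m where lm: "l < 5" "m < 5" "l \<noteq> m" "l \<notin> {i, j, k}" "m \<notin> {i, j, k}"
    by (rule two_avoiding) auto
  have 1: "c3 (Q U ! i) (Q U ! j) (Q U ! l) (D \<inter> U) \<in> H" "c3 (Q U ! i) (Q U ! k) (Q U ! m) (E \<inter> U) \<in> H"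
    using ctrlD[OF D U] ctrlD[OF E U] lm ijk unfolding full_def by auto
  have "indep U [Q U ! i, Q U ! j, Q U ! l, Q U ! k, Q U ! m]"
    using indep_nths[OF indep_Q[OF U], of "[i, j, l, k, m]"] lm ijk length_Q[OF U] by auto
  from c3_commutator_in[OF H this _ _ _ _ 1] have "c3 (Q U ! i) (Q U ! j) (Q U ! k) (D \<inter> U \<inter> (E \<inter> U)) \<in> H"
    using ctrl_clop[OF D] ctrl_clop[OF E] clop_BB[OF U] by simp
  moreover have "D \<inter> U \<inter> (E \<inter> U) = D \<inter> E \<inter> U" by auto
  ultimately show "c3 (Q U ! i) (Q U ! j) (Q U ! k) (D \<inter> E \<inter> U) \<in> H" by simp
qed

lemma ctrl_Diff_subset:
  assumes H: "subgroup H FG" and D: "ctrl H D" and E: "ctrl H E" and sub: "E \<subseteq> D"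
  shows "ctrl H (D - E)"
  unfolding ctrl_def full_def
proof (intro conjI ballI allI impI)
  show "clop (D - E)" using D E ctrl_clop by simp
  fix U and i j k :: nat assume U: "U \<in> BB" and ijk: "i < 5" "j < 5" "k < 5" "distinct [i, j, k]"
  have 1: "c3 (Q U ! i) (Q U ! j) (Q U ! k) (D \<inter> U) \<in> H" "c3 (Q U ! i) (Q U ! j) (Q U ! k) (E \<inter> U) \<in> H"
    using ctrlD[OF D U] ctrlD[OF E U] ijk unfolding full_def by auto
  have "indep U [Q U ! i, Q U ! j, Q U ! k]"
    using indep_nths[OF indep_Q[OF U], of "[i, j, k]"] ijk length_Q[OF U] by auto
  from c3_diff_in[OF H this _ _ _ _ 1] have "c3 (Q U ! i) (Q U ! j) (Q U ! k) (D \<inter> U - E \<inter> U) \<in> H"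
    using ctrl_clop[OF D] ctrl_clop[OF E] clop_BB[OF U] sub by (simp add: le_infI1)
  moreover have "D \<inter> U - E \<inter> U = (D - E) \<inter> U" by auto
  ultimately show "c3 (Q U ! i) (Q U ! j) (Q U ! k) ((D - E) \<inter> U) \<in> H" by simp
qed

lemma ctrl_Un:
  assumes H: "subgroup H FG" and u: "ctrl H (units G)" and D: "ctrl H D" and E: "ctrl H E"
  shows "ctrl H (D \<union> E)"
proof -
  have "D \<subseteq> units G" "E \<subseteq> units G" using D E ctrl_clop clop_subset by blast+
  then have "D \<union> E = units G - ((units G - D) \<inter> (units G - E))" by auto
  then show ?thesis
    using assms by (simp add: ctrl_Diff_subset ctrl_Int ctrl_clop clop_subset)
qed

lemma ctrl_Union:
  assumes H: "subgroup H FG" and u: "ctrl H (units G)" and "finite \<D>" "\<And>D. D \<in> \<D> \<Longrightarrow> ctrl H D"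
  shows "ctrl H (\<Union>\<D>)"
  using assms(3,4) by (induction \<D>) (auto simp: ctrl_empty[OF H] ctrl_Un[OF H u])

lemma ctrl_generators:
  assumes D: "clop D"
  shows "\<exists>K. finite K \<and> K \<subseteq> C3 \<and> (\<forall>H. K \<subseteq> H \<longrightarrow> ctrl H D)"
proof -
  let ?I = "{(U, i, j, k). U \<in> BB \<and> i < 5 \<and> j < 5 \<and> k < (5::nat) \<and> distinct [i, j, k]}"
  let ?f = "\<lambda>(U, i, j, k). c3 (Q U ! i) (Q U ! j) (Q U ! k) (D \<inter> U)"
  have "?I \<subseteq> BB \<times> {..<5} \<times> {..<5} \<times> {..<5}" by auto
  then have "finite ?I" by (rule finite_subset) (simp add: finite_BB)
  moreover have "?f ` ?I \<subseteq> C3"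
  proof clarify
    fix U i j k assume U: "U \<in> BB" and "i < 5" "j < 5" "k < (5::nat)" "distinct [i, j, k]"
    then have "indep U [Q U ! i, Q U ! j, Q U ! k]"
      using indep_nths[OF indep_Q[OF U], of "[i, j, k]"] length_Q[OF U] by auto
    from indep_mono[OF this] show "c3 (Q U ! i) (Q U ! j) (Q U ! k) (D \<inter> U) \<in> C3"
      using D clop_BB[OF U] by (intro C3I) simp
  qed
  moreover have "ctrl H D" if H: "?f ` ?I \<subseteq> H" for H
  proof -
    have "c3 (Q U ! i) (Q U ! j) (Q U ! k) (D \<inter> U) \<in> H"
      if "U \<in> BB" "i < 5" "j < 5" "k < 5" "distinct [i, j, k]" for U i j k
    proof -
      have "(U, i, j, k) \<in> ?I" using that by simp
      from subsetD[OF H imageI[OF this]] show ?thesis by simp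
    qed
    then show ?thesis using D by (simp add: ctrl_def full_def)
  qed
  ultimately show ?thesis by (intro exI[of _ "?f ` ?I"]) auto
qed

text \<open>The arrow with index \<open>p\<close> in the block at \<open>x\<close>. Disjointness of
  the blocks makes the description meaningful for every unit.\<close>

definition m :: "'a \<Rightarrow> nat \<Rightarrow> 'a" where
  "m x p = sec (Q (THE U. U \<in> BB \<and> x \<in> U) ! p) x"

lemma block_unique: "U \<in> BB \<Longrightarrow> W \<in> BB \<Longrightarrow> x \<in> U \<Longrightarrow> x \<in> W \<Longrightarrow> U = W"
  using disjoint_BB by (auto simp: disjoint_def)

lemma m_eq: "U \<in> BB \<Longrightarrow> x \<in> U \<Longrightarrow> m x p = sec (Q U ! p) x"
proof -
  assume U: "U \<in> BB" "x \<in> U"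
  have "(THE U. U \<in> BB \<and> x \<in> U) = U"
  proof (rule the_equality)
    show "W = U" if "W \<in> BB \<and> x \<in> W" for W
      using block_unique[OF _ U(1) _ U(2)] that by blast
  qed (use U in blast)
  then show ?thesis by (simp add: m_def)
qed

lemma block_exists:
  assumes "x \<in> units G"
  obtains U where "U \<in> BB" "x \<in> U"
  using assms Union_BB by blast

lemma m_in:
  assumes "U \<in> BB" "x \<in> U" "p < 5"
  shows "bisection G (Q U ! p)" "m x p \<in> Q U ! p" "x \<in> src G ` (Q U ! p)"
proof -
  have *: "bisection G (Q U ! p)" "U \<subseteq> src G ` (Q U ! p)"
    using indep_nth[OF indep_Q[OF assms(1)]] length_Q[OF assms(1)] assms(3) by auto
  with assms show "bisection G (Q U ! p)" "x \<in> src G ` (Q U ! p)" by auto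
  then show "m x p \<in> Q U ! p" using m_eq[OF assms(1,2)] by simp
qed

lemma m_props:
  assumes "x \<in> units G" "p < 5"
  shows "m x p \<in> mor G" "src G (m x p) = x" "m x 0 = x"
proof -
  obtain U where U: "U \<in> BB" "x \<in> U" using block_exists[OF assms(1)] .
  then show "m x p \<in> mor G" "src G (m x p) = x" "m x 0 = x"
    using m_in[OF U assms(2)] m_eq[OF U] Q_0 assms(1) by simp_all
qed

lemma inj_rng_m:
  assumes "x \<in> units G"
  shows "inj_on (\<lambda>p. rng G (m x p)) {..<5}"
proof (rule inj_onI, rule ccontr)
  fix p q :: nat assume pq: "p \<in> {..<5}" "q \<in> {..<5}" "rng G (m x p) = rng G (m x q)" "p \<noteq> q"
  obtain U where U: "U \<in> BB" "x \<in> U" using block_exists[OF assms] .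
  have "rng G (m x r) \<in> push (Q U ! r) U" if "r < 5" for r
    using in_pushI[OF m_in(1)[OF U that] U(2) m_in(3)[OF U that]] m_eq[OF U] by simp
  moreover have "push (Q U ! p) U \<inter> push (Q U ! q) U = {}"
    using indep_nth_disjoint[OF indep_Q[OF U(1)]] length_Q[OF U(1)] pq by auto
  ultimately show False using pq by (metis disjoint_iff lessThan_iff)
qed

text \<open>Here \<open>two_avoiding\<close> is applied with \<open>x\<close> among the excluded
  values. Since \<open>m x 0 = x\<close>, both indices differ from \<open>0\<close>, so together
  with \<open>0\<close> they index a three-cycle of the block.\<close>

lemma m_avoiding:
  assumes x: "x \<in> units G"
  shows "\<exists>p q. p < 5 \<and> q < 5 \<and> p \<noteq> q \<and> p \<noteq> 0 \<and> q \<noteq> 0 \<and> rng G (m x p) \<notin> {x, b, c}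
     \<and> rng G (m x q) \<notin> {x, b, c} \<and> rng G (m x p) \<noteq> rng G (m x q)"
proof -
  have "finite {x, b, c}" "card {x, b, c} \<le> 3" by (auto simp: card_insert_if)
  then obtain p q where pq: "p < 5" "q < 5" "p \<noteq> q" "rng G (m x p) \<notin> {x, b, c}" "rng G (m x q) \<notin> {x, b, c}"
    using two_avoiding[OF inj_rng_m[OF x]] by metis
  moreover have "rng G (m x p) \<noteq> rng G (m x q)"
    using inj_onD[OF inj_rng_m[OF x], of p q] pq by auto
  moreover have "rng G (m x 0) = x" using m_props(3)[OF x, of 0] x by simp
  then have "p \<noteq> 0" "q \<noteq> 0" using pq by (metis insertI1)+
  ultimately show ?thesis by blast
qed

section \<open>Links between arrows, and bisections that preserve control\<close>

definition E :: "'a set set \<Rightarrow> 'a \<Rightarrow> 'a \<Rightarrow> bool" where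
  "E H a b \<longleftrightarrow> (\<exists>c. good H a b c)"

text \<open>The chain starts at the identity arrow at the source of \<open>t\<close>, so that chains
  can be translated and concatenated along products.\<close>

definition linked :: "'a set set \<Rightarrow> 'a \<Rightarrow> bool" where
  "linked H t \<longleftrightarrow> (E H)\<^sup>*\<^sup>* (src G t) t"

lemma ED: "E H a b \<Longrightarrow> a \<in> mor G \<and> b \<in> mor G \<and> src G b = src G a \<and> rng G a \<noteq> rng G b"
proof -
  assume "E H a b"
  then obtain c where "good H a b c" unfolding E_def by blast
  then show ?thesis using good_mor[of H a b c] unfolding good_def by simp
qed

lemma rtranclp_E_src: "(E H)\<^sup>*\<^sup>* a b \<Longrightarrow> a \<in> mor G \<Longrightarrow> b \<in> mor G \<and> src G b = src G a"
  by (induction rule: rtranclp_induct) (auto dest: ED)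

lemma rtranclp_E_translate:
  assumes H: "subgroup H FG" and h: "h \<in> mor G" "rng G h = src G a" "a \<in> mor G"
  shows "(E H)\<^sup>*\<^sup>* a b \<Longrightarrow> (E H)\<^sup>*\<^sup>* (a \<cdot> h) (b \<cdot> h)"
proof (induction rule: rtranclp_induct)
  case (step b c)
  then have "src G b = src G a" using rtranclp_E_src h(3) by blast
  moreover obtain d where "good H b c d" using step(2) unfolding E_def by blast
  ultimately have "E H (b \<cdot> h) (c \<cdot> h)"
    using good_translate[OF H _ h(1)] h(2) unfolding E_def by metis
  with step show ?case by (metis rtranclp.rtrancl_into_rtrancl)
qed simp

text \<open>Translated by \<open>b\<close>, the chain from \<open>src G a\<close> to
  \<open>a\<close> runs from \<open>b\<close> to the product, and the chain from
  \<open>src G b\<close> to \<open>b\<close> leads into it.\<close>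

lemma linked_prd:
  assumes H: "subgroup H FG" and a: "a \<in> mor G" "linked H a" and b: "b \<in> mor G" "linked H b"
    and ab: "src G a = rng G b"
  shows "linked H (a \<cdot> b)"
proof -
  have "(E H)\<^sup>*\<^sup>* (src G a \<cdot> b) (a \<cdot> b)"
    using a b ab by (intro rtranclp_E_translate[OF H]) (auto simp: linked_def)
  then show ?thesis
    using b a ab unfolding linked_def by simp
qed

text \<open>The second clause is conditional because a germ of three-cycles needs restrictions to
  all small clopen sets. These become available only after the first clause has been applied along
  all products of the cover.\<close>

definition stable :: "'a set set \<Rightarrow> 'a set \<Rightarrow> bool" where
  "stable H T \<longleftrightarrow> (\<forall>D. ctrl H D \<longrightarrow> ctrl H (pull T D))
     \<and> ((\<forall>D. clop D \<longrightarrow> ctrl H D) \<longrightarrow> (\<forall>t\<in>T. linked H t))"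

text \<open>The set \<open>K\<close> depends on \<open>T\<close> alone and works for every subgroup,
  so the sets belonging to finitely many bisections can be joined before \<open>H\<close> is
  formed.\<close>

definition nice :: "'a set \<Rightarrow> bool" where
  "nice T \<longleftrightarrow> (\<exists>K. finite K \<and> K \<subseteq> C3
     \<and> (\<forall>H. subgroup H FG \<longrightarrow> K \<subseteq> H \<longrightarrow> ctrl H (units G) \<longrightarrow> stable H T))"

lemma stable_units: "stable H (units G)"
  unfolding stable_def
proof (intro conjI allI impI ballI)
  fix D assume "ctrl H D"
  moreover from this have "D \<subseteq> units G" using ctrl_clop clop_subset by blast
  then have "pull (units G) D = D" by (force simp: pull_def)
  ultimately show "ctrl H (pull (units G) D)" by simp
qed (simp add: linked_def)

lemma stable_sprd:
  assumes H: "subgroup H FG" and A: "A \<subseteq> mor G" "stable H A" and B: "B \<subseteq> mor G" "stable H B"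
  shows "stable H (A \<odot> B)"
  unfolding stable_def pull_sprd[OF A(1) B(1)]
proof (intro conjI allI impI ballI)
  fix t assume "\<forall>D. clop D \<longrightarrow> ctrl H D" and t: "t \<in> A \<odot> B"
  then have "\<And>a. a \<in> A \<Longrightarrow> linked H a" "\<And>b. b \<in> B \<Longrightarrow> linked H b"
    using A(2) B(2) unfolding stable_def by blast+
  then show "linked H t"
    using t A(1) B(1) by (elim sprdE) (auto intro: linked_prd[OF H])
qed (use A B in \<open>auto simp: stable_def\<close>)

lemma nice_sprd:
  assumes "A \<subseteq> mor G" "nice A" "B \<subseteq> mor G" "nice B"
  shows "nice (A \<odot> B)"
proof -
  obtain K L where K: "finite K" "K \<subseteq> C3" "\<And>H. subgroup H FG \<Longrightarrow> K \<subseteq> H \<Longrightarrow> ctrl H (units G) \<Longrightarrow> stable H A"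
    and L: "finite L" "L \<subseteq> C3" "\<And>H. subgroup H FG \<Longrightarrow> L \<subseteq> H \<Longrightarrow> ctrl H (units G) \<Longrightarrow> stable H B"
    using assms(2,4) unfolding nice_def by blast
  show ?thesis
    unfolding nice_def using K L stable_sprd assms(1,3) by (intro exI[of _ "K \<union> L"]) simp
qed

lemma nice_Un:
  assumes "nice A" "nice B"
  shows "nice (A \<union> B)"
proof -
  obtain K L where K: "finite K" "K \<subseteq> C3" "\<And>H. subgroup H FG \<Longrightarrow> K \<subseteq> H \<Longrightarrow> ctrl H (units G) \<Longrightarrow> stable H A"
    and L: "finite L" "L \<subseteq> C3" "\<And>H. subgroup H FG \<Longrightarrow> L \<subseteq> H \<Longrightarrow> ctrl H (units G) \<Longrightarrow> stable H B"
    using assms unfolding nice_def by blast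
  have "stable H (A \<union> B)" if H: "subgroup H FG" "K \<union> L \<subseteq> H" "ctrl H (units G)" for H
  proof -
    have "pull (A \<union> B) D = pull A D \<union> pull B D" for D by (auto simp: pull_def)
    then show ?thesis
      using K(3)[OF H(1) _ H(3)] L(3)[OF H(1) _ H(3)] H ctrl_Un[OF H(1,3)] unfolding stable_def by auto
  qed
  then show ?thesis
    unfolding nice_def using K L by (intro exI[of _ "K \<union> L"]) simp
qed

text \<open>Preimages along the restriction are cut down by \<open>V\<close>, so three-cycles that
  control \<open>V\<close> are added to the finite set.\<close>

lemma nice_restr:
  assumes "nice A" "clop V"
  shows "nice (restr A V)"
proof -
  obtain K where K: "finite K" "K \<subseteq> C3" "\<And>H. subgroup H FG \<Longrightarrow> K \<subseteq> H \<Longrightarrow> ctrl H (units G) \<Longrightarrow> stable H A"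
    using assms unfolding nice_def by blast
  obtain L where L: "finite L" "L \<subseteq> C3" "\<And>H. L \<subseteq> H \<Longrightarrow> ctrl H V"
    using ctrl_generators[OF assms(2)] by blast
  have "stable H (restr A V)" if H: "subgroup H FG" "K \<union> L \<subseteq> H" "ctrl H (units G)" for H
  proof -
    have "pull (restr A V) D = V \<inter> pull A D" for D by (auto simp: pull_def restr_def)
    moreover have "ctrl H V" using L(3) H(2) by simp
    ultimately show ?thesis
      using K(3)[OF H(1) _ H(3)] H(2) ctrl_Int[OF H(1)] unfolding stable_def by (auto simp: restr_def)
  qed
  then show ?thesis
    unfolding nice_def using K L by (intro exI[of _ "K \<union> L"]) simp
qed

lemma nice_empty: "nice {}"
  unfolding nice_def using ctrl_empty by (intro exI[of _ "{}"]) (simp add: stable_def pull_def)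

text \<open>Starting from one three-cycle of \<open>H\<close> along \<open>T\<close>, three commutators transport the restriction to \<open>D\<close> from
  the block at the range of \<open>s\<close> to the block at its source. Each needs five distinct points, of which
  blocks of five always leave enough to choose.\<close>

lemma nice_local:
  assumes s: "s \<in> mor G" "src G s \<noteq> rng G s"
  shows "\<exists>T. bisection G T \<and> s \<in> T \<and> nice T"
proof -
  define x y where "x = src G s" and "y = rng G s"
  have xy: "x \<in> units G" "y \<in> units G" "x \<noteq> y" "src G s = x" "rng G s = y"
    using s by (auto simp: x_def y_def)
  obtain X Y where X: "X \<in> BB" "x \<in> X" and Y: "Y \<in> BB" "y \<in> Y"
    using block_exists xy by metis
  \<comment> \<open>\<open>m x p\<close> completes \<open>s\<close> and \<open>x\<close> to the
    starting cycle. Only \<open>x\<close> and \<open>y\<close> have to be avoided, hence the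
    repeated entry.\<close>
  obtain p where p: "p < 5" "rng G (m x p) \<notin> {x, y, y}"
    using m_avoiding[OF xy(1), of y y] by blast
  define z where "z = rng G (m x p)"
  \<comment> \<open>The block points over \<open>y\<close> also avoid \<open>z\<close>, as the first
    commutator needs five distinct points.\<close>
  obtain q1 q2 where q: "q1 < 5" "q2 < 5" "q1 \<noteq> q2" "rng G (m y q1) \<notin> {y, x, z}" "rng G (m y q2) \<notin> {y, x, z}"
    "rng G (m y q1) \<noteq> rng G (m y q2)" "q1 \<noteq> 0" "q2 \<noteq> 0"
    using m_avoiding[OF xy(2), of x z] by blast
  \<comment> \<open>For the second commutator: the first one leaves \<open>m y q1 \<cdot> s\<close>
    in the cycle, so its range is excluded.\<close>
  obtain p1 p2 where p12: "p1 < 5" "p2 < 5" "p1 \<noteq> p2" "rng G (m x p1) \<notin> {x, y, rng G (m y q1)}"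
    "rng G (m x p2) \<notin> {x, y, rng G (m y q1)}" "rng G (m x p1) \<noteq> rng G (m x p2)" "p1 \<noteq> 0" "p2 \<noteq> 0"
    using m_avoiding[OF xy(1), of y "rng G (m y q1)"] by blast
  \<comment> \<open>For the third commutator: the point left by the second one is now the range of
    \<open>m x p1\<close>.\<close>
  obtain p3 p4 where p34: "p3 < 5" "p4 < 5" "p3 \<noteq> p4" "rng G (m x p3) \<notin> {x, y, rng G (m x p1)}"
    "rng G (m x p4) \<notin> {x, y, rng G (m x p1)}" "rng G (m x p3) \<noteq> rng G (m x p4)" "p3 \<noteq> 0" "p4 \<noteq> 0"
    using m_avoiding[OF xy(1), of y "rng G (m x p1)"] by blast
  define C A B A' B' where "C = Q X ! p" and "A = Q X ! p1" and "B = Q X ! p2"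
    and "A' = Q X ! p3" and "B' = Q X ! p4"
  define M N where "M = Q Y ! q1" and "N = Q Y ! q2"
  obtain T0 where T0: "bisection G T0" "s \<in> T0" using bisection_nbhd[OF openin_topspace s(1)] .
  note bis = m_in(1,2)[OF X p(1)] m_in(1,2)[OF X p12(1)] m_in(1,2)[OF X p12(2)]
    m_in(1,2)[OF X p34(1)] m_in(1,2)[OF X p34(2)] m_in(1,2)[OF Y q(1)] m_in(1,2)[OF Y q(2)]
  note bis = bis[folded C_def A_def B_def A'_def B'_def M_def N_def]
  note mp = m_props(1,2)[OF xy(1) p(1)] m_props(1,2)[OF xy(1) p12(1)] m_props(1,2)[OF xy(1) p12(2)]
    m_props(1,2)[OF xy(1) p34(1)] m_props(1,2)[OF xy(1) p34(2)] m_props(1,2)[OF xy(2) q(1)] m_props(1,2)[OF xy(2) q(2)]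
  have MT: "m y q1 \<cdot> s \<in> M \<odot> T0" "m y q2 \<cdot> s \<in> N \<odot> T0"
    using bis T0 mp xy by (auto intro!: sprdI)
  have sr: "src G (m y q1 \<cdot> s) = x" "src G (m y q2 \<cdot> s) = x"
    "rng G (m y q1 \<cdot> s) = rng G (m y q1)" "rng G (m y q2 \<cdot> s) = rng G (m y q2)"
    using mp(11-14) s(1) xy(4,5) by simp_all
  have d1: "distinct [y, x, z, rng G (m y q1), rng G (m y q2)]"
    using xy(3) p(2) q(4-6) by (auto simp: z_def)
  have d2: "distinct [x, y, rng G (m y q1), rng G (m x p1), rng G (m x p2)]"
    using xy(3) q(4) p12(4-6) by auto
  have d3: "distinct [x, rng G (m x p1), y, rng G (m x p3), rng G (m x p4)]"
    using xy(3) p12(4) p34(4-6) by auto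
  have n1: "near x (\<lambda>V. indep V [T0, units G, C, M \<odot> T0, N \<odot> T0])"
  proof (rule near_indep[of "[s, x, m x p, m y q1 \<cdot> s, m y q2 \<cdot> s]"])
    show "list_all2 (\<in>) [s, x, m x p, m y q1 \<cdot> s, m y q2 \<cdot> s] [T0, units G, C, M \<odot> T0, N \<odot> T0]"
      using bis T0 MT xy(1) by simp
    show "\<forall>A\<in>set [T0, units G, C, M \<odot> T0, N \<odot> T0]. bisection G A"
      using bis T0 by simp
    show "\<forall>a\<in>set [s, x, m x p, m y q1 \<cdot> s, m y q2 \<cdot> s]. src G a = x"
      using mp sr xy(1,4) by simp
    show "distinct (map (rng G) [s, x, m x p, m y q1 \<cdot> s, m y q2 \<cdot> s])"
      using d1 sr xy(1,5) by (simp add: z_def)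
  qed (rule xy(1))
  have n2: "near x (\<lambda>V. indep V [units G, T0, M \<odot> T0, A, B])"
  proof (rule near_indep[of "[x, s, m y q1 \<cdot> s, m x p1, m x p2]"])
    show "list_all2 (\<in>) [x, s, m y q1 \<cdot> s, m x p1, m x p2] [units G, T0, M \<odot> T0, A, B]"
      using bis T0 MT xy(1) by simp
    show "\<forall>A\<in>set [units G, T0, M \<odot> T0, A, B]. bisection G A"
      using bis T0 by simp
    show "\<forall>a\<in>set [x, s, m y q1 \<cdot> s, m x p1, m x p2]. src G a = x"
      using mp sr xy(1,4) by simp
    show "distinct (map (rng G) [x, s, m y q1 \<cdot> s, m x p1, m x p2])"
      using d2 sr xy(1,5) by (simp add: z_def)
  qed (rule xy(1))
  have n3: "near x (\<lambda>V. indep V [units G, A, T0, A', B'])"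
  proof (rule near_indep[of "[x, m x p1, s, m x p3, m x p4]"])
    show "list_all2 (\<in>) [x, m x p1, s, m x p3, m x p4] [units G, A, T0, A', B']"
      using bis T0 MT xy(1) by simp
    show "\<forall>A\<in>set [units G, A, T0, A', B']. bisection G A"
      using bis T0 by simp
    show "\<forall>a\<in>set [x, m x p1, s, m x p3, m x p4]. src G a = x"
      using mp sr xy(1,4) by simp
    show "distinct (map (rng G) [x, m x p1, s, m x p3, m x p4])"
      using d3 sr xy(1,5) by (simp add: z_def)
  qed (rule xy(1))
  have n4: "near x (\<lambda>V. V \<subseteq> X)"
    using X xy(1) clop_BB[OF X(1)] by (intro near_subset) (simp_all add: clop_iff)
  have n5: "near x (\<lambda>V. push T0 V \<subseteq> Y)"
    using near_push[OF T0, of Y] Y(2) clop_BB[OF Y(1)] xy(4,5) by (simp add: clop_iff)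
  \<comment> \<open>\<open>V\<close> is so small that all three quintuples are independent over it
    and that \<open>T0\<close> maps it into the single block \<open>Y\<close>; the image of any part
    of \<open>V\<close> then involves \<open>Q Y\<close> alone.\<close>
  obtain V where V: "clop V" "x \<in> V" and i1: "indep V [T0, units G, C, M \<odot> T0, N \<odot> T0]"
    and i2: "indep V [units G, T0, M \<odot> T0, A, B]" and i3: "indep V [units G, A, T0, A', B']"
    and VX: "V \<subseteq> X" and VY: "push T0 V \<subseteq> Y"
    using near_conj[OF n1 near_conj[OF n2 near_conj[OF n3 near_conj[OF n4 n5]]]] by (elim nearE) blast
  have VT: "V \<subseteq> src G ` T0" using i1 by simp
  define T where "T = restr T0 V"
  have T: "bisection G T" "s \<in> T"
    using bisection_restr[OF T0(1) V(1)] T0(2) V(2) xy(4) by (simp_all add: T_def restr_def)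
  obtain K1 where K1: "finite K1" "K1 \<subseteq> C3" "\<And>H. K1 \<subseteq> H \<Longrightarrow> ctrl H V"
    using ctrl_generators[OF V(1)] by blast
  obtain K2 where K2: "finite K2" "K2 \<subseteq> C3" "\<And>H. K2 \<subseteq> H \<Longrightarrow> ctrl H (push T0 V)"
    using ctrl_generators[OF clop_push[OF T0(1) V(1)]] by blast
  \<comment> \<open>Besides the starting cycle, \<open>K1\<close> supplies the cycles of
    \<open>Q X\<close> over \<open>V\<close>, and \<open>K2\<close> allows a controlled
    \<open>D\<close> to be cut down to the image of \<open>V\<close>.\<close>
  define K where "K = insert (c3 T0 (units G) C V) (K1 \<union> K2)"
  have "stable H T" if H: "subgroup H FG" "K \<subseteq> H" "ctrl H (units G)" for H
  proof -
    have cV: "ctrl H V" and cTV: "ctrl H (push T0 V)" using K1(3) K2(3) H(2) by (auto simp: K_def)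
    have fX: "full H (Q X) V" by (rule ctrl_full[OF cV X(1) VX])
    \<comment> \<open>The cycle in the first claim arises on the way to the second. It is recorded
      because it joins the arrows of \<open>T\<close> to their sources, as \<open>linked\<close>
      requires.\<close>
    have key: "c3 (units G) T0 A (pull T D) \<in> H" "ctrl H (pull T D)" if D: "ctrl H D" for D
    proof -
      define D' where "D' = pull T D"
      have D': "clop D'" "D' \<subseteq> V"
        using clop_pull[OF T(1) ctrl_clop[OF D]] by (auto simp: D'_def pull_def T_def restr_def)
      have push: "push T0 D' = D \<inter> push T0 V"
      proof (intro equalityI subsetI)
        fix w assume "w \<in> push T0 D'"
        then obtain t t' where t: "t \<in> T0" "w = rng G t" "t' \<in> T0" "src G t' = src G t" "src G t \<in> V" "rng G t' \<in> D"
          by (auto simp: push_def D'_def pull_def T_def restr_def)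
        then have "t' = t" using inj_onD[OF bisectionD(4)[OF T0(1)]] by blast
        with t show "w \<in> D \<inter> push T0 V" by (auto simp: push_def)
      qed (auto simp: push_def D'_def pull_def T_def restr_def)
      have "full H (Q Y) (push T0 D')"
        unfolding push using VY by (intro ctrl_full ctrl_Int H D cTV Y) auto
      then have "c3 (Q Y ! 0) (Q Y ! q1) (Q Y ! q2) (push T0 D') \<in> H"
        using q unfolding full_def by auto
      then have "c3 (units G) M N (push T0 D') \<in> H"
        by (simp add: Q_0[OF Y(1)] M_def N_def)
      moreover have "indep Y [units G, M, N]"
        using indep_nths[OF indep_Q[OF Y(1)], of "[0, q1, q2]"] q length_Q[OF Y(1)]
        by (auto simp: Q_0[OF Y(1)] M_def N_def)
      then have i0: "indep (push T0 D') [units G, M, N]"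
        by (rule indep_mono) (use clop_push[OF T0(1) D'(1)] push VY in auto)
      have "D' \<subseteq> src G ` T0" using D'(2) VT by (rule order_trans)
      from c3_push[OF T0(1) this i0] have "c3 T0 (M \<odot> T0) (N \<odot> T0) D' = c3 (units G) M N (push T0 D')"
        unfolding units_sprd[OF bisectionD(1)[OF T0(1)]] .
      ultimately have a1: "c3 T0 (M \<odot> T0) (N \<odot> T0) D' \<in> H" by simp
      have a0: "c3 T0 (units G) C V \<in> H" using H(2) by (simp add: K_def)
      have VD: "V \<inter> D' = D'" "D' \<inter> V = D'" using D' by auto
      \<comment> \<open>First commutator, pivot \<open>T0\<close>: the starting cycle over
        \<open>V\<close> meets the translated block cycle over \<open>D'\<close>, and the
        restriction to \<open>D'\<close> passes to a cycle containing
        \<open>units G\<close>.\<close>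
      have a: "c3 T0 (units G) (M \<odot> T0) D' \<in> H"
        using c3_commutator_in[OF H(1) i1 V(1) order_refl D' a0 a1] VD by simp
      have "indep D' [T0, units G, M \<odot> T0]"
        using indep_mono[OF i1 D'] by simp
      note b1 = c3_in_perm(5)[OF H(1) this a]
      have "c3 (Q X ! 0) A B V \<in> H" using fX p12 unfolding full_def A_def B_def by auto
      then have b2: "c3 (units G) A B V \<in> H" by (simp add: Q_0[OF X(1)])
      \<comment> \<open>Second commutator, pivot \<open>units G\<close>: a cycle of the block at the
        source exchanges \<open>M \<odot> T0\<close> for \<open>A\<close>.\<close>
      have b: "c3 (units G) T0 A D' \<in> H"
        using c3_commutator_in[OF H(1) i2 D' V(1) order_refl b1 b2] VD by simp
      have "indep D' [units G, T0, A]"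
        using indep_mono[OF i2 D'] by simp
      note c1 = c3_in_perm(3)[OF H(1) this b]
      have "c3 (Q X ! 0) A' B' V \<in> H" using fX p34 unfolding full_def A'_def B'_def by auto
      then have c2: "c3 (units G) A' B' V \<in> H" by (simp add: Q_0[OF X(1)])
      \<comment> \<open>Third commutator, again with pivot \<open>units G\<close>: \<open>T0\<close>
        is exchanged for \<open>A'\<close>, which leaves a cycle inside the block
        \<open>Q X\<close>.\<close>
      have c: "c3 (Q X ! 0) (Q X ! p1) (Q X ! p3) D' \<in> H"
        using c3_commutator_in[OF H(1) i3 D' V(1) order_refl c1 c2] VD
        by (simp add: Q_0[OF X(1)] A_def A'_def)
      have "p1 \<noteq> p3" using p34 by auto
      \<comment> \<open>Control of the unit space supplies all cycles of \<open>Q X\<close> over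
        \<open>X\<close>; against these, the one cycle over \<open>D'\<close> spreads to all triples
        of the block.\<close>
      then have full: "full H (Q X) D'"
        using full_propagate[OF H(1) indep_Q[OF X(1)] length_Q[OF X(1)] _ D'(1) _ _ _ _ _ c]
          ctrlD[OF H(3) X(1)] clop_subset[OF clop_BB[OF X(1)]] D' VX p12 p34 by (simp add: Int_absorb1)
      have "full H (Q U) (D' \<inter> U)" if U: "U \<in> BB" for U
      proof (cases "U = X")
        case True
        then show ?thesis using full D' VX by (simp add: Int_absorb2 subset_trans)
      next
        case False
        then have "D' \<inter> U = {}" using block_unique[OF U X(1)] D' VX by blast
        then show ?thesis using subgroup.one_closed[OF H(1)] by (simp add: full_def)
      qed
      then show "c3 (units G) T0 A (pull T D) \<in> H" "ctrl H (pull T D)"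
        using b D' by (auto simp: ctrl_def D'_def)
    qed
    have "linked H t" if all: "\<forall>D. clop D \<longrightarrow> ctrl H D" and t: "t \<in> T" for t
    proof -
      have t': "t \<in> T0" "src G t \<in> V" "t \<in> mor G" using t T0(1) bisection_subset_mor by (auto simp: T_def restr_def)
      have "near (src G t) (\<lambda>W. c3 (units G) T0 A W \<in> H)"
      proof (rule nearI[OF V(1) t'(2)])
        fix W assume W: "clop W" "W \<subseteq> V"
        \<comment> \<open>Every clopen \<open>W\<close> inside \<open>V\<close> is the preimage of
          its own image, so \<open>key\<close> reaches all of them once every clopen set is
          controlled.\<close>
        have "pull T (push T0 W) = W"
        proof (intro equalityI subsetI)
          fix w assume "w \<in> pull T (push T0 W)"
          then obtain t t' where t: "t \<in> T0" "w = src G t" "t' \<in> T0" "rng G t = rng G t'" "src G t' \<in> W"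
            by (auto simp: push_def pull_def T_def restr_def)
          then have "t' = t" using inj_onD[OF bisectionD(5)[OF T0(1)]] by metis
          with t show "w \<in> W" by auto
        next
          fix w assume w: "w \<in> W"
          then obtain t where "t \<in> T0" "w = src G t" using W VT by blast
          then show "w \<in> pull T (push T0 W)"
            using w W by (auto simp: push_def pull_def T_def restr_def)
        qed
        then show "c3 (units G) T0 A W \<in> H"
          using key(1)[of "push T0 W"] all clop_push[OF T0(1) W(1)] by simp
      qed
      moreover have "src G t \<in> src G ` A" using t'(2) i2 by auto
      moreover have "distinct (map (rng G) [src G t, t, sec A (src G t)])"
      proof -
        have "src G t \<in> push (units G) V" "rng G t \<in> push T0 V" "rng G (sec A (src G t)) \<in> push A V"
          using t' bis(3) \<open>src G t \<in> src G ` A\<close> in_pushI[of A "src G t" V]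
          by (auto simp: push_def intro!: image_eqI[of _ _ "src G t"])
        then show ?thesis using i2 t'(3) by auto
      qed
      ultimately have "good H (src G t) t (sec A (src G t))"
        using t' bis(3) T0 by (intro goodI[of "units G" T0 A]) auto
      then show ?thesis unfolding linked_def E_def by blast
    qed
    with key(2) show ?thesis unfolding stable_def by blast
  qed
  moreover have "c3 T0 (units G) C V \<in> C3" by (rule C3I) (use i1 in simp)
  then have "finite K" "K \<subseteq> C3" using K1(1,2) K2(1,2) by (simp_all add: K_def)
  ultimately have "nice T"
    unfolding nice_def by blast
  with T show ?thesis by blast
qed

text \<open>An arrow with equal source and range splits into two arrows with different ends:
  \<open>u\<close> leads from \<open>x\<close> to another point of its block, and
  \<open>s \<cdot> ginv G u\<close> leads back.\<close>

lemma nice_nbhd: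
  assumes s: "s \<in> mor G"
  shows "\<exists>T. bisection G T \<and> s \<in> T \<and> nice T"
proof (cases "src G s = rng G s")
  case True
  define x where "x = src G s"
  have x: "x \<in> units G" "src G s = x" "rng G s = x" using s True by (auto simp: x_def)
  obtain p where p: "p < 5" "rng G (m x p) \<notin> {x, x, x}"
    using m_avoiding[OF x(1), of x x] by blast
  define u where "u = m x p"
  have u: "u \<in> mor G" "src G u = x" "rng G u \<noteq> x" using m_props[OF x(1) p(1)] p by (auto simp: u_def)
  obtain A where A: "bisection G A" "u \<in> A" "nice A" using nice_local[of u] u by auto
  have su: "s \<cdot> ginv G u \<in> mor G" "src G (s \<cdot> ginv G u) = rng G u" "rng G (s \<cdot> ginv G u) = x"
    using s u x by auto
  obtain B where B: "bisection G B" "s \<cdot> ginv G u \<in> B" "nice B"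
    using nice_local[OF su(1)] su u by auto
  have "s \<cdot> ginv G u \<cdot> u = s" using s u x by (simp add: prd_assoc)
  then have "s \<in> B \<odot> A" using sprdI[OF B(2) A(2)] su by simp
  moreover have "nice (B \<odot> A)" using A B bisectionD(1) by (intro nice_sprd) auto
  ultimately show ?thesis using bisection_sprd[OF B(1) A(1)] by blast
qed (use nice_local[OF s] in blast)

text \<open>Near the source of one of its arrows \<open>F\<close> coincides with a nice bisection
  through that arrow; around any other unit its restriction is empty. Compactness joins finitely
  many restrictions.\<close>

lemma nice_bisection:
  assumes F: "bisection G F"
  shows "nice F"
proof -
  have "nice (restr F (units G))"
  proof (rule near_additive[where U = "units G"])
    fix x assume x: "x \<in> units G"
    show "near x (\<lambda>V. nice (restr F V))"
    proof (cases "x \<in> src G ` F")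
      case True
      then obtain a where a: "a \<in> F" "x = src G a" by auto
      then obtain T where T: "bisection G T" "a \<in> T" "nice T"
        using nice_nbhd bisection_subset_mor[OF F] by blast
      have "openin (arrows G) (F \<inter> T)" using F T bisectionD(2) by blast
      from near_src[OF this, of a] have "near x (\<lambda>V. V \<subseteq> src G ` (F \<inter> T))" using a T by simp
      then show ?thesis
      proof (rule near_mono)
        fix V assume V: "clop V" "V \<subseteq> src G ` (F \<inter> T)"
        have sub: "restr A V \<subseteq> restr B V" if AB: "bisection G A" "V \<subseteq> src G ` (A \<inter> B)" for A B
        proof
          fix g assume g: "g \<in> restr A V"
          then obtain h where "h \<in> A" "h \<in> B" "src G g = src G h" using AB(2) by (auto simp: restr_def)
          moreover have "g \<in> A" using g by (simp add: restr_def)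
          ultimately have "g = h" using inj_onD[OF bisectionD(4)[OF AB(1)]] by blast
          with g \<open>h \<in> B\<close> show "g \<in> restr B V" by (simp add: restr_def)
        qed
        have "restr F V = restr T V"
          using sub[OF F V(2)] sub[OF T(1)] V(2) by (auto simp: Int_commute)
        then show "nice (restr F V)" using nice_restr[OF T(3) V(1)] by simp
      qed
    next
      case False
      have "near x (\<lambda>V. V \<subseteq> units G - src G ` F)"
        using x False clop_Diff[OF clop_units clop_src[OF F]] by (intro near_subset) (auto simp: clop_iff)
      then show ?thesis
      proof (rule near_mono)
        fix V assume "V \<subseteq> units G - src G ` F"
        then have "restr F V = {}" by (auto simp: restr_def)
        then show "nice (restr F V)" using nice_empty by simp
      qed
    qed
  next
    show "nice (restr F {})" using nice_empty by (simp add: restr_def)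
  next
    fix V W assume "nice (restr F V)" "nice (restr F W)"
    moreover have "restr F (V \<union> W) = restr F V \<union> restr F W" by (auto simp: restr_def)
    ultimately show "nice (restr F (V \<union> W))" using nice_Un by simp
  qed simp
  moreover have "restr F (units G) = F" using bisection_subset_mor[OF F] by (auto simp: restr_def)
  ultimately show ?thesis by simp
qed

end

section \<open>All three-cycles\<close>

locale controlling = block_system +
  fixes H
  assumes H: "subgroup H FG"
    and ctrl_all: "clop D \<Longrightarrow> ctrl H D"
    and linked_all: "g \<in> mor G \<Longrightarrow> linked H g"
begin

lemma good_sym: "good H a b c \<Longrightarrow> good H b a c"
  and good_swap: "good H a b c \<Longrightarrow> good H a c b"
  using good_perm[OF H] by blast+

lemma E_sym: "E H a b \<Longrightarrow> E H b a"
  using good_sym unfolding E_def by blast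

lemma good_block:
  assumes b: "b \<in> mor G" and p: "p < 5" "p \<noteq> 0" and q: "q < 5" "q \<noteq> 0" and pq: "p \<noteq> q"
  shows "good H b (m (rng G b) p \<cdot> b) (m (rng G b) q \<cdot> b)"
proof -
  define y where "y = rng G b"
  have y: "y \<in> units G" using b by (simp add: y_def)
  obtain U where U: "U \<in> BB" "y \<in> U" using block_exists[OF y] by blast
  have "near (src G y) (\<lambda>V. c3 (units G) (Q U ! p) (Q U ! q) V \<in> H)"
  proof (rule nearI[OF clop_BB[OF U(1)]])
    fix V assume "clop V" "V \<subseteq> U"
    then have "full H (Q U) V" using ctrl_full[OF ctrl_all U(1)] by blast
    then have "c3 (Q U ! 0) (Q U ! p) (Q U ! q) V \<in> H"
      using p q pq unfolding full_def by auto
    then show "c3 (units G) (Q U ! p) (Q U ! q) V \<in> H" by (simp add: Q_0[OF U(1)])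
  qed (use U y in simp)
  moreover have "distinct (map (rng G) [y, m y p, m y q])"
  proof -
    have "rng G (m y 0) = y" using m_props(3)[OF y, of 0] y by simp
    then show ?thesis
      using inj_onD[OF inj_rng_m[OF y], of 0 p] inj_onD[OF inj_rng_m[OF y], of 0 q]
        inj_onD[OF inj_rng_m[OF y], of p q] p q pq y by auto
  qed
  ultimately have "good H y (m y p) (m y q)"
    using m_in(1,2)[OF U p(1)] m_in(1,2)[OF U q(1)] m_props(2)[OF y p(1)] m_props(2)[OF y q(1)] y
    by (intro goodI[of "units G" "Q U ! p" "Q U ! q"]) simp_all
  from good_translate[OF H this b] show ?thesis
    using b y by (simp add: y_def)
qed

lemma block_arrow:
  assumes "b \<in> mor G" "p < 5"
  shows "m (rng G b) p \<cdot> b \<in> mor G" "src G (m (rng G b) p \<cdot> b) = src G b"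
    "rng G (m (rng G b) p \<cdot> b) = rng G (m (rng G b) p)"
  using m_props(1,2)[of "rng G b" p] assms by simp_all

text \<open>The commutator with a block cycle at \<open>b\<close> exchanges the third arrow
  \<open>w\<close> for the block arrow with index \<open>r\<close>.\<close>

lemma good_move:
  assumes g: "good H b a w" and r: "r < 5" "rng G (m (rng G b) r) \<notin> {rng G b, rng G a, rng G w}"
  shows "good H b a (m (rng G b) r \<cdot> b)"
proof -
  have b: "b \<in> mor G" using good_mor[OF g] by simp
  then have y: "rng G b \<in> units G" by simp
  obtain p q where pq: "p < 5" "q < 5" "p \<noteq> q" "p \<noteq> 0" "q \<noteq> 0"
    "rng G (m (rng G b) p) \<notin> {rng G b, rng G a, rng G w}" "rng G (m (rng G b) q) \<notin> {rng G b, rng G a, rng G w}"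
    using m_avoiding[OF y, of "rng G a" "rng G w"] by blast
  \<comment> \<open>Two candidates are at hand because one of them may equal
    \<open>r\<close>.\<close>
  then obtain q' where q': "q' < 5" "q' \<noteq> r" "q' \<noteq> 0" "rng G (m (rng G b) q') \<notin> {rng G b, rng G a, rng G w}"
    by metis
  have "rng G (m (rng G b) 0) = rng G b" using m_props(3)[OF y, of 0] y by simp
  then have r0: "r \<noteq> 0" using r by (metis insertI1)
  have ne: "rng G (m (rng G b) r) \<noteq> rng G (m (rng G b) q')"
    using inj_onD[OF inj_rng_m[OF y], of r q'] r(1) q' by auto
  have "rng G b \<noteq> rng G a" "rng G b \<noteq> rng G w" "rng G a \<noteq> rng G w"
    using g unfolding good_def by simp_all
  then have "distinct (map (rng G) [b, a, w, m (rng G b) r \<cdot> b, m (rng G b) q' \<cdot> b])"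
    using r(2) q'(4) ne by (simp add: block_arrow[OF b r(1)] block_arrow[OF b q'(1)]) metis
  from good_commutator[OF H g good_block[OF b r(1) r0 q'(1,3)] this] q'(2) show ?thesis by blast
qed

text \<open>Compared with \<open>good_move\<close>, the range of the third arrow \<open>w\<close> is
  no longer excluded: \<open>w\<close> is first exchanged for a block arrow that avoids it, and that
  one for the arrow with index \<open>r\<close>.\<close>

lemma E_block:
  assumes ab: "E H a b" and r: "r < 5" "rng G (m (rng G b) r) \<notin> {rng G b, rng G a}"
  shows "good H b a (m (rng G b) r \<cdot> b)"
proof -
  obtain w where g: "good H b a w" using ab good_sym unfolding E_def by blast
  have b: "b \<in> mor G" using good_mor[OF g] by simp
  then have y: "rng G b \<in> units G" by simp
  obtain p where p: "p < 5" "rng G (m (rng G b) p) \<notin> {rng G b, rng G a, rng G w}"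
    using m_avoiding[OF y, of "rng G a" "rng G w"] by blast
  have gp: "good H b a (m (rng G b) p \<cdot> b)" by (rule good_move[OF g p])
  show ?thesis
  proof (cases "p = r")
    case False
    then have "rng G (m (rng G b) r) \<noteq> rng G (m (rng G b) p)"
      using inj_onD[OF inj_rng_m[OF y], of r p] r(1) p(1) by auto
    then show ?thesis
      using good_move[OF gp r(1)] r(2) block_arrow(3)[OF b p(1)] by simp
  qed (use gp in simp)
qed

text \<open>Both links are completed to good triples by different block arrows at the pivot
  \<open>b\<close>. The commutator removes these auxiliary arrows and keeps \<open>a\<close> and
  \<open>c\<close>.\<close>

lemma E_E_good:
  assumes ab: "E H a b" and bc: "E H b c" and ne: "rng G a \<noteq> rng G c"
  shows "good H b a c"
proof -
  have m: "a \<in> mor G" "b \<in> mor G" "c \<in> mor G" "rng G a \<noteq> rng G b" "rng G b \<noteq> rng G c"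
    using ED[OF ab] ED[OF bc] by auto
  then have y: "rng G b \<in> units G" by simp
  obtain p q where pq: "p < 5" "q < 5" "rng G (m (rng G b) p) \<notin> {rng G b, rng G a, rng G c}"
    "rng G (m (rng G b) q) \<notin> {rng G b, rng G a, rng G c}" "rng G (m (rng G b) p) \<noteq> rng G (m (rng G b) q)"
    using m_avoiding[OF y, of "rng G a" "rng G c"] by blast
  have 1: "good H b a (m (rng G b) p \<cdot> b)" using E_block[OF ab pq(1)] pq(3) by blast
  have 2: "good H b c (m (rng G b) q \<cdot> b)" using E_block[OF E_sym[OF bc] pq(2)] pq(4) by blast
  have "distinct (map (rng G) [b, a, m (rng G b) p \<cdot> b, c, m (rng G b) q \<cdot> b])"
    using m(4,5) ne pq(3-5) by (simp add: block_arrow[OF m(2) pq(1)] block_arrow[OF m(2) pq(2)]) metis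
  from good_commutator[OF H 1 2 this] show ?thesis .
qed

lemma E_trans: "E H a b \<Longrightarrow> E H b c \<Longrightarrow> rng G a \<noteq> rng G c \<Longrightarrow> E H a c"
  using E_E_good good_sym good_swap unfolding E_def by blast

lemma E_avoiding:
  assumes "a \<in> mor G"
  shows "\<exists>q. E H a q \<and> rng G q \<noteq> rng G a \<and> rng G q \<noteq> u \<and> rng G q \<noteq> v"
proof -
  have y: "rng G a \<in> units G" using assms by simp
  obtain p q where pq: "p < 5" "q < 5" "p \<noteq> q" "p \<noteq> 0" "q \<noteq> 0" "rng G (m (rng G a) p) \<notin> {rng G a, u, v}"
    using m_avoiding[OF y, of u v] by blast
  have "E H a (m (rng G a) p \<cdot> a)"
    using good_block[OF assms pq(1,4,2,5,3)] unfolding E_def by blast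
  moreover have "rng G (m (rng G a) p \<cdot> a) = rng G (m (rng G a) p)"
    by (rule block_arrow[OF assms pq(1)])
  ultimately show ?thesis using pq(6) by (metis insertCI)
qed

text \<open>A path of related arrows can be shortcut by \<open>E_trans\<close> except where it returns to the range of its
  starting point; there it is rerouted through a block.\<close>

lemma rtranclp_E_neighbour:
  assumes "(E H)\<^sup>*\<^sup>* a b" "a \<in> mor G"
  shows "E H a p \<Longrightarrow> rng G p \<noteq> rng G b \<Longrightarrow> E H p b"
  using assms
proof (induction arbitrary: p rule: rtranclp_induct)
  case base
  then show ?case using E_sym by blast
next
  case (step b c)
  show ?case
  proof (cases "rng G p = rng G b")
    case False
    then show ?thesis using step E_trans by blast
  next
    case True
    \<comment> \<open>\<open>p\<close> and \<open>b\<close> cannot be linked, as their ranges agree.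
      A further neighbour \<open>q\<close> of \<open>a\<close> is linked to \<open>c\<close> through
      \<open>b\<close> and to \<open>p\<close> through \<open>a\<close>, and then joins
      \<open>p\<close> to \<open>c\<close>.\<close>
    obtain q where q: "E H a q" "rng G q \<noteq> rng G p" "rng G q \<noteq> rng G c"
      using E_avoiding[OF step.prems(3)] by blast
    then have "E H q c"
      using step True E_trans by metis
    moreover have "E H p q" using E_trans[OF E_sym[OF step.prems(1)] q(1)] q(2) by metis
    ultimately show ?thesis using E_trans step.prems(2) by blast
  qed
qed

text \<open>Links are symmetric, so the chains from the common source combine to a chain from
  \<open>a\<close> to \<open>b\<close>. Shortcutting it links a neighbour \<open>q\<close> of
  \<open>a\<close> to \<open>b\<close>, and a last use of \<open>E_trans\<close> replaces
  \<open>q\<close> by \<open>a\<close>.\<close>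

lemma E_complete:
  assumes a: "a \<in> mor G" and b: "b \<in> mor G" and ab: "src G a = src G b" "rng G a \<noteq> rng G b"
  shows "E H a b"
proof -
  have "symp (E H)" using E_sym by (auto intro: sympI)
  then have "(E H)\<^sup>*\<^sup>* a (src G a)"
    using linked_all[OF a] sympD[OF symp_rtranclp] unfolding linked_def by metis
  moreover have "(E H)\<^sup>*\<^sup>* (src G a) b" using linked_all[OF b] ab(1) by (simp add: linked_def)
  ultimately have path: "(E H)\<^sup>*\<^sup>* a b" by (rule rtranclp_trans)
  obtain q where "E H a q" "rng G q \<noteq> rng G b" using E_avoiding[OF a] by blast
  then show ?thesis
    using rtranclp_E_neighbour[OF path a] E_trans ab(2) by blast
qed

lemma good_all:
  assumes "a \<in> mor G" "b \<in> mor G" "c \<in> mor G" "src G b = src G a" "src G c = src G a"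
    "distinct (map (rng G) [a, b, c])"
  shows "good H a b c"
proof -
  have ne: "rng G b \<noteq> rng G a" "rng G a \<noteq> rng G c" "rng G b \<noteq> rng G c" using assms(6) by auto
  show ?thesis
    by (rule E_E_good[OF E_complete[OF assms(2,1,4) ne(1)] E_complete[OF assms(1,3) assms(5)[symmetric] ne(2)] ne(3)])
qed

text \<open>Over each point the three sections have distinct ranges and form a good triple, so small
  restrictions of the cycle lie in \<open>H\<close>; additivity in the base set assembles the whole
  cycle.\<close>

lemma C3_subset: "C3 \<subseteq> H"
proof
  fix F assume "F \<in> C3"
  then obtain A B C U where F: "F = c3 A B C U" and i: "indep U [A, B, C]" unfolding C3_def by blast
  have "c3 A B C U \<in> H"
  proof (rule near_additive[OF indep_clop[OF i]])
    fix x assume x: "x \<in> U"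
    have b: "bisection G A" "bisection G B" "bisection G C" "x \<in> src G ` A" "x \<in> src G ` B" "x \<in> src G ` C"
      using i x by auto
    have "rng G (sec A x) \<in> push A U" "rng G (sec B x) \<in> push B U" "rng G (sec C x) \<in> push C U"
      by (intro in_pushI b x)+
    then have "distinct (map (rng G) [sec A x, sec B x, sec C x])" using i by auto
    then have "good H (sec A x) (sec B x) (sec C x)" using b by (intro good_all) simp_all
    from good_near[OF this b(1-3)] show "near x (\<lambda>V. c3 A B C V \<in> H)" using b by simp
  next
    show "c3 A B C {} \<in> H" using subgroup.one_closed[OF H] by simp
  next
    fix V W assume "clop V" "clop W" "V \<subseteq> U" "W \<subseteq> U" "V \<inter> W = {}" "c3 A B C V \<in> H" "c3 A B C W \<in> H"
    then show "c3 A B C (V \<union> W) \<in> H" using c3_union_in[OF H i] by blast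
  qed
  then show "F \<in> H" by (simp add: F)
qed

end

section \<open>The alternating full group of an expansive groupoid\<close>

lemma is_basis_openin:
  assumes "is_basis T \<B>"
  shows "F \<in> \<B> \<Longrightarrow> openin T F" and "openin T O' \<Longrightarrow> \<exists>\<U>. \<U> \<subseteq> \<B> \<and> O' = \<Union>\<U>"
proof -
  show "openin T F" if "F \<in> \<B>"
    using assms that unfolding is_basis_def union_of_def arbitrary_def by (auto intro!: exI[of _ "{F}"])
  show "\<exists>\<U>. \<U> \<subseteq> \<B> \<and> O' = \<Union>\<U>" if "openin T O'"
    using assms that unfolding is_basis_def union_of_def arbitrary_def by auto
qed

section \<open>Multisections of degree three as three-cycles\<close>

context compact_etale_groupoid
begin

text \<open>Sources of \<open>F i j\<close> lie in \<open>F i i\<close>, which acts as a right unit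
  on it, and exhaust it because \<open>F j i \<odot> F i j = F i i\<close>; dually for
  ranges.\<close>

lemma multisectionD:
  assumes F: "multisection G d F" and i: "i \<in> {1..d}" and j: "j \<in> {1..d}"
  shows "bisection G (F i j)" "src G ` F i j = F i i" "rng G ` F i j = F j j"
proof -
  have b: "bisection G (F i j)" if "i \<in> {1..d}" "j \<in> {1..d}" for i j
    using F that unfolding multisection_def by blast
  have p: "F j k \<odot> F i j = F i k" if "i \<in> {1..d}" "j \<in> {1..d}" "k \<in> {1..d}" for i j k
    using F that unfolding multisection_def by blast
  have u: "F i i \<subseteq> units G" if "i \<in> {1..d}" for i
    using F that unfolding multisection_def by blast
  note m = bisection_subset_mor[OF b]
  show "bisection G (F i j)" using b i j by blast
  show "src G ` F i j = F i i"
  proof (intro equalityI subsetI)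
    fix x assume "x \<in> src G ` F i j"
    then obtain g where "g \<in> F i j \<odot> F i i" "x = src G g" using p[OF i i j] by auto
    then obtain h v where "h \<in> F i j" "v \<in> F i i" "src G h = rng G v" "x = src G (h \<cdot> v)"
      by (auto elim: sprdE)
    then show "x \<in> F i i" using u[OF i] m[OF i j] by auto
  next
    fix x assume x: "x \<in> F i i"
    then have "x \<in> F j i \<odot> F i j" using p[OF i j i] by simp
    then obtain h g where "h \<in> F j i" "g \<in> F i j" "src G h = rng G g" "x = h \<cdot> g" by (rule sprdE)
    moreover have "src G x = x" using u[OF i] x by auto
    ultimately show "x \<in> src G ` F i j" using m[OF i j] m[OF j i] by (intro image_eqI[of _ _ g]) auto
  qed
  show "rng G ` F i j = F j j"
  proof (intro equalityI subsetI)
    fix x assume "x \<in> rng G ` F i j"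
    then obtain g where "g \<in> F j j \<odot> F i j" "x = rng G g" using p[OF i j j] by auto
    then obtain v h where "h \<in> F i j" "v \<in> F j j" "src G v = rng G h" "x = rng G (v \<cdot> h)"
      by (auto elim: sprdE)
    then show "x \<in> F j j" using u[OF j] m[OF i j] by auto
  next
    fix x assume x: "x \<in> F j j"
    then have "x \<in> F i j \<odot> F j i" using p[OF j i j] by simp
    then obtain g h where "g \<in> F i j" "h \<in> F j i" "src G g = rng G h" "x = g \<cdot> h" by (rule sprdE)
    moreover have "rng G x = x" using u[OF j] x by auto
    ultimately show "x \<in> rng G ` F i j" using m[OF i j] m[OF j i] by (intro image_eqI[of _ _ g]) auto
  qed
qed

text \<open>A multisection is determined by any one row: \<open>F i j\<close> is
  \<open>F k j\<close> times the inverse of \<open>F k i\<close>. In degree three the first row is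
  thus the data of a three-cycle over \<open>F 1 1\<close>.\<close>

lemma multisection_eq_mv:
  assumes F: "multisection G d F" and i: "i \<in> {1..d}" and j: "j \<in> {1..d}" and k: "k \<in> {1..d}"
  shows "F i j = mv (F k i) (F k j) (F k k)"
proof -
  have p: "F i j \<odot> F k i = F k j"
    using F i j k unfolding multisection_def by blast
  note ki = multisectionD[OF F k i] and kj = multisectionD[OF F k j] and ij = multisectionD[OF F i j]
  note m = bisection_subset_mor[OF ki(1)] bisection_subset_mor[OF kj(1)] bisection_subset_mor[OF ij(1)]
  show ?thesis
  proof (intro equalityI subsetI)
    fix g assume g: "g \<in> F i j"
    then have "src G g \<in> rng G ` F k i" using ki(3) ij(2) by blast
    then obtain a where a: "a \<in> F k i" "src G g = rng G a" by auto
    then have ga: "g \<cdot> a \<in> F k j" using sprdI[OF g a(1)] p by simp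
    have am: "a \<in> mor G" "g \<in> mor G" using m a g by auto
    have "sec (F k i) (src G a) = a" "sec (F k j) (src G a) = g \<cdot> a"
      using sec_eq[OF ki(1) a(1)] sec_eq[OF kj(1) ga] am a(2) by simp_all
    moreover have "g \<cdot> a \<cdot> ginv G a = g" using am a(2) by (simp add: prd_assoc)
    moreover have "src G a \<in> F k k" using a(1) ki(2) by blast
    ultimately show "g \<in> mv (F k i) (F k j) (F k k)"
      unfolding mv_def by (intro image_eqI[of _ _ "src G a"]) simp_all
  next
    fix g assume "g \<in> mv (F k i) (F k j) (F k k)"
    then obtain x where x: "x \<in> F k k" "g = sec (F k j) x \<cdot> ginv G (sec (F k i) x)" by (auto simp: mv_def)
    then have sx: "x \<in> src G ` F k i" "x \<in> src G ` F k j" using ki(2) kj(2) by auto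
    have "sec (F k j) x \<in> F i j \<odot> F k i" using sec(1)[OF kj(1) sx(2)] p by simp
    then obtain h a where h: "h \<in> F i j" "a \<in> F k i" "src G h = rng G a" "sec (F k j) x = h \<cdot> a"
      by (rule sprdE)
    have hm: "h \<in> mor G" "a \<in> mor G" using m h by auto
    have "src G a = x" using sec(3)[OF kj(1) sx(2)] h hm by simp
    then have "sec (F k i) x = a" using sec_eq[OF ki(1) h(2)] by simp
    then have "g = h" using x(2) h hm by (simp add: prd_assoc)
    then show "g \<in> F i j" using h by simp
  qed
qed

lemma atLeastAtMost_1_3: "{1..3::nat} = {1, 2, 3}"
  by auto

text \<open>The even permutations of three indices are the identity, which gives
  \<open>units G\<close>, and the two three-cycles.\<close>

lemma multisection_alt_subset:
  assumes F: "multisection G 3 F"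
  shows "multisection_alt G 3 F \<subseteq> insert (units G) C3"
proof
  fix X assume "X \<in> multisection_alt G 3 F"
  then obtain \<pi> where \<pi>: "\<pi> permutes {1..3}" "evenperm \<pi>" and X: "X = multisection_perm G 3 F \<pi>"
    by (auto simp: multisection_alt_def)
  have I: "1 \<in> {1..3::nat}" "2 \<in> {1..3::nat}" "3 \<in> {1..3::nat}" by auto
  let ?A = "F 1 1" and ?B = "F 1 2" and ?C = "F 1 3"
  have dis: "F 1 1 \<inter> F 2 2 = {}" "F 1 1 \<inter> F 3 3 = {}" "F 2 2 \<inter> F 3 3 = {}"
  proof -
    have "F i i \<inter> F j j = {}" if "i \<in> {1..3}" "j \<in> {1..3}" "i \<noteq> j" for i j
      using F that unfolding multisection_def by blast
    from this[OF I(1,2)] this[OF I(1,3)] this[OF I(2,3)]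
    show "F 1 1 \<inter> F 2 2 = {}" "F 1 1 \<inter> F 3 3 = {}" "F 2 2 \<inter> F 3 3 = {}" by simp_all
  qed
  have u: "F i i \<subseteq> units G" if "i \<in> {1..3}" for i using F that unfolding multisection_def by blast
  have push: "push (F 1 i) (F 1 1) = F i i" if "i \<in> {1..3}" for i
  proof -
    have "{a \<in> F 1 i. src G a \<in> F 1 1} = F 1 i" using multisectionD(2)[OF F I(1) that] by blast
    then show ?thesis using multisectionD(3)[OF F I(1) that] by (simp add: push_def)
  qed
  have cl: "clop (F 1 1)" using clop_bisection[OF multisectionD(1)[OF F I(1,1)] u[OF I(1)]] .
  have ind: "indep ?A [?A, ?B, ?C]" "indep ?A [?A, ?C, ?B]"
    using multisectionD[OF F I(1)] I dis cl push[OF I(1)] push[OF I(2)] push[OF I(3)] by auto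
  have mv: "mv (F 1 i) (F 1 j) ?A = F i j" if "i \<in> {1..3}" "j \<in> {1..3}" for i j
    using multisection_eq_mv[OF F that I(1)] by simp
  have dom: "multisection_domain 3 F = F 1 1 \<union> F 2 2 \<union> F 3 3"
    unfolding multisection_domain_def atLeastAtMost_1_3 by auto
  have X': "X = F 1 (\<pi> 1) \<union> F 2 (\<pi> 2) \<union> F 3 (\<pi> 3) \<union> (units G - (F 1 1 \<union> F 2 2 \<union> F 3 3))"
    unfolding X multisection_perm_def dom atLeastAtMost_1_3 by auto
  have c: "c3 ?A ?B ?C ?A = F 1 2 \<union> F 2 3 \<union> F 3 1 \<union> (units G - (F 1 1 \<union> F 2 2 \<union> F 3 3))"
    "c3 ?A ?C ?B ?A = F 1 3 \<union> F 3 2 \<union> F 2 1 \<union> (units G - (F 1 1 \<union> F 3 3 \<union> F 2 2))"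
    unfolding c3_def by (simp_all only: mv I push)
  have img: "\<pi> 1 \<in> {1, 2, 3}" "\<pi> 2 \<in> {1, 2, 3}" "\<pi> 3 \<in> {1, 2, 3}"
    using permutes_in_image[OF \<pi>(1)] unfolding atLeastAtMost_1_3 by blast+
  have inj: "\<pi> 1 \<noteq> \<pi> 2" "\<pi> 1 \<noteq> \<pi> 3" "\<pi> 2 \<noteq> \<pi> 3"
    using permutes_inj[OF \<pi>(1)] by (simp_all add: inj_eq)
  have out: "\<pi> x = x" if "x \<noteq> 1" "x \<noteq> 2" "x \<noteq> 3" for x
    using permutes_not_in[OF \<pi>(1), of x] that unfolding atLeastAtMost_1_3 by blast
  have odd: "\<pi> \<noteq> Transposition.transpose a b" if "a \<noteq> b" for a b
    using \<pi>(2) evenperm_swap[of a b] that by auto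
  consider "\<pi> 1 = 1" "\<pi> 2 = 2" "\<pi> 3 = 3" | "\<pi> 1 = 2" "\<pi> 2 = 3" "\<pi> 3 = 1" | "\<pi> 1 = 3" "\<pi> 2 = 1" "\<pi> 3 = 2"
    | "\<pi> 1 = 1" "\<pi> 2 = 3" "\<pi> 3 = 2" | "\<pi> 1 = 3" "\<pi> 2 = 2" "\<pi> 3 = 1" | "\<pi> 1 = 2" "\<pi> 2 = 1" "\<pi> 3 = 3"
    using img inj by auto
  then show "X \<in> insert (units G) C3"
  proof cases
    case 1
    then have "X = units G" unfolding X' using u[OF I(1)] u[OF I(2)] u[OF I(3)] by auto
    then show ?thesis by simp
  next
    case 2
    then have "X = c3 ?A ?B ?C ?A" unfolding X' c by simp
    then show ?thesis using C3I[OF ind(1)] by simp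
  next
    case 3
    then have "X = c3 ?A ?C ?B ?A" unfolding X' c by auto
    then show ?thesis using C3I[OF ind(2)] by simp
  next
    case 4
    have "\<pi> x = Transposition.transpose 2 3 x" for x
      using 4 out[of x] by (cases "x = 1"; cases "x = 2"; cases "x = 3") (simp_all add: Transposition.transpose_def)
    then have "\<pi> = Transposition.transpose 2 3" by blast
    then show ?thesis using odd[of 2 3] by simp
  next
    case 5
    have "\<pi> x = Transposition.transpose 1 3 x" for x
      using 5 out[of x] by (cases "x = 1"; cases "x = 2"; cases "x = 3") (simp_all add: Transposition.transpose_def)
    then have "\<pi> = Transposition.transpose 1 3" by blast
    then show ?thesis using odd[of 1 3] by simp
  next
    case 6
    have "\<pi> x = Transposition.transpose 1 2 x" for x
      using 6 out[of x] by (cases "x = 1"; cases "x = 2"; cases "x = 3") (simp_all add: Transposition.transpose_def)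
    then have "\<pi> = Transposition.transpose 1 2" by blast
    then show ?thesis using odd[of 1 2] by simp
  qed
qed

lemma mv_sprd:
  assumes "bisection G A" "bisection G B" "bisection G C" "V \<subseteq> src G ` A" "V \<subseteq> src G ` B" "V \<subseteq> src G ` C"
  shows "mv B C V \<odot> mv A B V = mv A C V"
proof -
  have V: "x \<in> src G ` A" "x \<in> src G ` B" "x \<in> src G ` C" if "x \<in> V" for x using that assms by auto
  note s = sec[OF assms(1) V(1)] sec[OF assms(2) V(2)] sec[OF assms(3) V(3)]
  have comp: "sec C x \<cdot> ginv G (sec B x) \<cdot> (sec B x \<cdot> ginv G (sec A x)) = sec C x \<cdot> ginv G (sec A x)"
    if "x \<in> V" for x
    using s(2,3,5,6,8,9)[OF that] by (simp add: prd_assoc)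
  show ?thesis
  proof (intro equalityI subsetI)
    fix g assume "g \<in> mv B C V \<odot> mv A B V"
    then obtain x y where xy: "x \<in> V" "y \<in> V"
      "src G (sec C x \<cdot> ginv G (sec B x)) = rng G (sec B y \<cdot> ginv G (sec A y))"
      "g = sec C x \<cdot> ginv G (sec B x) \<cdot> (sec B y \<cdot> ginv G (sec A y))"
      by (auto simp: mv_def elim!: sprdE)
    then have "rng G (sec B x) = rng G (sec B y)"
      using s(2,3,5,6,8,9)[OF xy(1)] s(2,3,5,6,8,9)[OF xy(2)] by simp
    then have "x = y" using sec_inj[OF assms(2) V(2) V(2)] xy by blast
    then show "g \<in> mv A C V" using xy comp by (auto simp: mv_def)
  next
    fix g assume "g \<in> mv A C V"
    then obtain x where x: "x \<in> V" "g = sec C x \<cdot> ginv G (sec A x)" by (auto simp: mv_def)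
    have "sec C x \<cdot> ginv G (sec B x) \<cdot> (sec B x \<cdot> ginv G (sec A x)) \<in> mv B C V \<odot> mv A B V"
      using x s(2,3,5,6,8,9)[OF x(1)] by (intro sprdI) (auto simp: mv_def)
    then show "g \<in> mv B C V \<odot> mv A B V" using comp[OF x(1)] x(2) by simp
  qed
qed

lemma C3_subset_multisection_alt: "C3 \<subseteq> (\<Union>F\<in>{F. multisection G 3 F}. multisection_alt G 3 F)"
proof
  fix X assume "X \<in> C3"
  then obtain A B C V where X: "X = c3 A B C V" and ind: "indep V [A, B, C]" unfolding C3_def by blast
  \<comment> \<open>Multisections are indexed from 1, lists from 0.\<close>
  define P where "P i = [A, B, C] ! (i - 1)" for i :: nat
  define F where "F i j = mv (P i) (P j) V" for i j
  have P: "bisection G (P i)" "V \<subseteq> src G ` P i" if "i \<in> {1..3}" for i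
  proof -
    have "i - 1 < length [A, B, C]" using that by auto
    from indep_nth[OF ind this] show "bisection G (P i)" "V \<subseteq> src G ` P i"
      unfolding P_def by blast+
  qed
  have V: "clop V" using ind by simp
  have diag: "F i i = push (P i) V" if "i \<in> {1..3}" for i
  proof -
    have "x \<in> src G ` P i" if "x \<in> V" for x using P(2)[OF \<open>i \<in> {1..3}\<close>] that by auto
    then show ?thesis
      unfolding F_def mv_def push_eq[OF P[OF that]] using P(1)[OF that] by (intro image_cong) simp_all
  qed
  have ms: "multisection G 3 F"
    unfolding multisection_def
  proof (intro conjI ballI impI)
    fix i j k :: nat assume i: "i \<in> {1..3}" and j: "j \<in> {1..3}"
    show "bisection G (F i j)"
      unfolding F_def by (rule mv_bisection(1)[OF P(1)[OF i] P(1)[OF j] V P(2)[OF i] P(2)[OF j]])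
    show "F j k \<odot> F i j = F i k" if "k \<in> {1..3}"
      unfolding F_def by (rule mv_sprd) (fact P[OF i] P[OF j] P[OF that])+
    show "F i i \<subseteq> units G"
      unfolding diag[OF i] using clop_subset[OF clop_push[OF P(1)[OF i] V]] .
    show "F i i \<inter> F j j = {}" if "i \<noteq> j"
      unfolding diag[OF i] diag[OF j] P_def using i j that
      by (intro indep_nth_disjoint[OF ind]) auto
  qed
  \<comment> \<open>A product of two transpositions is even; this one sends 1 to 2, 2 to 3 and 3 to
    1, in the direction of \<open>c3\<close>.\<close>
  define \<pi> :: "nat \<Rightarrow> nat" where "\<pi> = Transposition.transpose 1 2 \<circ> Transposition.transpose 2 3"
  have \<pi>: "\<pi> 1 = 2" "\<pi> 2 = 3" "\<pi> 3 = 1" by (simp_all add: \<pi>_def Transposition.transpose_def)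
  have "\<pi> permutes {1..3}"
    unfolding \<pi>_def by (intro permutes_compose permutes_swap_id) auto
  moreover have "evenperm \<pi>"
    unfolding \<pi>_def by (subst evenperm_comp) (simp_all add: permutation_swap_id evenperm_swap)
  moreover have "X = multisection_perm G 3 F \<pi>"
  proof -
    have P123: "P 1 = A" "P 2 = B" "P 3 = C" by (simp_all add: P_def)
    have d: "F 1 1 = push A V" "F 2 2 = push B V" "F 3 3 = push C V"
      using diag[of 1] diag[of 2] diag[of 3] P123 by simp_all
    have dom: "multisection_domain 3 F = push A V \<union> push B V \<union> push C V"
      unfolding multisection_domain_def atLeastAtMost_1_3 using d by auto
    have "F 1 2 = mv A B V" "F 2 3 = mv B C V" "F 3 1 = mv C A V"
      unfolding F_def P123 by (rule refl)+
    then have "(\<Union>i\<in>{1..3}. F i (\<pi> i)) = mv A B V \<union> mv B C V \<union> mv C A V"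
      unfolding atLeastAtMost_1_3 by (simp only: UN_insert UN_empty \<pi> Un_empty_right Un_assoc)
    then show ?thesis
      unfolding X c3_def multisection_perm_def dom by simp
  qed
  ultimately have "X \<in> multisection_alt G 3 F" unfolding multisection_alt_def by blast
  with ms show "X \<in> (\<Union>F\<in>{F. multisection G 3 F}. multisection_alt G 3 F)" by blast
qed

lemma C3_carrier: "C3 \<subseteq> carrier FG"
  using c3_closed unfolding C3_def by blast

lemma carrier_alternating_full_group: "carrier (alternating_full_group G) = generate FG C3"
proof -
  let ?Gen = "\<Union>F\<in>{F. multisection G 3 F}. multisection_alt G 3 F"
  have sub: "subgroup (generate FG C3) FG" by (rule FG.generate_is_subgroup[OF C3_carrier])
  have "?Gen \<subseteq> insert (units G) C3" using multisection_alt_subset by blast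
  also have "\<dots> \<subseteq> generate FG C3"
    using subgroup.one_closed[OF sub] generate.incl[of _ C3 FG] by auto
  finally have "generate FG ?Gen \<subseteq> generate FG C3" using sub by (rule FG.generate_subgroup_incl)
  moreover have "generate FG C3 \<subseteq> generate FG ?Gen"
    by (rule FG.mono_generate[OF C3_subset_multisection_alt])
  ultimately show ?thesis by (simp add: alternating_full_group_def)
qed

lemma finitely_generated_alternating:
  assumes K: "finite K" "K \<subseteq> C3" and C3: "C3 \<subseteq> generate FG K"
  shows "finitely_generated_group (alternating_full_group G)"
proof -
  define A where "A = generate FG C3"
  have sub: "subgroup A FG" unfolding A_def by (rule FG.generate_is_subgroup[OF C3_carrier])
  have eq: "alternating_full_group G = FG\<lparr>carrier := A\<rparr>"
    using carrier_alternating_full_group by (simp add: alternating_full_group_def A_def)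
  have KA: "K \<subseteq> A" using K(2) generate.incl[of _ C3 FG] unfolding A_def by auto
  have "subgroup (generate FG K) FG"
    by (rule FG.generate_is_subgroup) (use K(2) C3_carrier in auto)
  then have "A \<subseteq> generate FG K" unfolding A_def by (rule FG.generate_subgroup_incl[OF C3])
  moreover have "generate FG K \<subseteq> A" by (rule FG.generate_subgroup_incl[OF KA sub])
  ultimately have "generate FG K = A" by blast
  then show ?thesis
    unfolding finitely_generated_group_def eq FG.generate_consistent[OF KA sub, symmetric]
    using K(1) KA FG.generate_consistent[OF KA sub] FG.subgroup_imp_group[OF sub]
    by (auto intro!: exI[of _ K])
qed

text \<open>Four orbit points other than \<open>x\<close> are ranges of arrows starting at
  \<open>x\<close>. The unit \<open>x\<close> is the fifth arrow, which puts \<open>units G\<close>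
  at the head of the list.\<close>

lemma five_arrows:
  assumes x: "x \<in> units G" and orb: "infinite (orbit G x) \<or> 5 \<le> card (orbit G x)"
  shows "near x (\<lambda>V. \<exists>Ps. indep V Ps \<and> length Ps = 5 \<and> Ps ! 0 = units G)"
proof -
  have "infinite (orbit G x - {x}) \<or> 4 \<le> card (orbit G x - {x})"
    using orb by (auto simp: card_Diff_singleton_if)
  then obtain S where S: "S \<subseteq> orbit G x - {x}" "finite S" "card S = 4"
    by (metis infinite_arbitrarily_large obtain_subset_with_card_n card.infinite not_numeral_le_zero)
  then obtain ys where ys: "distinct ys" "set ys = S" by (metis finite_distinct_list)
  have "\<forall>y\<in>S. \<exists>g. g \<in> mor G \<and> src G g = x \<and> rng G g = y" using S(1) unfolding orbit_def by blast
  then obtain \<gamma> where \<gamma>: "\<And>y. y \<in> S \<Longrightarrow> \<gamma> y \<in> mor G \<and> src G (\<gamma> y) = x \<and> rng G (\<gamma> y) = y" by metis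
  have "\<forall>y\<in>S. \<exists>A. bisection G A \<and> \<gamma> y \<in> A"
    using \<gamma> bisection_nbhd[OF openin_topspace] by metis
  then obtain \<beta> where \<beta>: "\<And>y. y \<in> S \<Longrightarrow> bisection G (\<beta> y) \<and> \<gamma> y \<in> \<beta> y" by metis
  have "map (rng G \<circ> \<gamma>) ys = map id ys" using \<gamma> ys(2) by (intro map_cong) auto
  then have rng: "map (rng G) (map \<gamma> ys) = ys" by simp
  have "near x (\<lambda>V. indep V (units G # map \<beta> ys))"
  proof (rule near_indep[of "x # map \<gamma> ys"])
    show "list_all2 (\<in>) (x # map \<gamma> ys) (units G # map \<beta> ys)"
      using x \<beta> ys(2) by (simp add: list.rel_map list_all2_same)
    show "\<forall>A\<in>set (units G # map \<beta> ys). bisection G A" using \<beta> ys(2) by simp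
    show "\<forall>a\<in>set (x # map \<gamma> ys). src G a = x" using \<gamma> ys(2) x by simp
    show "distinct (map (rng G) (x # map \<gamma> ys))" using rng ys S(1) x by auto
  qed (rule x)
  moreover have "length (units G # map \<beta> ys) = 5" using distinct_card[OF ys(1)] ys(2) S(3) by simp
  ultimately show ?thesis
    by (auto elim!: near_mono intro!: exI[of _ "units G # map \<beta> ys"])
qed

end

section \<open>Finite generation from an expansive cover\<close>

context block_system
begin

lemma stable_family_pow:
  assumes H: "subgroup H FG" and C: "\<And>F. F \<in> \<C> \<Longrightarrow> bisection G F \<and> stable H F"
  shows "F \<in> family_pow G \<C> n \<Longrightarrow> F \<subseteq> mor G \<and> stable H F"
proof (induction n arbitrary: F)
  case 0
  then show ?case using stable_units units_subset by simp
next
  case (Suc n)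
  then obtain A B where "A \<in> \<C>" "B \<in> family_pow G \<C> n" "F = A \<odot> B" by auto
  then show ?case
    using C Suc.IH stable_sprd[OF H] sprd_closed bisectionD(1) by metis
qed

lemma expansive_C3_finitely_generated:
  assumes C: "finite \<C>" "\<forall>F\<in>\<C>. bisection G F" and ex: "expansive_family G \<C>"
  shows "\<exists>K. finite K \<and> K \<subseteq> C3 \<and> C3 \<subseteq> generate FG K"
proof -
  define \<C>' where "\<C>' = \<C> \<union> subset_inv G ` \<C>"
  have C': "finite \<C>'" "\<And>F. F \<in> \<C>' \<Longrightarrow> bisection G F"
    using C by (auto simp: \<C>'_def subset_inv_def)
  define \<B> where "\<B> = (\<Union>n\<in>{1..}. family_pow G \<C>' n)"
  have basis: "is_basis (arrows G) \<B>"
    using ex by (simp add: expansive_family_def \<B>_def \<C>'_def)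
  have "\<forall>F\<in>\<C>'. \<exists>K. finite K \<and> K \<subseteq> C3
     \<and> (\<forall>H. subgroup H FG \<longrightarrow> K \<subseteq> H \<longrightarrow> ctrl H (units G) \<longrightarrow> stable H F)"
    using nice_bisection C'(2) unfolding nice_def by blast
  then obtain k where k: "\<And>F. F \<in> \<C>' \<Longrightarrow> finite (k F)" "\<And>F. F \<in> \<C>' \<Longrightarrow> k F \<subseteq> C3"
    "\<And>F H. F \<in> \<C>' \<Longrightarrow> subgroup H FG \<Longrightarrow> k F \<subseteq> H \<Longrightarrow> ctrl H (units G) \<Longrightarrow> stable H F"
    by metis
  obtain K0 where K0: "finite K0" "K0 \<subseteq> C3" "\<And>H. K0 \<subseteq> H \<Longrightarrow> ctrl H (units G)"
    using ctrl_generators[OF clop_units] by blast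
  \<comment> \<open>\<open>K0\<close> starts the process with control of the unit space; each member
    of the cover or its inverse contributes the finite set given by \<open>nice\<close>.\<close>
  define K where "K = K0 \<union> (\<Union>F\<in>\<C>'. k F)"
  have K: "finite K" "K \<subseteq> C3" using K0(1,2) k(1,2) C'(1) by (auto simp: K_def)
  define H where "H = generate FG K"
  have H: "subgroup H FG"
    unfolding H_def by (rule FG.generate_is_subgroup) (use K C3_carrier in auto)
  have KH: "K \<subseteq> H" using generate.incl[of _ K FG] by (auto simp: H_def)
  have cu: "ctrl H (units G)" using K0(3) KH by (auto simp: K_def)
  have st: "bisection G F \<and> stable H F" if "F \<in> \<C>'" for F
  proof -
    have "k F \<subseteq> H" using KH that by (auto simp: K_def)
    then show ?thesis using k(3)[OF that H _ cu] C'(2)[OF that] by blast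
  qed
  have stB: "F \<subseteq> mor G \<and> stable H F" if "F \<in> \<B>" for F
    using that stable_family_pow[OF H st] unfolding \<B>_def by blast
  have ctrl: "ctrl H D" if D: "clop D" for D
  proof -
    obtain \<U> where U: "\<U> \<subseteq> \<B>" "D = \<Union>\<U>"
      using is_basis_openin(2)[OF basis, of D] D by (auto simp: clop_iff)
    have "\<forall>F\<in>\<U>. openin (arrows G) F" using U(1) is_basis_openin(1)[OF basis] by blast
    moreover have "compactin (arrows G) D" using D by (simp add: clop_iff)
    ultimately obtain \<V> where V: "finite \<V>" "\<V> \<subseteq> \<U>" "D \<subseteq> \<Union>\<V>"
      using U(2) unfolding compactin_def by (metis order_refl)
    \<comment> \<open>A basis member consisting of units is its own source, hence the preimage of
      the unit space along itself.\<close>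
    have "ctrl H F" if "F \<in> \<V>" for F
    proof -
      have F: "F \<subseteq> units G" "F \<in> \<B>" using that V(2) U clop_subset[OF D] by auto
      then have "pull F (units G) = F"
        using pull_units[of F] stB by simp
      moreover have "ctrl H (pull F (units G))" using stB[OF F(2)] cu unfolding stable_def by blast
      ultimately show ?thesis by simp
    qed
    then have "ctrl H (\<Union>\<V>)" using ctrl_Union[OF H cu V(1)] by blast
    moreover have "\<Union>\<V> = D" using V U(2) by blast
    ultimately show ?thesis by simp
  qed
  \<comment> \<open>Full control releases the second clause of \<open>stable\<close> for every
    product of the cover, and these products contain all arrows.\<close>
  have linked: "linked H g" if g: "g \<in> mor G" for g
  proof -
    obtain \<U> where U: "\<U> \<subseteq> \<B>" "mor G = \<Union>\<U>"
      using is_basis_openin(2)[OF basis openin_topspace] by (elim exE conjE)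
    obtain F where F: "g \<in> F" "F \<in> \<U>" using g unfolding U(2) by (rule UnionE)
    then have "stable H F" using stB U(1) by blast
    then have "(\<forall>D. clop D \<longrightarrow> ctrl H D) \<longrightarrow> (\<forall>t\<in>F. linked H t)"
      unfolding stable_def by (rule conjunct2)
    then show ?thesis using ctrl F(1) by simp
  qed
  interpret controlling G BB Q H
    by (intro controlling.intro controlling_axioms.intro block_system_axioms) (fact H ctrl linked)+
  have "C3 \<subseteq> generate FG K" using C3_subset by (simp add: H_def)
  with K show ?thesis by blast
qed

end

theorem theorem5p6:
  fixes G :: "'a groupoid_data"
  assumes "etale_groupoid G"
    and "unit_space G homeomorphic_space cantor_space"
    and "expansive G"
    and "\<And>x. x \<in> units G \<Longrightarrow> infinite (orbit G x) \<or> 5 \<le> card (orbit G x)"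
  shows "finitely_generated_group (alternating_full_group G)"
proof -
  have "compact_space cantor_space" "Hausdorff_space cantor_space"
    unfolding cantor_space_def
    by (simp_all add: compact_space_product_topology compact_space_discrete_topology
        Hausdorff_space_product_topology)
  then have top: "compact_space (unit_space G)" "Hausdorff_space (unit_space G)"
    using assms(2) homeomorphic_compact_space homeomorphic_Hausdorff_space by blast+
  interpret compact_etale_groupoid G
    by (intro compact_etale_groupoid.intro compact_etale_groupoid_axioms.intro) (fact assms(1) top)+
  have blocks: "near x (\<lambda>V. \<exists>Ps. indep V Ps \<and> length Ps = 5 \<and> Ps ! 0 = units G)" if "x \<in> units G" for x
    using that assms(4)[OF that] by (rule five_arrows)
  have "\<exists>BB. finite BB \<and> \<Union>BB = units G \<and> disjoint BB
      \<and> (\<forall>U\<in>BB. clop U \<and> (\<exists>Ps. indep U Ps \<and> length Ps = 5 \<and> Ps ! 0 = units G))"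
    by (rule clop_partition) (rule blocks)
  then obtain BB where BB: "finite BB" "\<Union>BB = units G" "disjoint BB"
    "\<forall>U\<in>BB. clop U \<and> (\<exists>Ps. indep U Ps \<and> length Ps = 5 \<and> Ps ! 0 = units G)"
    by (elim exE conjE)
  then have "\<forall>U\<in>BB. \<exists>Ps. indep U Ps \<and> length Ps = 5 \<and> Ps ! 0 = units G" by blast
  from bchoice[OF this] obtain Q where Q: "\<forall>U\<in>BB. indep U (Q U) \<and> length (Q U) = 5 \<and> Q U ! 0 = units G"
    by (rule exE)
  interpret block_system G BB Q
    by (intro block_system.intro block_system_axioms.intro compact_etale_groupoid_axioms)
      (use BB(1-3) Q in blast)+
  obtain S \<C> where C: "bisection_cover G S \<C>" "expansive_family G \<C>"
    using assms(3) unfolding expansive_def by blast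
  then have "finite \<C>" "\<forall>F\<in>\<C>. bisection G F" unfolding bisection_cover_def by blast+
  from expansive_C3_finitely_generated[OF this C(2)]
  obtain K where "finite K" "K \<subseteq> C3" "C3 \<subseteq> generate FG K" by (elim exE conjE)
  then show ?thesis by (rule finitely_generated_alternating)
qed

end
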